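(* Let $A,B\subset\mathbb{R}^d$ be Borel sets. Then: (i) $\dim_{\mathcal S}(A+B)\geq \dim_{\mathcal F}A+\dim_{\mathcal H}B$. (ii) If $\dim_{\mathcal F}A+\dim_{\mathcal H}B>d$, then $\mathcal{L}^d(A+B)>0$. (iii) If, for $0<u<d$, $\dim_{\mathcal F}A+\dim_{\mathcal H}B>u$, then $\dim_{\mathcal H}(A+B)\geq u$.
   Context: Here $d\geq 1$, $A+B=\{a+b: a\in A, b\in B\}$, $\mathcal{L}^d$ is Lebesgue measure on $\mathbb{R}^d$, and $\dim_{\mathcal H}$ is Hausdorff dimension. For $A\subset\mathbb{R}^d$, $\mathcal{M}(A)$ is the set of non-zero Radon measures on $\mathbb{R}^d$ with compact support contained in $A$. The Fourier transform of a measure $\mu$ is $\widehat{\mu}(\xi)=\int e^{-2\pi i\xi\cdot x}\,d\mu(x)$, $\xi\in\mathbb{R}^d$. The Fourier dimension of $A$ is $\dim_{\mathcal F}A=\sup\{s\leq d:\ \exists \mu\in\mathcal{M}(A)\text{ and a constant } C>0 \text{ such that } |\widehat{\mu}(x)|\leq C(1+|x|)^{-s/2}\text{ for all }x\in\mathbb{R}^d\}$. A set $A\subset\mathbb{R}^d$ is said to have Sobolev dimension $\dim_{\mathcal S}A\geq s$ if $A$ carries a Borel probability measure $\mu$ such that $\int|\widehat{\mu}(x)|^2(1+|x|)^{s-d}\,dx<\infty$.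
   Formalization: The Sobolev dimension is taken as the supremum of all s for which the set carries such a measure; attaining the endpoint s fails already for A=B={0}. All dimensions of the empty set are taken to be minus infinity. *)

theory Defs
  imports "HOL-Probability.Probability" "HOL-Library.Set_Algebras"
begin

text \<open>
  All three dimensions below are suprema taken in \<^typ>\<open>ereal\<close>, and each of them assigns
  \<^term>\<open>-\<infinity>\<close> to the empty set and a value \<open>\<ge> 0\<close> to every nonempty set.
  The ambient space \<open>\<real>\<^sup>d\<close> is an arbitrary euclidean space \<^typ>\<open>'a\<close> with \<open>d = DIM('a)\<close>.
\<close>

definition radon_measure :: "'a::euclidean_space measure \<Rightarrow> bool" where
  "radon_measure \<mu> \<longleftrightarrow>
     sets \<mu> = sets borel \<and>
     (\<forall>K. compact K \<longrightarrow> emeasure \<mu> K < \<infinity>) \<and>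
     (\<forall>V. open V \<longrightarrow> emeasure \<mu> V = (SUP K\<in>{K. compact K \<and> K \<subseteq> V}. emeasure \<mu> K)) \<and>
     (\<forall>E\<in>sets borel. emeasure \<mu> E = (INF V\<in>{V. open V \<and> E \<subseteq> V}. emeasure \<mu> V))"

definition measure_support :: "'a::euclidean_space measure \<Rightarrow> 'a set" where
  "measure_support \<mu> = - \<Union>{V. open V \<and> emeasure \<mu> V = 0}"

definition radon_measures_on :: "'a::euclidean_space set \<Rightarrow> 'a measure set" where
  "radon_measures_on A =
     {\<mu>. radon_measure \<mu> \<and> emeasure \<mu> UNIV \<noteq> 0 \<and>
          compact (measure_support \<mu>) \<and> measure_support \<mu> \<subseteq> A}"

definition fourier_transform :: "'a::euclidean_space measure \<Rightarrow> 'a \<Rightarrow> complex" where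
  "fourier_transform \<mu> \<xi> = (LINT x|\<mu>. exp (- 2 * of_real pi * \<i> * of_real (\<xi> \<bullet> x)))"

definition fourier_dim :: "'a::euclidean_space set \<Rightarrow> ereal" where
  "fourier_dim A = Sup (ereal ` {s. s \<le> real DIM('a) \<and>
     (\<exists>\<mu>\<in>radon_measures_on A. \<exists>C>0. \<forall>x.
        cmod (fourier_transform \<mu> x) \<le> C * (1 + norm x) powr (- s / 2))})"

text \<open>
  The measure is carried by \<open>A\<close> in the sense that the complement of \<open>A\<close> is contained in a
  null set; the set \<open>A\<close> itself need not be Borel (a sum of two Borel sets is in general only
  analytic).
\<close>

definition carries_sobolev_measure :: "'a::euclidean_space set \<Rightarrow> real \<Rightarrow> bool" where
  "carries_sobolev_measure A s \<longleftrightarrow>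
     (\<exists>\<mu>::'a measure. prob_space \<mu> \<and> sets \<mu> = sets borel \<and> (AE x in \<mu>. x \<in> A) \<and>
        (\<integral>\<^sup>+ x. ennreal ((cmod (fourier_transform \<mu> x))\<^sup>2 *
             (1 + norm x) powr (s - real DIM('a))) \<partial>lborel) < \<infinity>)"

definition sobolev_dim :: "'a::euclidean_space set \<Rightarrow> ereal" where
  "sobolev_dim A = Sup (ereal ` {s. carries_sobolev_measure A s})"

text \<open>
  The \<open>s\<close>-th power of the diameter, with the convention \<open>0\<^sup>0 = 1\<close> for nonempty sets (whereas
  \<^term>\<open>0 powr 0 = (0::real)\<close>), so that the \<open>0\<close>-dimensional Hausdorff measure is the
  counting measure.
\<close>

definition diameter_power :: "real \<Rightarrow> 'a::euclidean_space set \<Rightarrow> real" where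
  "diameter_power s U =
     (if U = {} then 0 else if s = 0 then 1 else diameter U powr s)"

definition hausdorff_content :: "real \<Rightarrow> real \<Rightarrow> 'a::euclidean_space set \<Rightarrow> ennreal" where
  "hausdorff_content \<delta> s E =
     (INF U\<in>{U::nat \<Rightarrow> 'a set. E \<subseteq> (\<Union>i. U i) \<and> (\<forall>i. bounded (U i) \<and> diameter (U i) \<le> \<delta>)}.
        \<Sum>i. ennreal (diameter_power s (U i)))"

definition hausdorff_measure :: "real \<Rightarrow> 'a::euclidean_space set \<Rightarrow> ennreal" where
  "hausdorff_measure s E = (SUP \<delta>\<in>{0<..}. hausdorff_content \<delta> s E)"

definition hausdorff_dim :: "'a::euclidean_space set \<Rightarrow> ereal" where
  "hausdorff_dim E = Sup (ereal ` {s. 0 \<le> s \<and> hausdorff_measure s E > 0})"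

end

theory Submission
  imports Defs
begin

text \<open>
  The sum set is measured by a convolution. Frostman's lemma gives a measure \<open>\<nu>\<close> with compact support
  in \<open>B\<close> and \<open>\<nu> (cball x r) \<le> C r\<^sup>\<beta>\<close>; integrating against Gaussians turns this into
  (with \<open>F\<close> the Fourier transform) \<open>\<integral> |F \<nu>|\<^sup>2 (1 + |\<xi>|)\<^bsup>t - d\<^esup> < \<infinity>\<close> for \<open>t < \<beta>\<close>, and multiplying by the decay of the transform of a
  measure on \<open>A\<close> shows that the convolution has finite Sobolev energy of every order below the sum
  of the dimensions. Conversely, again by the Gaussian identity, a measure \<open>\<rho>\<close> of finite energy of order \<open>v\<close>
  has \<open>(\<rho> \<otimes> \<rho>) {|x - y| \<le> r} \<le> C r\<^sup>v\<close>. For \<open>v = d\<close>, the Cauchy-Schwarz inequality for \<open>x \<mapsto> \<rho> (cball x r)\<close>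
  bounds the volume of the support from below, and for \<open>u < v\<close> the bound \<open>\<rho> (cball x r) \<le> r\<^sup>u\<close> holds for small \<open>r\<close>
  off a set of small measure, so the mass distribution principle applies.

  Choquet's capacitability theorem is used twice: with dyadic net contents, to pass from the
  Borel set \<open>B\<close> to a compact subset in Frostman's lemma, and with Lebesgue outer measure, because
  \<open>A + B\<close> is in general only analytic and \<^term>\<open>emeasure lebesgue\<close> vanishes on non-measurable sets.
\<close>

subsection \<open>Analytic sets and capacitability\<close>

text \<open>Contents are computed on digit sequences rather than on cubes in space. Cylinders are
  open and any two of them are nested or disjoint, whereas closed dyadic cubes share faces. A cover
  therefore shrinks canonically to its minimal words, and this gives the continuity along increasing
  sequences that Choquet's theorem asks for. The same tree carries the Frostman flow; reading the
  flow as nested intervals realises the measure as an image of Lebesgue measure on an interval, so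
  no weak limit is taken. Gaussians take the place of Riesz kernels because their transform is
  explicit and positive and everything is absolutely integrable. One identity, summed over dyadic
  widths, bounds the energy from above; read at a single width, it bounds the mass of close pairs.
  The power weight is compared with Gaussians pointwise, so no singular kernel occurs. The losses
  are absorbed by working at exponents strictly below the dimensions, which makes the geometric
  series converge.\<close>

text \<open>Suslin sets in projection form. The closed set \<open>S\<close> in the product with
  Baire space is what capacitability works with: limits of convergent witnesses stay in it.\<close>

definition analytic_set :: "'a::metric_space set \<Rightarrow> bool" where
  "analytic_set B \<longleftrightarrow> (\<exists>S::('a \<times> (nat \<Rightarrow> nat)) set. closed S \<and> B = fst ` S)"

lemma analytic_set_closed:
  assumes "closed B"
  shows "analytic_set B"
  unfolding analytic_set_def
  by (rule exI[of _ "B \<times> UNIV"]) (auto simp: assms closed_Times)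

lemma continuous_on_fun_apply: "continuous_on UNIV (\<lambda>f::nat \<Rightarrow> nat. f i)"
  by (rule continuous_on_product_coordinates)

lemma analytic_set_UN:
  fixes B :: "nat \<Rightarrow> 'a::metric_space set"
  assumes "\<And>n. analytic_set (B n)"
  shows "analytic_set (\<Union>n. B n)"
proof -
  obtain S :: "nat \<Rightarrow> ('a \<times> (nat \<Rightarrow> nat)) set" where S: "\<And>n. closed (S n)" "\<And>n. B n = fst ` S n"
    using assms unfolding analytic_set_def by metis
  \<comment> \<open>The entry at 0 names a member of the family and the shifted tail is a witness
    for it. The alternative \<open>- {n}\<close> makes the n-th condition void unless the entry is
    n, so that \<open>T\<close> is an intersection of closed sets.\<close>
  define T where "T = (\<Inter>n. (\<lambda>p. snd p 0) -` (- {n}) \<union> (\<lambda>p. (fst p, \<lambda>i. snd p (Suc i))) -` S n)"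
  have c: "continuous_on UNIV (\<lambda>p::'a \<times> (nat \<Rightarrow> nat). snd p i)" for i
    by (intro continuous_on_compose2[OF continuous_on_fun_apply[of i] continuous_on_snd[OF continuous_on_id]]) auto
  have "closed T" unfolding T_def
    by (intro closed_INT ballI closed_Un closed_vimage S continuous_on_Pair continuous_on_coordinatewise_then_product c continuous_on_fst continuous_on_id)
       (auto simp: closed_def discrete_topology_class.open_discrete)
  moreover have "(\<Union>n. B n) = fst ` T"
  proof safe
    fix x n assume "x \<in> B n"
    then obtain s where s: "(x,s) \<in> S n" using S(2) by auto
    have "(x, case_nat n s) \<in> T" using s by (auto simp: T_def)
    then show "x \<in> fst ` T" by force
  next
    fix x s assume "(x,s) \<in> T"
    then have "(x, \<lambda>i. s (Suc i)) \<in> S (s 0)" by (auto simp: T_def)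
    then show "fst (x,s) \<in> (\<Union>n. B n)" using S(2) by force
  qed
  ultimately show ?thesis unfolding analytic_set_def by blast
qed

lemma analytic_set_INT:
  fixes B :: "nat \<Rightarrow> 'a::metric_space set"
  assumes "\<And>n. analytic_set (B n)"
  shows "analytic_set (\<Inter>n. B n)"
proof -
  obtain S :: "nat \<Rightarrow> ('a \<times> (nat \<Rightarrow> nat)) set" where S: "\<And>n. closed (S n)" "\<And>n. B n = fst ` S n"
    using assms unfolding analytic_set_def by metis
  \<comment> \<open>One sequence stores a witness for every n, interleaved by
    \<open>prod_encode\<close>.\<close>
  define T where "T = (\<Inter>n. (\<lambda>p. (fst p, \<lambda>i. snd p (prod_encode (n, i)))) -` S n)"
  have c: "continuous_on UNIV (\<lambda>p::'a \<times> (nat \<Rightarrow> nat). snd p i)" for i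
    by (intro continuous_on_compose2[OF continuous_on_fun_apply[of i] continuous_on_snd[OF continuous_on_id]]) auto
  have "closed T" unfolding T_def
    by (intro closed_INT ballI closed_vimage S continuous_on_Pair continuous_on_coordinatewise_then_product c continuous_on_fst continuous_on_id)
  moreover have "(\<Inter>n. B n) = fst ` T"
  proof safe
    fix x assume "x \<in> (\<Inter>n. B n)"
    then have "\<forall>n. \<exists>s. (x,s) \<in> S n" using S(2) by force
    then obtain s where s: "\<And>n. (x, s n) \<in> S n" by metis
    have "(x, \<lambda>k. case prod_decode k of (n, i) \<Rightarrow> s n i) \<in> T" using s by (auto simp: T_def)
    then show "x \<in> fst ` T" by force
  next
    fix x s n assume "(x,s) \<in> T"
    then have "(x, \<lambda>i. s (prod_encode (n, i))) \<in> S n" by (auto simp: T_def)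
    then show "fst (x,s) \<in> B n" using S(2) by force
  qed
  ultimately show ?thesis unfolding analytic_set_def by blast
qed

lemma analytic_set_open:
  fixes U :: "'a::metric_space set"
  assumes "open U"
  shows "analytic_set U"
\<comment> \<open>The whole space is treated apart because \<open>infdist x {} = 0\<close> would
  make all the closed sets below empty.\<close>
proof (cases "U = UNIV")
  case True
  then show ?thesis by (simp add: analytic_set_closed)
next
  case False
  have "U = (\<Union>n. {x. inverse (real (Suc n)) \<le> infdist x (- U)})"
  proof (intro set_eqI iffI)
    fix x assume "x \<in> U"
    then have "infdist x (- U) > 0"
      using assms False in_closed_iff_infdist_zero[of "- U" x] infdist_nonneg[of x "- U"] by force
    from reals_Archimedean[OF this] obtain n where "inverse (real (Suc n)) < infdist x (- U)" ..
    then show "x \<in> (\<Union>n. {x. inverse (real (Suc n)) \<le> infdist x (- U)})"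
      by (auto intro!: exI[of _ n])
  next
    fix x assume "x \<in> (\<Union>n. {x. inverse (real (Suc n)) \<le> infdist x (- U)})"
    then obtain n where n: "inverse (real (Suc n)) \<le> infdist x (- U)" by auto
    moreover have "0 < inverse (real (Suc n))" by simp
    ultimately show "x \<in> U" using infdist_zero[of x "- U"] by fastforce
  qed
  moreover have "analytic_set {x. inverse (real (Suc n)) \<le> infdist x (- U)}" for n
    by (intro analytic_set_closed closed_Collect_le continuous_intros)
  ultimately show ?thesis using analytic_set_UN by metis
qed

lemma analytic_set_borel:
  fixes B :: "'a::metric_space set"
  assumes "B \<in> sets borel"
  shows "analytic_set B"
proof -
  \<comment> \<open>Complements are carried through the induction, as analytic sets are not closed
    under complementation.\<close>
  have "analytic_set B \<and> analytic_set (- B)"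
  proof -
    have "B \<in> sigma_sets UNIV {S. open S}"
      using assms by (simp add: borel_def)
    then show ?thesis
    proof induction
      case (Basic a)
      then show ?case by (auto intro: analytic_set_open analytic_set_closed)
    next
      case Empty
      then show ?case by (auto intro: analytic_set_open)
    next
      case (Compl a)
      then show ?case by (simp add: Compl_eq_Diff_UNIV[symmetric])
    next
      case (Union a)
      then have "analytic_set (\<Union>i. a i)" "analytic_set (\<Inter>i. - a i)"
        by (auto intro: analytic_set_UN analytic_set_INT)
      then show ?case by (simp add: Compl_UN)
    qed
  qed
  then show ?thesis ..
qed

lemma compact_bounded_sequences: "compact {\<sigma>::nat \<Rightarrow> nat. \<forall>i. \<sigma> i \<le> m i}"
proof -
  have "compactin (product_topology (\<lambda>i. euclidean) UNIV) (PiE UNIV (\<lambda>i. {..m i}))"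
    by (subst compactin_PiE) (auto intro: finite_imp_compact)
  then have "compact (PiE UNIV (\<lambda>i. {..m i}))"
    by (simp add: euclidean_product_topology)
  moreover have "PiE UNIV (\<lambda>i. {..m i}) = {\<sigma>::nat \<Rightarrow> nat. \<forall>i. \<sigma> i \<le> m i}"
    by auto
  ultimately show ?thesis by simp
qed

lemma tendsto_fun_componentwise:
  fixes f :: "'c \<Rightarrow> 'i \<Rightarrow> 'b::topological_space"
  assumes "\<And>i. ((\<lambda>k. f k i) \<longlongrightarrow> l i) F"
  shows "(f \<longlongrightarrow> l) F"
proof -
  have "limitin (product_topology (\<lambda>i. euclidean) UNIV) f l F"
    by (subst limitin_componentwise) (auto simp: assms)
  then show ?thesis by (simp add: euclidean_product_topology)
qed

text \<open>Choquet's theorem with the conclusion on open neighbourhoods of \<open>K\<close> instead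
  of \<open>K\<close> itself. No continuity along decreasing compact sets is then assumed of
  \<open>C\<close>; each application passes from neighbourhoods to \<open>K\<close> by its own
  argument.\<close>

theorem capacitability:
  fixes C :: "'a::euclidean_space set \<Rightarrow> ennreal"
  assumes mono: "\<And>E F. E \<subseteq> F \<Longrightarrow> C E \<le> C F"
    and incr: "\<And>E. incseq E \<Longrightarrow> a < C (\<Union>n. E n) \<Longrightarrow> \<exists>n. a < C (E n)"
    and B: "B \<in> sets borel" "a < C B"
  obtains K where "compact K" "K \<subseteq> B" "\<And>U. open U \<Longrightarrow> K \<subseteq> U \<Longrightarrow> a < C U"
proof -
  obtain S :: "('a \<times> (nat \<Rightarrow> nat)) set" where S: "closed S" "B = fst ` S"
    using analytic_set_borel[OF B(1)] unfolding analytic_set_def by auto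
  define E where "E k R m = fst ` (S \<inter> {p. norm (fst p) \<le> real R \<and> (\<forall>i<k. snd p i \<le> m i)})"
    for k R and m :: "nat \<Rightarrow> nat"
  have "B = (\<Union>R. E 0 R m)" for m
  proof (intro set_eqI iffI)
    fix x assume "x \<in> B"
    then obtain s where "(x, s) \<in> S" using S(2) by auto
    moreover obtain R where "norm x \<le> real R" using real_arch_simple by blast
    ultimately show "x \<in> (\<Union>R. E 0 R m)" unfolding E_def by force
  qed (auto simp: E_def S(2))
  moreover have "incseq (\<lambda>R. E 0 R m)" for m
    by (rule incseq_SucI) (force simp: E_def)
  ultimately obtain R where R: "a < C (E 0 R m)" for m
  proof -
    assume *: "\<And>R. (\<And>m. a < C (E 0 R m)) \<Longrightarrow> thesis"
    obtain R where "a < C (E 0 R (\<lambda>_. 0))"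
      using incr[OF \<open>\<And>m. incseq (\<lambda>R. E 0 R m)\<close>] B(2) \<open>\<And>m. B = (\<Union>R. E 0 R m)\<close> by metis
    moreover have "E 0 R m = E 0 R (\<lambda>_. 0)" for m by (simp add: E_def)
    ultimately show thesis using * by metis
  qed
  \<comment> \<open>Bounding one more entry of the witness by n exhausts the set as n grows, so some
    bound keeps the capacity above \<open>a\<close>.\<close>
  have step: "\<exists>n. a < C (E (Suc k) R (m(k := n)))" if "a < C (E k R m)" for k m
  proof -
    have "E k R m = (\<Union>n. E (Suc k) R (m(k := n)))"
    proof (intro set_eqI iffI)
      fix x assume "x \<in> E k R m"
      then obtain s where s: "(x, s) \<in> S" "norm x \<le> real R" "\<forall>i<k. s i \<le> m i" by (auto simp: E_def)
      then have "x \<in> E (Suc k) R (m(k := s k))"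
        unfolding E_def by (intro image_eqI[of _ _ "(x, s)"]) (auto simp: less_Suc_eq)
      then show "x \<in> (\<Union>n. E (Suc k) R (m(k := n)))" by blast
    qed (force simp: E_def less_Suc_eq)
    moreover have "incseq (\<lambda>n. E (Suc k) R (m(k := n)))"
      by (rule incseq_SucI) (force simp: E_def less_Suc_eq)
    ultimately show ?thesis using incr that by metis
  qed
  \<comment> \<open>Stage k alters only the entry at k. Hence \<open>M k\<close> agrees below k with
    the diagonal \<open>m\<close>, and \<open>E k R m\<close> sees only those entries.\<close>
  define M where "M = rec_nat (\<lambda>_. 0) (\<lambda>k m. m(k := (SOME n. a < C (E (Suc k) R (m(k := n))))))"
  have M_Suc: "M (Suc k) = (M k)(k := (SOME n. a < C (E (Suc k) R ((M k)(k := n)))))" for k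
    by (simp add: M_def)
  have M: "a < C (E k R (M k))" for k
  proof (induction k)
    case 0
    show ?case by (rule R)
  next
    case (Suc k)
    show ?case unfolding M_Suc by (rule someI_ex[OF step[OF Suc]])
  qed
  define m where "m i = M (Suc i) i" for i
  have M_eq: "M k i = m i" if "i < k" for k i
    using that by (induction k) (auto simp: M_Suc m_def less_Suc_eq)
  have Em: "a < C (E k R m)" for k
  proof -
    have "E k R (M k) = E k R m" using M_eq by (auto simp: E_def)
    then show ?thesis using M by metis
  qed
  define D where "D = cball (0::'a) (real R) \<times> {\<sigma>. \<forall>i. \<sigma> i \<le> m i}"
  have D: "compact D" unfolding D_def by (intro compact_Times compact_cball compact_bounded_sequences)
  define K where "K = fst ` (S \<inter> D)"
  show thesis
  proof
    show "compact K" unfolding K_def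
      by (intro compact_continuous_image continuous_on_fst continuous_on_id closed_Int_compact S D)
    show "K \<subseteq> B" by (auto simp: K_def S)
    fix U assume U: "open U" "K \<subseteq> U"
    have "\<exists>k. E k R m \<subseteq> U"
    proof (rule ccontr)
      assume "\<not> ?thesis"
      then have "\<forall>k. \<exists>p. p \<in> S \<and> norm (fst p) \<le> real R \<and> (\<forall>i<k. snd p i \<le> m i) \<and> fst p \<notin> U"
        by (force simp: E_def)
      then obtain p where p: "\<And>k. p k \<in> S" "\<And>k. norm (fst (p k)) \<le> real R"
        "\<And>k i. i < k \<Longrightarrow> snd (p k) i \<le> m i" "\<And>k. fst (p k) \<notin> U"
        by metis
      \<comment> \<open>The witnesses \<open>p k\<close> need not lie in the compact set
        \<open>D\<close>, since only their entries below k are bounded. Truncation moves them into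
        \<open>D\<close> and leaves each fixed entry unchanged for large k, so a limit of the
        truncations is also a limit of the points \<open>p (r k)\<close> of the closed set
        \<open>S\<close>.\<close>
      define q where "q k = (fst (p k), \<lambda>i. min (snd (p k) i) (m i))" for k
      have "\<forall>k. q k \<in> D" using p by (auto simp: q_def D_def)
      then obtain l r where l: "l \<in> D" "strict_mono (r::nat\<Rightarrow>nat)" "(q \<circ> r) \<longlonglongrightarrow> l"
        by (rule seq_compactE[OF compact_imp_seq_compact[OF D]])
      have f: "(\<lambda>k. fst (p (r k))) \<longlonglongrightarrow> fst l"
        using tendsto_fst[OF l(3)] by (simp add: q_def o_def)
      have "(\<lambda>k. snd (p (r k))) \<longlonglongrightarrow> snd l"
      proof (rule tendsto_fun_componentwise)
        fix i
        have "(\<lambda>k. snd (q (r k))) \<longlonglongrightarrow> snd l"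
          using tendsto_snd[OF l(3)] by (simp add: o_def)
        then have "(\<lambda>k. snd (q (r k)) i) \<longlonglongrightarrow> snd l i"
          by (rule tendsto_compose[OF continuous_on_fun_apply[unfolded continuous_on_def, rule_format, OF UNIV_I]])
        moreover have "eventually (\<lambda>k. snd (q (r k)) i = snd (p (r k)) i) sequentially"
          using eventually_gt_at_top[of i]
        proof eventually_elim
          case (elim k)
          then have "i < r k" using seq_suble[OF l(2), of k] by linarith
          from p(3)[OF this] show ?case by (simp add: q_def)
        qed
        ultimately show "(\<lambda>k. snd (p (r k)) i) \<longlonglongrightarrow> snd l i"
          by (rule Lim_transform_eventually)
      qed
      from tendsto_Pair[OF f this] have "(\<lambda>k. p (r k)) \<longlonglongrightarrow> l" by simp
      then have "l \<in> S" by (rule closed_sequentially[OF S(1) p(1)])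
      then have "fst l \<in> U" using l(1) U(2) by (auto simp: K_def)
      moreover have "fst l \<in> - U"
        by (rule closed_sequentially[OF closed_Compl[OF U(1)] _ f]) (simp add: p)
      ultimately show False by simp
    qed
    then obtain k where "E k R m \<subseteq> U" ..
    with Em[of k] mono show "a < C U" by (meson less_le_trans)
  qed
qed

section \<open>Lebesgue measurability of continuous images of Borel sets\<close>

lemma outer_measure_image_compact:
  fixes f :: "'a::euclidean_space \<Rightarrow> 'b::euclidean_space"
  assumes f: "continuous_on UNIV f" and B: "B \<in> sets borel"
    and a: "a < outer_measure_of lborel (f ` B)"
  obtains K where "compact K" "K \<subseteq> f ` B" "a \<le> emeasure lborel K"
proof -
  obtain K where K: "compact K" "K \<subseteq> B"
    "\<And>U. open U \<Longrightarrow> K \<subseteq> U \<Longrightarrow> a < outer_measure_of lborel (f ` U)"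
  proof (rule capacitability[of "\<lambda>E. outer_measure_of lborel (f ` E)" a B])
    show "outer_measure_of lborel (f ` E) \<le> outer_measure_of lborel (f ` F)" if "E \<subseteq> F" for E F
      using that by (intro outer_measure_of_mono image_mono)
    show "\<exists>n. a < outer_measure_of lborel (f ` E n)"
      if E: "incseq E" "a < outer_measure_of lborel (f ` (\<Union>n. E n))" for E
    proof -
      have "(SUP n. outer_measure_of lborel (f ` E n)) = outer_measure_of lborel (\<Union>n. f ` E n)"
        using E(1) by (intro SUP_outer_measure_of_incseq) (auto simp: incseq_def intro!: image_mono)
      with E(2) have "a < (SUP n. outer_measure_of lborel (f ` E n))" by (simp add: image_UN)
      then show ?thesis by (auto simp: less_SUP_iff)
    qed
  qed (use B a in auto)
  have fK: "compact (f ` K)"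
    using f K(1) by (meson compact_continuous_image continuous_on_subset subset_UNIV)
  show thesis
  proof
    show "compact (f ` K)" by (rule fK)
    show "f ` K \<subseteq> f ` B" using K(2) by auto
    have [measurable]: "f ` K \<in> sets borel" using fK by (rule borel_compact)
    show "a \<le> emeasure lborel (f ` K)"
    proof (rule ennreal_le_epsilon)
      fix e :: real assume "0 < e"
      obtain V where V: "open V" "f ` K \<subseteq> V" "emeasure lborel (V - f ` K) \<le> e"
        using outer_regular_lborel_le[OF _ \<open>0 < e\<close>, of "f ` K"] by auto
      have "open (f -` V)" using f V(1) by (simp add: open_vimage)
      then have "a < outer_measure_of lborel (f ` (f -` V))" using V(2) by (intro K(3)) auto
      also have "\<dots> \<le> outer_measure_of lborel V" by (intro outer_measure_of_mono) auto
      also have "\<dots> = emeasure lborel (f ` K \<union> (V - f ` K))" using V by (simp add: Un_absorb1)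
      also have "\<dots> \<le> emeasure lborel (f ` K) + emeasure lborel (V - f ` K)"
        using V(1) by (intro emeasure_subadditive) auto
      also have "\<dots> \<le> emeasure lborel (f ` K) + e" using V(3) by (rule add_left_mono)
      finally show "a \<le> emeasure lborel (f ` K) + ennreal e" by simp
    qed
  qed
qed

text \<open>Compact subsets of a bounded image exhaust its outer measure. Their countable union
  \<open>D\<close> and a measurable hull \<open>H\<close> enclose the image and differ by a null
  set, and Lebesgue measure is complete.\<close>

lemma lebesgue_measurable_image_borel:
  fixes f :: "'a::euclidean_space \<Rightarrow> 'b::euclidean_space"
  assumes f: "continuous_on UNIV f" and B: "B \<in> sets borel"
  shows "f ` B \<in> sets lebesgue"
proof -
  have *: "f ` E \<in> sets lebesgue" if E: "E \<in> sets borel" "bounded (f ` E)" for E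
  proof -
    define m where "m = outer_measure_of lborel (f ` E)"
    have "f ` E \<subseteq> space lborel" by simp
    from outer_measure_of_attain[OF this] obtain H
      where H: "H \<in> sets borel" "f ` E \<subseteq> H" "m = emeasure lborel H"
      unfolding m_def sets_lborel by blast
    from bounded_iff[THEN iffD1, OF E(2)] obtain R where "\<forall>y\<in>f ` E. norm y \<le> R" ..
    then have "f ` E \<subseteq> cball 0 R" by auto
    then have "m \<le> emeasure lborel (cball (0::'b) R)"
      unfolding m_def using outer_measure_of_mono[of "f ` E" "cball 0 R" lborel] by simp
    also have "\<dots> < \<infinity>" by (rule emeasure_lborel_cball_finite)
    finally have fin: "m < \<infinity>" .
    have "\<exists>L. compact L \<and> L \<subseteq> f ` E \<and> m \<le> emeasure lborel L + ennreal (inverse (real (Suc n)))" for n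
    \<comment> \<open>A compact set is obtained only for a value strictly below \<open>m\<close>.
      For positive finite \<open>m\<close> the value \<open>m - ?e\<close> is one; for
      \<open>m = 0\<close> there is none.\<close>
    proof (cases "m = 0")
      case True
      then show ?thesis by (intro exI[of _ "{}"]) auto
    next
      case False
      let ?e = "ennreal (inverse (real (Suc n)))"
      have "m - ?e < m" using False fin by (intro ennreal_between) (auto simp: less_top zero_less_iff_neq_zero)
      then obtain L where "compact L" "L \<subseteq> f ` E" "m - ?e \<le> emeasure lborel L"
        using outer_measure_image_compact[OF f E(1), of "m - ?e"] unfolding m_def by blast
      moreover from this(3) have "m \<le> emeasure lborel L + ?e"
        by (metis add.commute ennreal_minus_le_iff ennreal_neq_top)
      ultimately show ?thesis by blast
    qed
    then obtain L where L: "\<And>n. compact (L n)" "\<And>n. L n \<subseteq> f ` E"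
      "\<And>n. m \<le> emeasure lborel (L n) + ennreal (inverse (real (Suc n)))"
      by metis
    define D where "D = (\<Union>n. L n)"
    have Lb: "L n \<in> sets borel" for n using L(1) by (simp add: borel_compact)
    then have D: "D \<in> sets borel" "D \<subseteq> f ` E" using L(2) by (auto simp: D_def)
    have "m \<le> emeasure lborel D"
    proof (rule ennreal_le_epsilon)
      fix e :: real assume "0 < e"
      then obtain n where n: "inverse (real (Suc n)) < e" using reals_Archimedean by blast
      have "m \<le> emeasure lborel (L n) + ennreal (inverse (real (Suc n)))" by (rule L(3))
      also have "\<dots> \<le> emeasure lborel D + ennreal e"
        using n D by (intro add_mono emeasure_mono ennreal_leI) (auto simp: D_def)
      finally show "m \<le> emeasure lborel D + ennreal e" .
    qed
    have "emeasure lborel D \<le> m" using D H by (auto intro!: emeasure_mono)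
    then have "emeasure lborel (H - D) = emeasure lborel H - emeasure lborel D"
      using D H fin by (intro emeasure_Diff) auto
    also have "\<dots> = 0"
      using \<open>m \<le> emeasure lborel D\<close> H(3) fin by (intro diff_eq_0_ennreal) auto
    finally have "H - D \<in> null_sets lborel" using H D by (auto simp: null_sets_def)
    then have "f ` E - D \<in> null_sets lebesgue"
      using H by (intro null_sets_completion_subset[of "f ` E - D" "H - D"] null_sets_completionI) auto
    then have "f ` E - D \<in> sets lebesgue" by (rule null_setsD2)
    moreover have "D \<in> sets lebesgue" using D(1) by simp
    ultimately have "D \<union> (f ` E - D) \<in> sets lebesgue" by (intro sets.Un)
    then show ?thesis using D(2) by (simp add: Un_absorb1)
  qed
  have "f ` B = (\<Union>n. f ` (B \<inter> cball 0 (real n)))"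
  proof (intro set_eqI iffI)
    fix y assume "y \<in> f ` B"
    then obtain x where "x \<in> B" "y = f x" by blast
    moreover obtain n where "norm x \<le> real n" using real_arch_simple by blast
    ultimately show "y \<in> (\<Union>n. f ` (B \<inter> cball 0 (real n)))"
      by (intro UN_I[of n] image_eqI[of _ _ x]) auto
  qed auto
  moreover have "f ` (B \<inter> cball 0 (real n)) \<in> sets lebesgue" for n
  proof (rule *)
    show "bounded (f ` (B \<inter> cball 0 (real n)))"
      by (rule bounded_subset[of "f ` cball 0 (real n)"])
        (auto intro!: compact_imp_bounded compact_continuous_image continuous_on_subset[OF f])
  qed (use B in auto)
  ultimately show ?thesis by (simp only:) (intro sets.countable_UN, blast)
qed

lemma lebesgue_measurable_sumset:
  fixes A B :: "'a::euclidean_space set"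
  assumes "A \<in> sets borel" "B \<in> sets borel"
  shows "A + B \<in> sets lebesgue"
proof -
  have "A \<times> B \<in> sets (borel :: ('a \<times> 'a) measure)"
    using assms by (auto simp: borel_prod[symmetric])
  then have "(\<lambda>p. fst p + snd p) ` (A \<times> B) \<in> sets lebesgue"
    by (intro lebesgue_measurable_image_borel continuous_intros)
  also have "(\<lambda>p. fst p + snd p) ` (A \<times> B) = A + B"
    by (fastforce simp: set_plus_def image_iff)
  finally show ?thesis .
qed

subsection \<open>Net contents on the space of digit sequences\<close>

text \<open>Words are stored with the last letter first, so that the children of a node \<open>w\<close> are \<open>j # w\<close>.\<close>

primrec prefix_rev :: "(nat \<Rightarrow> nat) \<Rightarrow> nat \<Rightarrow> nat list" where
  "prefix_rev \<omega> 0 = []"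
| "prefix_rev \<omega> (Suc n) = \<omega> n # prefix_rev \<omega> n"

definition cylinder :: "nat list \<Rightarrow> (nat \<Rightarrow> nat) set" where
  "cylinder w = {\<omega>. prefix_rev \<omega> (length w) = w}"

definition cylinders :: "nat list set \<Rightarrow> (nat \<Rightarrow> nat) set" where
  "cylinders W = (\<Union>w\<in>W. cylinder w)"

text \<open>Words without a proper initial segment in \<open>W\<close>; since words are stored in
  reverse, an initial segment is a suffix. Their cylinders are the maximal ones of the family, hence
  pairwise disjoint.\<close>

definition minimal_words :: "nat list set \<Rightarrow> nat list set" where
  "minimal_words W = {w\<in>W. \<forall>u v. w = u @ v \<longrightarrow> v \<in> W \<longrightarrow> u = []}"

lemma length_prefix_rev [simp]: "length (prefix_rev \<omega> n) = n"
  by (induction n) auto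

lemma prefix_rev_in_cylinder [simp]: "\<omega> \<in> cylinder (prefix_rev \<omega> n)"
  by (simp add: cylinder_def)

lemma cylinder_Nil [simp]: "cylinder [] = UNIV"
  by (simp add: cylinder_def)

lemma cylinder_Cons: "\<omega> \<in> cylinder (j # w) \<longleftrightarrow> \<omega> \<in> cylinder w \<and> \<omega> (length w) = j"
  by (auto simp: cylinder_def)

lemma cylinder_append: "cylinder (u @ v) \<subseteq> cylinder v"
  by (induction u) (auto simp: cylinder_Cons)

lemma prefix_rev_le: "m \<le> n \<Longrightarrow> \<exists>u. prefix_rev \<omega> n = u @ prefix_rev \<omega> m"
proof (induction n)
  case (Suc n)
  then show ?case
    by (cases "m = Suc n") (force simp: le_Suc_eq Cons_eq_append_conv)+
qed simp

text \<open>The tree property on which the reduction of covers to minimal words rests: cylinders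
  that meet are nested.\<close>

lemma cylinder_comparable:
  assumes "\<omega> \<in> cylinder v" "\<omega> \<in> cylinder w"
  shows "(\<exists>u. w = u @ v) \<or> (\<exists>u. v = u @ w)"
  using assms prefix_rev_le[of "length v" "length w" \<omega>] prefix_rev_le[of "length w" "length v" \<omega>]
  by (auto simp: cylinder_def) (metis nle_le)

lemma minimal_words_subset: "minimal_words W \<subseteq> W"
  by (auto simp: minimal_words_def)

lemma minimal_words_suffix:
  assumes "w \<in> W"
  obtains u v where "w = u @ v" "v \<in> minimal_words W"
proof -
  let ?P = "\<lambda>v. v \<in> W \<and> (\<exists>u. w = u @ v)"
  have "?P w" using assms by auto
  from ex_has_least_nat[of ?P, OF this, of length] obtain v
    where v: "?P v" "\<And>v'. ?P v' \<Longrightarrow> length v \<le> length v'" by blast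
  then obtain u where u: "w = u @ v" by blast
  have "v \<in> minimal_words W"
    unfolding minimal_words_def
  proof (safe)
    fix u' v' assume *: "v = u' @ v'" "v' \<in> W"
    then have "?P v'" using u by (auto intro!: exI[of _ "u @ u'"])
    from v(2)[OF this] * show "u' = []" by simp
  qed (use v in auto)
  with u that show thesis by blast
qed

lemma cylinders_minimal_words: "cylinders (minimal_words W) = cylinders W"
proof
  show "cylinders W \<subseteq> cylinders (minimal_words W)"
  proof
    fix \<omega> assume "\<omega> \<in> cylinders W"
    then obtain w where w: "w \<in> W" "\<omega> \<in> cylinder w" by (auto simp: cylinders_def)
    from minimal_words_suffix[OF w(1)] obtain u v where "w = u @ v" "v \<in> minimal_words W" .
    with w(2) cylinder_append show "\<omega> \<in> cylinders (minimal_words W)"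
      unfolding cylinders_def by blast
  qed
qed (use minimal_words_subset in \<open>auto simp: cylinders_def\<close>)

lemma cylinders_mono: "V \<subseteq> W \<Longrightarrow> cylinders V \<subseteq> cylinders W"
  by (auto simp: cylinders_def)

lemma cylinders_Un: "cylinders (V \<union> W) = cylinders V \<union> cylinders W"
  by (auto simp: cylinders_def)

text \<open>Counted with multiplicity, \<open>V\<close> and \<open>W\<close> split into the minimal
  words of the union, its other words, and the common words. The last two groups cover the
  intersection: a point of it lies in two comparable cylinders, and the longer word is not minimal
  unless the two coincide.\<close>

lemma cylinders_Int_subset:
  "cylinders V \<inter> cylinders W \<subseteq> cylinders ((V \<union> W - minimal_words (V \<union> W)) \<union> (V \<inter> W))"
proof
  fix \<omega> assume "\<omega> \<in> cylinders V \<inter> cylinders W"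
  then obtain v w where vw: "v \<in> V" "w \<in> W" "\<omega> \<in> cylinder v" "\<omega> \<in> cylinder w"
    by (auto simp: cylinders_def)
  consider "v = w" | u where "u \<noteq> []" "w = u @ v" | u where "u \<noteq> []" "v = u @ w"
    using cylinder_comparable[OF vw(3,4)] by force
  then show "\<omega> \<in> cylinders ((V \<union> W - minimal_words (V \<union> W)) \<union> (V \<inter> W))"
  proof cases
    case 1
    then show ?thesis using vw by (auto simp: cylinders_def)
  next
    case 2
    then have "w \<notin> minimal_words (V \<union> W)" using vw by (auto simp: minimal_words_def)
    then show ?thesis using vw unfolding cylinders_def by blast
  next
    case 3
    then have "v \<notin> minimal_words (V \<union> W)" using vw by (auto simp: minimal_words_def)
    then show ?thesis using vw unfolding cylinders_def by blast
  qed
qed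

lemma ennreal_less_add_pos: "x < \<infinity> \<Longrightarrow> 0 < e \<Longrightarrow> x < x + ennreal e"
  by (cases x) (auto simp: ennreal_less_iff simp flip: ennreal_plus)

text \<open>The weights are encoded as a measure on words, so that the sum over a cover inherits
  subadditivity and continuity from measure theory. Word lengths are not bounded from below, as in
  Hausdorff contents without a mesh condition.\<close>

definition net_content :: "nat list measure \<Rightarrow> (nat \<Rightarrow> nat) set \<Rightarrow> ennreal" where
  "net_content m F = (INF W\<in>{W. F \<subseteq> cylinders W}. emeasure m W)"

lemma net_content_le: "F \<subseteq> cylinders W \<Longrightarrow> net_content m F \<le> emeasure m W"
  unfolding net_content_def by (rule INF_lower) simp

lemma net_content_lessE:
  assumes "net_content m F < c"
  obtains W where "F \<subseteq> cylinders W" "emeasure m W < c"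
  using assms unfolding net_content_def by (auto simp: INF_less_iff)

lemma net_content_mono: "E \<subseteq> F \<Longrightarrow> net_content m E \<le> net_content m F"
  unfolding net_content_def by (rule INF_superset_mono) auto

lemma net_content_empty [simp]: "net_content m {} = 0"
  using net_content_le[of "{}" "{}" m] by simp

lemma net_content_Un:
  assumes [simp]: "sets m = UNIV"
  shows "net_content m (E \<union> F) \<le> net_content m E + net_content m F"
proof (cases "net_content m E + net_content m F = \<infinity>")
  case False
  show ?thesis
  proof (rule ennreal_le_epsilon)
    fix e :: real assume "0 < e"
    have "net_content m E < net_content m E + ennreal (e/2)"
      "net_content m F < net_content m F + ennreal (e/2)"
      using False \<open>0 < e\<close> by (auto simp: less_top[symmetric] intro!: ennreal_less_add_pos)
    then obtain V W where VW: "E \<subseteq> cylinders V" "emeasure m V < net_content m E + ennreal (e/2)"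
      "F \<subseteq> cylinders W" "emeasure m W < net_content m F + ennreal (e/2)"
      by (metis net_content_lessE)
    have "net_content m (E \<union> F) \<le> emeasure m (V \<union> W)"
      using VW by (intro net_content_le) (auto simp: cylinders_Un)
    also have "\<dots> \<le> emeasure m V + emeasure m W" by (rule emeasure_subadditive) auto
    also have "\<dots> \<le> (net_content m E + ennreal (e/2)) + (net_content m F + ennreal (e/2))"
      using VW by (intro add_mono) auto
    also have "\<dots> = net_content m E + net_content m F + ennreal e"
      using \<open>0 < e\<close> ennreal_plus[of "e/2" "e/2"] by (simp add: ac_simps del: ennreal_plus)
    finally show "net_content m (E \<union> F) \<le> net_content m E + net_content m F + ennreal e" .
  qed
qed auto

lemma net_content_UN_le:
  assumes "sets m = UNIV"
  shows "net_content m (\<Union>j<n::nat. F j) \<le> (\<Sum>j<n. net_content m (F j))"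
proof (induction n)
  case (Suc n)
  have "net_content m (\<Union>j<Suc n. F j) = net_content m ((\<Union>j<n. F j) \<union> F n)"
    by (simp add: lessThan_Suc Un_commute)
  also have "\<dots> \<le> net_content m (\<Union>j<n. F j) + net_content m (F n)"
    by (rule net_content_Un[OF assms])
  also have "\<dots> \<le> (\<Sum>j<Suc n. net_content m (F j))" using Suc by (simp add: add_right_mono)
  finally show ?case .
qed simp

text \<open>The minimal words of \<open>V \<union> W\<close> cover the union, and what is left over still covers the
  intersection, so the content is strongly subadditive.\<close>

lemma net_content_incseq:
  assumes m: "sets m = UNIV" and F: "incseq F" and a: "\<And>n. net_content m (F n) \<le> a"
  shows "net_content m (\<Union>n. F n) \<le> a"
proof (cases "a = \<infinity>")
  case False
  note [simp] = m
  have fin: "net_content m (F n) < \<infinity>" for n using a[of n] False by (auto simp: top.not_eq_extremum)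
  show ?thesis
  proof (rule ennreal_le_epsilon)
    fix e :: real assume "0 < e"
    define d where "d n = e * (1/2) ^ Suc n" for n :: nat
    have d: "d n > 0" for n using \<open>0 < e\<close> by (simp add: d_def)
    have "\<exists>W. F n \<subseteq> cylinders W \<and> emeasure m W \<le> net_content m (F n) + ennreal (d n)" for n
    proof -
      have "net_content m (F n) < net_content m (F n) + ennreal (d n)"
        using fin[of n] d[of n] by (auto intro!: ennreal_less_add_pos)
      then show ?thesis by (metis net_content_lessE less_imp_le)
    qed
    then obtain W where W: "\<And>n. F n \<subseteq> cylinders (W n)"
      "\<And>n. emeasure m (W n) \<le> net_content m (F n) + ennreal (d n)" by metis
    \<comment> \<open>The old cover is merged with a new one and only minimal words are kept. Both
      cover \<open>F n\<close>, so by the splitting above the surplus weighs at least the content of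
      \<open>F n\<close>. Cancelling that finite content, the error grows by
      \<open>d (Suc n)\<close> only.\<close>
    define V where "V = rec_nat (W 0) (\<lambda>n v. minimal_words (v \<union> W (Suc n)))"
    have V_0: "V 0 = W 0" and V_Suc: "V (Suc n) = minimal_words (V n \<union> W (Suc n))" for n
      by (simp_all add: V_def)
    have cov: "F n \<subseteq> cylinders (V n)" for n
      by (cases n) (use W(1) in \<open>auto simp: V_0 V_Suc cylinders_minimal_words cylinders_Un\<close>)
    have bound: "emeasure m (V n) \<le> net_content m (F n) + ennreal (\<Sum>i\<le>n. d i)" for n
    proof (induction n)
      case 0
      show ?case using W(2)[of 0] by (simp add: V_0)
    next
      case (Suc n)
      let ?X = "V n \<union> W (Suc n)"
      have "F n \<subseteq> cylinders (V n) \<inter> cylinders (W (Suc n))"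
        using cov[of n] W(1)[of "Suc n"] incseq_SucD[OF F, of n] by blast
      then have "F n \<subseteq> cylinders ((?X - minimal_words ?X) \<union> (V n \<inter> W (Suc n)))"
        using cylinders_Int_subset by blast
      then have "net_content m (F n) \<le> emeasure m ((?X - minimal_words ?X) \<union> (V n \<inter> W (Suc n)))"
        by (rule net_content_le)
      also have "\<dots> \<le> emeasure m (?X - minimal_words ?X) + emeasure m (V n \<inter> W (Suc n))"
        by (rule emeasure_subadditive) auto
      finally have "net_content m (F n) + emeasure m (V (Suc n)) \<le>
        (emeasure m (?X - minimal_words ?X) + emeasure m (minimal_words ?X)) + emeasure m (V n \<inter> W (Suc n))"
        by (simp add: V_Suc add_right_mono ac_simps)
      also have "emeasure m (?X - minimal_words ?X) + emeasure m (minimal_words ?X) = emeasure m ?X"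
        using minimal_words_subset[of ?X] by (subst plus_emeasure) (auto simp: Un_absorb2)
      also have "emeasure m ?X + emeasure m (V n \<inter> W (Suc n)) = emeasure m (V n) + emeasure m (W (Suc n))"
        by (rule emeasure_Un_Int[symmetric]) auto
      also have "\<dots> \<le> (net_content m (F n) + ennreal (\<Sum>i\<le>n. d i)) +
          (net_content m (F (Suc n)) + ennreal (d (Suc n)))"
        by (intro add_mono Suc W(2))
      also have "\<dots> = net_content m (F n) + (net_content m (F (Suc n)) + ennreal (\<Sum>i\<le>Suc n. d i))"
        using d by (simp add: ac_simps sum_nonneg less_imp_le)
      finally show ?case using fin[of n] by (auto simp: ennreal_add_left_cancel_le)
    qed
    have sumd: "(\<Sum>i\<le>n. d i) \<le> e" for n
    proof -
      have "(\<Sum>i\<le>n. d i) = e * (1 - (1/2) ^ Suc n)"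
        by (induction n) (auto simp: d_def field_simps)
      also have "\<dots> \<le> e * 1" using \<open>0 < e\<close> by (intro mult_left_mono) auto
      finally show ?thesis by simp
    qed
    have Vb: "emeasure m (V n) \<le> a + ennreal e" for n
      using bound[of n] a[of n] sumd[of n] by (meson add_mono ennreal_leI order_trans)
    have VW: "V n \<subseteq> (\<Union>i. W i)" for n
    proof (induction n)
      case (Suc n)
      then show ?case using minimal_words_subset[of "V n \<union> W (Suc n)"] unfolding V_Suc by blast
    qed (auto simp: V_0)
    let ?Y = "minimal_words (\<Union>i. W i)"
    \<comment> \<open>A word that is minimal in the union of all covers is never discarded once it
      has entered. Hence \<open>?Y\<close> lies in the lower limit of the sets \<open>V k\<close>,
      whose weights are uniformly bounded.\<close>
    have mem: "w \<in> V k" if "w \<in> ?Y" "w \<in> W i" "i \<le> k" for w i k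
      using that(3)
    proof (induction k rule: dec_induct)
      case base
      show ?case
      proof (cases i)
        case (Suc j)
        then show ?thesis using that(1,2) VW[of j] by (auto simp: V_Suc minimal_words_def)
      qed (use that in \<open>simp add: V_0\<close>)
    next
      case (step k)
      then show ?case using that(1) VW[of k] by (auto simp: V_Suc minimal_words_def)
    qed
    have "?Y \<subseteq> (\<Union>n. \<Inter>k\<in>{n..}. V k)"
    proof
      fix w assume w: "w \<in> ?Y"
      then obtain i where "w \<in> W i" using minimal_words_subset by blast
      then have "w \<in> (\<Inter>k\<in>{i..}. V k)" using mem[OF w] by auto
      then show "w \<in> (\<Union>n. \<Inter>k\<in>{n..}. V k)" by blast
    qed
    then have "emeasure m ?Y \<le> emeasure m (\<Union>n. \<Inter>k\<in>{n..}. V k)" by (intro emeasure_mono) auto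
    also have "\<dots> = (SUP n. emeasure m (\<Inter>k\<in>{n..}. V k))"
      by (rule SUP_emeasure_incseq[symmetric]) (auto simp: incseq_def)
    also have "\<dots> \<le> a + ennreal e"
    proof (rule SUP_least)
      fix n
      have "emeasure m (\<Inter>k\<in>{n..}. V k) \<le> emeasure m (V n)" by (intro emeasure_mono) auto
      then show "emeasure m (\<Inter>k\<in>{n..}. V k) \<le> a + ennreal e" using Vb[of n] by simp
    qed
    finally have "emeasure m ?Y \<le> a + ennreal e" .
    moreover have "(\<Union>n. F n) \<subseteq> cylinders ?Y"
      unfolding cylinders_minimal_words
      using W(1) cylinders_mono[of "W _" "\<Union>i. W i"] by blast
    ultimately show "net_content m (\<Union>n. F n) \<le> a + ennreal e"
      by (meson net_content_le order_trans)
  qed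
qed auto

section \<open>Binary expansions of the points of a cube\<close>

text \<open>A digit selects the upper or lower half in each coordinate, that is, a subset of
  \<open>Basis\<close>. Numbering the subsets lets expansions live in the space of sequences of
  naturals that is used for analytic sets.\<close>

definition digit :: "nat \<Rightarrow> 'a::euclidean_space set" where
  "digit = (SOME h. bij_betw h {..<2 ^ DIM('a)} (Pow Basis))"

lemma bij_betw_digit: "bij_betw digit {..<2 ^ DIM('a)} (Pow (Basis :: 'a::euclidean_space set))"
proof -
  have "card (Pow (Basis :: 'a set)) = 2 ^ DIM('a)" by (simp add: card_Pow)
  then have "\<exists>h. bij_betw h {..<2 ^ DIM('a) :: nat} (Pow (Basis :: 'a set))"
    using ex_bij_betw_nat_finite[of "Pow (Basis :: 'a set)"] by (simp add: atLeast0LessThan)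
  then show ?thesis unfolding digit_def by (rule someI_ex)
qed

text \<open>The value \<open>0\<close> at indices that are not digits makes \<open>path_point\<close> converge on all sequences.\<close>

definition digit_vec :: "nat \<Rightarrow> 'a::euclidean_space" where
  "digit_vec j = (if j < 2 ^ DIM('a) then \<Sum>(digit j) else 0)"

lemma digit_vec_inner:
  fixes b :: "'a::euclidean_space"
  assumes "j < 2 ^ DIM('a)" "b \<in> Basis"
  shows "digit_vec j \<bullet> b = (if b \<in> digit j then 1 else 0)"
proof -
  have D: "(digit j :: 'a set) \<subseteq> Basis"
    using bij_betw_digit[where 'a='a] assms(1) by (auto simp: bij_betw_def)
  have "digit_vec j \<bullet> b = (\<Sum>c\<in>digit j. if b = c then 1 else 0)"
    using D assms unfolding digit_vec_def
    by (auto simp: inner_sum_left inner_Basis intro!: sum.cong)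
  also have "\<dots> = (if b \<in> digit j then 1 else 0)"
    using D finite_subset[OF D] by simp
  finally show ?thesis .
qed

lemma norm_digit_vec: "norm (digit_vec j :: 'a::euclidean_space) \<le> DIM('a)"
proof (cases "j < 2 ^ DIM('a)")
  case True
  have "norm (digit_vec j :: 'a) \<le> (\<Sum>b\<in>Basis. \<bar>(digit_vec j :: 'a) \<bullet> b\<bar>)" by (rule norm_le_l1)
  also have "\<dots> \<le> (\<Sum>b\<in>(Basis :: 'a set). 1)" using True by (intro sum_mono) (auto simp: digit_vec_inner)
  finally show ?thesis by simp
qed (simp add: digit_vec_def)

primrec corner :: "nat list \<Rightarrow> 'a::euclidean_space" where
  "corner [] = 0"
| "corner (j # w) = corner w + (1/2) ^ Suc (length w) *\<^sub>R digit_vec j"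

definition path_point :: "(nat \<Rightarrow> nat) \<Rightarrow> 'a::euclidean_space" where
  "path_point \<omega> = (\<Sum>n. (1/2) ^ Suc n *\<^sub>R digit_vec (\<omega> n))"

lemma corner_prefix_rev: "corner (prefix_rev \<omega> n) = (\<Sum>i<n. (1/2) ^ Suc i *\<^sub>R digit_vec (\<omega> i))"
  by (induction n) auto

lemma norm_digit_term: "norm ((1/2) ^ Suc n *\<^sub>R digit_vec j :: 'a::euclidean_space) \<le> DIM('a) * (1/2) ^ Suc n"
  using mult_left_mono[OF norm_digit_vec[of j, where 'a='a], of "(1/2) ^ Suc n"] by (simp add: mult.commute)

lemma summable_digit_bound: "summable (\<lambda>n. c * (1/2::real) ^ Suc n)"
  by (intro summable_mult) (simp add: summable_geometric summable_mult)

lemma summable_path_point: "summable (\<lambda>n. (1/2) ^ Suc n *\<^sub>R digit_vec (\<omega> n) :: 'a::euclidean_space)"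
  by (rule summable_comparison_test'[OF summable_digit_bound norm_digit_term])

lemma corner_LIMSEQ: "(\<lambda>n. corner (prefix_rev \<omega> n)) \<longlonglongrightarrow> path_point \<omega>"
  unfolding corner_prefix_rev path_point_def by (rule summable_LIMSEQ[OF summable_path_point])

text \<open>The difference of powers is the exact geometric sum, which closes the induction; a bound
  without the subtracted term would not.\<close>

lemma corner_Suc_dist:
  "dist (corner (prefix_rev \<omega> (m + n)) :: 'a::euclidean_space) (corner (prefix_rev \<omega> n))
    \<le> DIM('a) * ((1/2) ^ n - (1/2) ^ (m + n))"
proof (induction m)
  case (Suc m)
  have "dist (corner (prefix_rev \<omega> (Suc m + n)) :: 'a) (corner (prefix_rev \<omega> n))
    \<le> dist (corner (prefix_rev \<omega> (Suc m + n)) :: 'a) (corner (prefix_rev \<omega> (m + n)))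
      + dist (corner (prefix_rev \<omega> (m + n)) :: 'a) (corner (prefix_rev \<omega> n))" by (rule dist_triangle)
  also have "\<dots> \<le> DIM('a) * (1/2) ^ Suc (m + n) + DIM('a) * ((1/2) ^ n - (1/2) ^ (m + n))"
    using norm_digit_term[of "m + n" "\<omega> (m + n)", where 'a='a] Suc
    by (intro add_mono) (simp_all add: dist_norm)
  finally show ?case by (simp add: algebra_simps)
qed simp

lemma dist_path_point_corner:
  "dist (path_point \<omega> :: 'a::euclidean_space) (corner (prefix_rev \<omega> n)) \<le> DIM('a) * (1/2) ^ n"
proof (rule tendsto_upperbound)
  show "(\<lambda>m. dist (corner (prefix_rev \<omega> m) :: 'a) (corner (prefix_rev \<omega> n)))
    \<longlonglongrightarrow> dist (path_point \<omega> :: 'a) (corner (prefix_rev \<omega> n))"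
    by (intro tendsto_intros corner_LIMSEQ)
  show "\<forall>\<^sub>F m in sequentially. dist (corner (prefix_rev \<omega> m) :: 'a) (corner (prefix_rev \<omega> n)) \<le> DIM('a) * (1/2) ^ n"
    using eventually_ge_at_top[of n]
  proof eventually_elim
    case (elim m)
    have "dist (corner (prefix_rev \<omega> m) :: 'a) (corner (prefix_rev \<omega> n)) \<le> DIM('a) * ((1/2) ^ n - (1/2) ^ m)"
      using corner_Suc_dist[of \<omega> "m - n" n, where 'a='a] elim by simp
    also have "\<dots> \<le> DIM('a) * (1/2) ^ n" by (intro mult_left_mono) auto
    finally show ?case .
  qed
qed simp

lemma continuous_on_path_point: "continuous_on UNIV (path_point :: _ \<Rightarrow> 'a::euclidean_space)"
proof (rule uniform_limit_theorem)
  show "\<forall>\<^sub>F n in sequentially. continuous_on UNIV (\<lambda>\<omega>. corner (prefix_rev \<omega> n) :: 'a)"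
  proof (intro always_eventually allI)
    fix n
    have "continuous_on UNIV (\<lambda>\<omega>. digit_vec (\<omega> i) :: 'a)" for i
      by (rule continuous_on_compose2[of UNIV digit_vec, OF _ continuous_on_product_coordinates]) auto
    then show "continuous_on UNIV (\<lambda>\<omega>. corner (prefix_rev \<omega> n) :: 'a)"
      unfolding corner_prefix_rev by (intro continuous_intros) auto
  qed
  show "uniform_limit UNIV (\<lambda>n \<omega>. corner (prefix_rev \<omega> n) :: 'a) path_point sequentially"
  proof (rule uniform_limitI)
    fix e :: real assume "0 < e"
    have "(\<lambda>n. DIM('a) * (1/2::real) ^ n) \<longlonglongrightarrow> real DIM('a) * 0"
      by (intro tendsto_intros LIMSEQ_power_zero) auto
    then have "\<forall>\<^sub>F n in sequentially. DIM('a) * (1/2::real) ^ n < e"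
      using \<open>0 < e\<close> by (simp add: order_tendsto_iff)
    then show "\<forall>\<^sub>F n in sequentially. \<forall>\<omega>\<in>UNIV. dist (corner (prefix_rev \<omega> n) :: 'a) (path_point \<omega>) < e"
    proof eventually_elim
      case (elim n)
      then show ?case
        using le_less_trans[OF dist_path_point_corner[of _ n, where 'a='a]] by (simp add: dist_commute)
    qed
  qed
qed simp

definition digit_paths :: "'a::euclidean_space itself \<Rightarrow> (nat \<Rightarrow> nat) set" where
  "digit_paths _ = {\<omega>. \<forall>i. \<omega> i < 2 ^ DIM('a)}"

lemma unit_cube_path:
  fixes x :: "'a::euclidean_space"
  assumes x: "\<And>b. b \<in> Basis \<Longrightarrow> 0 \<le> x \<bullet> b \<and> x \<bullet> b \<le> 1"
  obtains \<omega> where "\<omega> \<in> digit_paths TYPE('a)" "path_point \<omega> = x"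
proof -
  \<comment> \<open>Greedy expansion by doubling. With the closed threshold 1/2 the remainder stays
    in the closed cube, and a coordinate 1 reproduces itself with digit 1, so the upper faces are
    reached as well.\<close>
  define step where "step y = (SOME j. j < 2 ^ DIM('a) \<and> digit j = {b\<in>Basis. 1/2 \<le> (y::'a) \<bullet> b})" for y
  have step: "step y < 2 ^ DIM('a)" "digit (step y) = {b\<in>Basis. 1/2 \<le> y \<bullet> b}" for y :: 'a
  proof -
    have "{b\<in>Basis. 1/2 \<le> y \<bullet> b} \<in> digit ` {..<2 ^ DIM('a)}"
      using bij_betw_digit[where 'a='a] unfolding bij_betw_def by auto
    then have "\<exists>j. j < 2 ^ DIM('a) \<and> digit j = {b\<in>Basis. 1/2 \<le> y \<bullet> b}" by force
    from someI_ex[OF this] show "step y < 2 ^ DIM('a)" "digit (step y) = {b\<in>Basis. 1/2 \<le> y \<bullet> b}"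
      unfolding step_def by auto
  qed
  define X where "X = rec_nat x (\<lambda>_ y. 2 *\<^sub>R y - digit_vec (step y))"
  have X_0: "X 0 = x" and X_Suc: "X (Suc n) = 2 *\<^sub>R X n - digit_vec (step (X n))" for n
    by (simp_all add: X_def)
  define \<omega> where "\<omega> n = step (X n)" for n
  have box: "b \<in> Basis \<Longrightarrow> 0 \<le> X n \<bullet> b \<and> X n \<bullet> b \<le> 1" for n b
    by (induction n) (auto simp: X_0 x X_Suc inner_diff_left digit_vec_inner step)
  have eq: "x = corner (prefix_rev \<omega> n) + (1/2) ^ n *\<^sub>R X n" for n
    by (induction n) (simp_all add: X_0 X_Suc \<omega>_def scaleR_diff_right)
  have "(\<lambda>n. corner (prefix_rev \<omega> n) + (1/2) ^ n *\<^sub>R X n) \<longlonglongrightarrow> path_point \<omega> + 0"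
  proof (intro tendsto_add corner_LIMSEQ)
    show "(\<lambda>n. (1/2) ^ n *\<^sub>R X n) \<longlonglongrightarrow> 0"
    proof (rule Lim_null_comparison)
      show "\<forall>\<^sub>F n in sequentially. norm ((1/2) ^ n *\<^sub>R X n) \<le> DIM('a) * (1/2) ^ n"
      proof (intro always_eventually allI)
        fix n
        have "norm (X n) \<le> (\<Sum>b\<in>Basis. \<bar>X n \<bullet> b\<bar>)" by (rule norm_le_l1)
        also have "\<dots> \<le> (\<Sum>b\<in>(Basis :: 'a set). 1)" using box by (intro sum_mono) auto
        finally show "norm ((1/2) ^ n *\<^sub>R X n) \<le> DIM('a) * (1/2) ^ n"
          using mult_left_mono[of "norm (X n)" "DIM('a)" "(1/2)^n"] by (simp add: mult.commute)
      qed
      have "(\<lambda>n. DIM('a) * (1/2::real) ^ n) \<longlonglongrightarrow> real DIM('a) * 0"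
        by (intro tendsto_intros LIMSEQ_power_zero) auto
      then show "(\<lambda>n. DIM('a) * (1/2::real) ^ n) \<longlonglongrightarrow> 0" by simp
    qed
  qed
  then have "path_point \<omega> = x" using eq LIMSEQ_unique[OF _ tendsto_const[of x]] by simp
  moreover have "\<omega> \<in> digit_paths TYPE('a)" by (simp add: digit_paths_def \<omega>_def step)
  ultimately show thesis using that by blast
qed

text \<open>The corner in units of the side length. It turns the count of words with nearby corners
  into a count of lattice points.\<close>

primrec corner_int :: "'a::euclidean_space \<Rightarrow> nat list \<Rightarrow> int" where
  "corner_int b [] = 0"
| "corner_int b (j # w) = 2 * corner_int b w + (if b \<in> digit j then 1 else 0)"

lemma corner_int_eq:
  fixes b :: "'a::euclidean_space"
  assumes "set w \<subseteq> {..<2 ^ DIM('a)}" "b \<in> Basis"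
  shows "of_int (corner_int b w) = 2 ^ length w * (corner w \<bullet> b)"
  using assms by (induction w) (auto simp: inner_add_left digit_vec_inner algebra_simps power_divide)

text \<open>The parity of \<open>corner_int b\<close> tells whether b belongs to the last digit, and
  halving removes that digit.\<close>

lemma corner_int_inject:
  assumes "length w = length w'" "set w \<subseteq> {..<2 ^ DIM('a)}" "set w' \<subseteq> {..<2 ^ DIM('a)}"
    and "\<And>b::'a::euclidean_space. b \<in> Basis \<Longrightarrow> corner_int b w = corner_int b w'"
  shows "w = w'"
  using assms
proof (induction w w' rule: list_induct2)
  case (Cons j w j' w')
  have *: "(b \<in> digit j \<longleftrightarrow> b \<in> digit j') \<and> corner_int b w = corner_int b w'" if "b \<in> Basis" for b :: 'a
    using Cons.prems(3)[OF that] by (auto split: if_splits) presburger+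
  moreover have "digit j \<in> Pow (Basis :: 'a set)" "digit j' \<in> Pow (Basis :: 'a set)"
    using bij_betw_digit[where 'a='a] Cons.prems by (auto simp: bij_betw_def)
  ultimately have "digit j = (digit j' :: 'a set)" by blast
  then have "j = j'"
    using bij_betw_digit[where 'a='a] Cons.prems by (auto simp: bij_betw_def inj_on_def)
  moreover have "w = w'" by (rule Cons.IH) (use Cons.prems * in auto)
  ultimately show ?case by simp
qed simp

text \<open>After scaling by \<open>2 ^ n\<close> the corners are distinct lattice points in a cube
  of side \<open>2 * \<rho>\<close>, which has at most \<open>2 * \<rho> + 1\<close> integers per
  coordinate. The bound does not depend on n; this is the bounded overlap needed for Frostman's ball
  condition.\<close>

lemma card_corners_near:
  fixes y :: "'a::euclidean_space" and \<rho> :: real and n :: nat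
  assumes "\<rho> \<ge> 0"
  defines "G \<equiv> {w. length w = n \<and> set w \<subseteq> {..<2 ^ DIM('a)} \<and> dist (corner w) y \<le> \<rho> * (1/2) ^ n}"
  shows "finite G" "real (card G) \<le> (2 * \<rho> + 1) ^ DIM('a)"
proof -
  let ?z = "\<lambda>w. \<lambda>b\<in>(Basis :: 'a set). corner_int b w"
  let ?lo = "\<lambda>b. \<lceil>2 ^ n * (y \<bullet> b) - \<rho>\<rceil>" and ?hi = "\<lambda>b. \<lfloor>2 ^ n * (y \<bullet> b) + \<rho>\<rfloor>"
  let ?P = "\<Pi>\<^sub>E b\<in>(Basis :: 'a set). {?lo b..?hi b}"
  have "?z ` G \<subseteq> ?P"
  proof (safe intro!: PiE_I)
    fix w and b :: 'a assume w: "w \<in> G" and b: "b \<in> Basis"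
    have "\<bar>2 ^ n * (corner w \<bullet> b) - 2 ^ n * (y \<bullet> b)\<bar> = 2 ^ n * \<bar>(corner w - y) \<bullet> b\<bar>"
      by (simp add: abs_mult inner_diff_left flip: right_diff_distrib)
    also have "\<dots> \<le> 2 ^ n * dist (corner w) y"
      using Basis_le_norm[OF b, of "corner w - y"] by (simp add: dist_norm)
    also have "\<dots> \<le> 2 ^ n * (\<rho> * (1/2) ^ n)" using w by (intro mult_left_mono) (auto simp: G_def)
    also have "\<dots> = \<rho>" by (simp add: power_divide)
    finally have "\<bar>of_int (corner_int b w) - 2 ^ n * (y \<bullet> b)\<bar> \<le> \<rho>"
      using corner_int_eq[of w b] w b by (auto simp: G_def)
    then show "?z w b \<in> {?lo b..?hi b}" using b by (auto simp: ceiling_le_iff le_floor_iff abs_le_iff)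
  qed auto
  moreover have inj: "inj_on ?z G"
  proof (rule inj_onI)
    fix w w' assume *: "w \<in> G" "w' \<in> G" "?z w = ?z w'"
    then have "corner_int b w = corner_int b w'" if "b \<in> Basis" for b :: 'a
      using that by (metis restrict_apply')
    then show "w = w'" using * by (intro corner_int_inject) (auto simp: G_def)
  qed
  moreover have fin: "finite ?P" by (intro finite_PiE) auto
  ultimately show "finite G" using finite_imageD[OF finite_subset] by blast
  have "card G \<le> card ?P"
    by (rule card_inj_on_le[OF inj \<open>?z ` G \<subseteq> ?P\<close> fin])
  then have "real (card G) \<le> real (card ?P)" by simp
  also have "\<dots> = (\<Prod>b\<in>(Basis :: 'a set). real (card {?lo b..?hi b}))" by (simp add: card_PiE)
  also have "\<dots> \<le> (\<Prod>b\<in>(Basis :: 'a set). 2 * \<rho> + 1)"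
  proof (intro prod_mono conjI)
    fix b :: 'a
    have "real_of_int (?hi b - ?lo b + 1) \<le> 2 * \<rho> + 1" by linarith
    moreover have "(0::real) \<le> 2 * \<rho> + 1" using assms(1) by simp
    ultimately show "real (card {?lo b..?hi b}) \<le> 2 * \<rho> + 1" by (auto simp: nat_le_real_less of_nat_nat)
  qed auto
  finally show "real (card G) \<le> (2 * \<rho> + 1) ^ DIM('a)" by simp
qed

subsection \<open>Frostman's lemma\<close>

text \<open>Each word \<open>w\<close> is given an interval of length \<open>f w\<close>, nested along the tree, and a point of the
  interval of the empty word selects the path of the intervals that contain it.\<close>

lemma tree_intervals:
  fixes f :: "nat list \<Rightarrow> real"
  assumes f: "\<And>w. 0 \<le> f w" and add: "\<And>w. (\<Sum>j<N. f (j # w)) = f w"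
  obtains X :: "real \<Rightarrow> nat \<Rightarrow> nat"
    where "\<And>n. (\<lambda>t. prefix_rev (X t) n) \<in> borel \<rightarrow>\<^sub>M count_space UNIV"
      "\<And>t n. 0 \<le> t \<Longrightarrow> t < f [] \<Longrightarrow> X t n < N \<and> 0 < f (prefix_rev (X t) n)"
      "\<And>w. emeasure lborel {t\<in>{0..<f []}. prefix_rev (X t) (length w) = w} \<le> ennreal (f w)"
proof -
  \<comment> \<open>The left end of the interval of a word; the intervals of its children lie side
    by side in the order of their letters.\<close>
  define a where "a = rec_list 0 (\<lambda>j w aw. aw + (\<Sum>i<j. f (i # w)))"
  have a_Nil: "a [] = 0" and a_Cons: "a (j # w) = a w + (\<Sum>i<j. f (i # w))" for j w
    by (simp_all add: a_def)
  define letter where "letter t w = (LEAST j. t < a w + (\<Sum>i\<le>j. f (i # w)))" for t w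
  define nd where "nd t = rec_nat [] (\<lambda>_ w. letter t w # w)" for t
  have nd_0: "nd t 0 = []" and nd_Suc: "nd t (Suc n) = letter t (nd t n) # nd t n" for t n
    by (simp_all add: nd_def)
  define X where "X t n = letter t (nd t n)" for t n
  have pre: "prefix_rev (X t) n = nd t n" for t n
    by (induction n) (simp_all add: nd_0 nd_Suc X_def)
  have letter: "letter t w < N \<and> a (letter t w # w) \<le> t \<and> t < a (letter t w # w) + f (letter t w # w)"
    if t: "a w \<le> t" "t < a w + f w" for t w
  proof -
    let ?P = "\<lambda>j. t < a w + (\<Sum>i\<le>j. f (i # w))"
    have N: "N \<noteq> 0" using t add[of w] by (cases N) auto
    then have "{..N - 1} = {..<N}" by auto
    then have P: "?P (N - 1)" using t add[of w] by simp
    have 1: "?P (letter t w)" unfolding letter_def by (rule LeastI[of ?P, OF P])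
    have 2: "letter t w \<le> N - 1" unfolding letter_def by (rule Least_le[of ?P, OF P])
    have 3: "a (letter t w # w) \<le> t"
    proof (cases "letter t w")
      case 0
      then show ?thesis using t by (simp add: a_Cons)
    next
      case (Suc k)
      then have "\<not> ?P k" using not_less_Least[of k ?P] unfolding letter_def by simp
      then show ?thesis by (simp add: a_Cons Suc lessThan_Suc_atMost)
    qed
    have "(\<Sum>i\<le>letter t w. f (i # w)) = (\<Sum>i<letter t w. f (i # w)) + f (letter t w # w)"
      by (simp flip: lessThan_Suc_atMost)
    with 1 2 3 N show ?thesis by (simp add: a_Cons)
  qed
  \<comment> \<open>The intervals are half-open, so one that contains t has positive length. This is
    why a path never visits a word of mass zero.\<close>
  have inv: "a (nd t n) \<le> t \<and> t < a (nd t n) + f (nd t n)" if "0 \<le> t" "t < f []" for t n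
    using that by (induction n) (auto simp: nd_0 nd_Suc a_Nil dest: letter)
  have letter_meas: "(\<lambda>t. letter t w) \<in> borel \<rightarrow>\<^sub>M count_space UNIV" for w
    unfolding letter_def by measurable
  have nd_meas: "(\<lambda>t. nd t n) \<in> borel \<rightarrow>\<^sub>M count_space UNIV" for n
  proof (induction n)
    case (Suc n)
    have "(\<lambda>t. (\<lambda>w t. letter t w # w) (nd t n) t) \<in> borel \<rightarrow>\<^sub>M count_space UNIV"
    proof (rule measurable_compose_countable[OF _ Suc])
      show "(\<lambda>t. letter t w # w) \<in> borel \<rightarrow>\<^sub>M count_space UNIV" for w
        by (rule measurable_compose[OF letter_meas]) simp
    qed
    then show ?case by (simp add: nd_Suc)
  qed (simp add: nd_0)
  show thesis
  proof
    show "(\<lambda>t. prefix_rev (X t) n) \<in> borel \<rightarrow>\<^sub>M count_space UNIV" for n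
      unfolding pre by (rule nd_meas)
    show "X t n < N \<and> 0 < f (prefix_rev (X t) n)" if "0 \<le> t" "t < f []" for t n
      using inv[OF that, of n] letter[of "nd t n" t] by (auto simp: pre X_def)
    show "emeasure lborel {t\<in>{0..<f []}. prefix_rev (X t) (length w) = w} \<le> ennreal (f w)" for w
    proof -
      have "{t\<in>{0..<f []}. prefix_rev (X t) (length w) = w} \<subseteq> {a w..a w + f w}"
      proof safe
        fix t assume "t \<in> {0..<f []}" "prefix_rev (X t) (length w) = w"
        then show "t \<in> {a w..a w + f w}"
          using inv[of t "length w"] by (auto simp: pre)
      qed
      then have "emeasure lborel {t\<in>{0..<f []}. prefix_rev (X t) (length w) = w}
        \<le> emeasure lborel {a w..a w + f w}" by (intro emeasure_mono) auto
      then show ?thesis using f by simp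
    qed
  qed
qed

text \<open>The s-th power of the side length of the dyadic cube coded by the word. The factor
  between side and diameter is paid when the content is compared with Hausdorff measure.\<close>

definition net_measure :: "real \<Rightarrow> nat list measure" where
  "net_measure s = density (count_space UNIV) (\<lambda>w. ennreal ((1/2) powr (s * length w)))"

lemma sets_net_measure [simp]: "sets (net_measure s) = UNIV"
  by (simp add: net_measure_def)

lemma emeasure_net_measure:
  "emeasure (net_measure s) W = (\<integral>\<^sup>+w. ennreal ((1/2) powr (s * length w)) * indicator W w \<partial>count_space UNIV)"
  unfolding net_measure_def by (subst emeasure_density) auto

lemma emeasure_net_measure_finite:
  "finite W \<Longrightarrow> emeasure (net_measure s) W = (\<Sum>w\<in>W. ennreal ((1/2) powr (s * length w)))"
  unfolding emeasure_net_measure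
  by (subst nn_integral_count_space'[of W]) auto

text \<open>The mass of a node is distributed among its children proportionally to their contents; since
  the content is subadditive, no node receives more than its own content.\<close>

lemma tree_flow:
  fixes F :: "(nat \<Rightarrow> nat) set"
  assumes F: "\<And>\<omega> i. \<omega> \<in> F \<Longrightarrow> \<omega> i < N" and pos: "0 < net_content (net_measure s) F"
  obtains f :: "nat list \<Rightarrow> real"
    where "\<And>w. 0 \<le> f w" "\<And>w. (\<Sum>j<N. f (j # w)) = f w" "0 < f []"
      "\<And>w. f w \<le> (1/2) powr (s * length w)" "\<And>w. 0 < f w \<Longrightarrow> F \<inter> cylinder w \<noteq> {}"
proof -
  define c where "c w = net_content (net_measure s) (F \<inter> cylinder w)" for w
  have c_le: "c w \<le> ennreal ((1/2) powr (s * length w))" for w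
  proof -
    have "c w \<le> emeasure (net_measure s) {w}"
      unfolding c_def by (rule net_content_le) (auto simp: cylinders_def)
    then show ?thesis by (simp add: emeasure_net_measure_finite)
  qed
  then have c_fin: "c w < \<infinity>" for w by (metis ennreal_less_top infinity_ennreal_def le_less_trans)
  define r where "r w = enn2real (c w)" for w
  have c_r: "c w = ennreal (r w)" for w using c_fin[of w] by (simp add: r_def)
  have r0: "0 \<le> r w" for w by (simp add: r_def)
  have r_le: "r w \<le> (1/2) powr (s * length w)" for w
    using c_le[of w] by (simp add: c_r)
  have c_sum: "c w \<le> (\<Sum>j<N. c (j # w))" for w
  proof -
    have "F \<inter> cylinder w = (\<Union>j<N. F \<inter> cylinder (j # w))"
      using F by (auto simp: cylinder_Cons)
    then show ?thesis unfolding c_def by (metis net_content_UN_le sets_net_measure)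
  qed
  have r_sum: "r w \<le> (\<Sum>j<N. r (j # w))" for w
    using c_sum[of w] r0 by (simp add: c_r sum_nonneg)
  define f where "f = rec_list (r []) (\<lambda>j w fw. fw * r (j # w) / (\<Sum>i<N. r (i # w)))"
  have f_Nil: "f [] = r []" and f_Cons: "f (j # w) = f w * r (j # w) / (\<Sum>i<N. r (i # w))" for j w
    by (simp_all add: f_def)
  have f_bounds: "0 \<le> f w \<and> f w \<le> r w" for w
  proof (induction w)
    case (Cons j w)
    have s0: "0 \<le> (\<Sum>i<N. r (i # w))" by (simp add: sum_nonneg r0)
    have "f w / (\<Sum>i<N. r (i # w)) \<le> 1"
      using Cons r_sum[of w] s0 by (auto simp: divide_le_eq_1)
    then have "f w / (\<Sum>i<N. r (i # w)) * r (j # w) \<le> 1 * r (j # w)"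
      by (intro mult_right_mono r0)
    then show ?case using Cons s0 r0 by (auto simp: f_Cons)
  qed (simp add: f_Nil r0)
  show thesis
  proof
    show "0 \<le> f w" for w using f_bounds by blast
    show "(\<Sum>j<N. f (j # w)) = f w" for w
    \<comment> \<open>If all children have content zero, then so does \<open>w\<close> by
      \<open>r_sum\<close>, and its mass is zero. Division by zero then gives the right value
      0.\<close>
    proof (cases "(\<Sum>i<N. r (i # w)) = 0")
      case True
      then have "f w = 0" using f_bounds[of w] r_sum[of w] by simp
      then show ?thesis by (simp add: f_Cons)
    next
      case False
      then show ?thesis by (simp add: f_Cons flip: sum_divide_distrib sum_distrib_left)
    qed
    have "0 < c []" using pos by (simp add: c_def)
    then show "0 < f []" by (simp add: f_Nil c_r)
    show "f w \<le> (1/2) powr (s * length w)" for w using f_bounds[of w] r_le[of w] by simp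
    show "F \<inter> cylinder w \<noteq> {}" if "0 < f w" for w
    proof
      assume "F \<inter> cylinder w = {}"
      then have "r w = 0" by (simp add: r_def c_def)
      with that f_bounds[of w] show False by simp
    qed
  qed
qed

section \<open>Contents in Euclidean space and Hausdorff measure\<close>

definition scaled_point :: "real \<Rightarrow> (nat \<Rightarrow> nat) \<Rightarrow> 'a::euclidean_space" where
  "scaled_point L \<omega> = L *\<^sub>R (2 *\<^sub>R path_point \<omega> - One)"

text \<open>The content is taken of all expansions of all points of \<open>E\<close>, so a point
  with several expansions is covered in each of them. Preimages commute with unions, hence the
  results on the tree transfer directly.\<close>

definition cube_content :: "real \<Rightarrow> real \<Rightarrow> 'a::euclidean_space set \<Rightarrow> ennreal" where
  "cube_content s L E =
     net_content (net_measure s) {\<omega>\<in>digit_paths TYPE('a). scaled_point L \<omega> \<in> E}"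

lemma cube_content_mono: "E \<subseteq> F \<Longrightarrow> cube_content s L E \<le> cube_content s L F"
  unfolding cube_content_def by (intro net_content_mono) auto

lemma cube_content_incseq:
  fixes E :: "nat \<Rightarrow> 'a::euclidean_space set"
  assumes "incseq E" "a < cube_content s L (\<Union>n. E n)"
  shows "\<exists>n. a < cube_content s L (E n)"
proof (rule ccontr)
  assume "\<not> ?thesis"
  then have "net_content (net_measure s) (\<Union>n. {\<omega>\<in>digit_paths TYPE('a). scaled_point L \<omega> \<in> E n}) \<le> a"
    using assms(1) unfolding cube_content_def
    by (intro net_content_incseq) (auto simp: incseq_def not_less)
  moreover have "(\<Union>n. {\<omega>\<in>digit_paths TYPE('a). scaled_point L \<omega> \<in> E n}) =
    {\<omega>\<in>digit_paths TYPE('a). scaled_point L \<omega> \<in> (\<Union>n. E n)}" by auto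
  ultimately show False using assms(2) by (simp add: cube_content_def)
qed

lemma continuous_on_scaled_point: "continuous_on S (scaled_point L :: _ \<Rightarrow> 'a::euclidean_space)"
  unfolding scaled_point_def
  by (intro continuous_intros continuous_on_subset[OF continuous_on_path_point]) auto

lemma compact_digit_paths: "compact (digit_paths TYPE('a::euclidean_space))"
proof -
  have *: "x < 2 ^ DIM('a) \<longleftrightarrow> x \<le> 2 ^ DIM('a) - 1" for x :: nat
  proof -
    have "(0::nat) < 2 ^ DIM('a)" by simp
    then show ?thesis by linarith
  qed
  have "digit_paths TYPE('a) = {\<sigma>. \<forall>i. \<sigma> i \<le> 2 ^ DIM('a) - 1}"
    unfolding digit_paths_def using * by simp
  then show ?thesis using compact_bounded_sequences by simp
qed

lemma open_cylinder: "open (cylinder w)"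
proof (induction w)
  case (Cons j w)
  have "cylinder (j # w) = cylinder w \<inter> (\<lambda>\<omega>. \<omega> (length w)) -` {j}"
    by (auto simp: cylinder_Cons)
  moreover have "open ((\<lambda>\<omega>::nat \<Rightarrow> nat. \<omega> (length w)) -` {j})"
    by (intro open_vimage continuous_on_product_coordinates) (simp add: discrete_topology_class.open_discrete)
  ultimately show ?case using Cons by auto
qed simp

text \<open>Cylinders are open, so the digit paths missed by a cover form a compact set. Its image
  \<open>Z\<close> is compact and disjoint from \<open>K\<close>, and the cover already handles the
  whole open set \<open>- Z\<close>.\<close>

lemma cube_content_compact:
  fixes K :: "'a::euclidean_space set"
  assumes K: "\<And>U. open U \<Longrightarrow> K \<subseteq> U \<Longrightarrow> a < cube_content s L U"
  shows "a \<le> cube_content s L K"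
proof (rule ccontr)
  assume "\<not> ?thesis"
  then obtain W where W: "{\<omega>\<in>digit_paths TYPE('a). scaled_point L \<omega> \<in> K} \<subseteq> cylinders W"
    "emeasure (net_measure s) W < a"
    unfolding cube_content_def by (auto simp: not_le elim: net_content_lessE)
  define Z where "Z = (scaled_point L :: _ \<Rightarrow> 'a) ` (digit_paths TYPE('a) \<inter> - cylinders W)"
  have "closed (- cylinders W)" unfolding cylinders_def by (auto intro: open_cylinder)
  then have "compact Z" unfolding Z_def
    by (intro compact_continuous_image continuous_on_scaled_point compact_Int_closed compact_digit_paths)
  then have "open (- Z)" by (simp add: compact_imp_closed open_Compl)
  moreover have "K \<subseteq> - Z" using W(1) by (auto simp: Z_def)
  ultimately have "a < cube_content s L (- Z)" by (rule K)
  moreover have "cube_content s L (- Z) \<le> emeasure (net_measure s) W"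
    unfolding cube_content_def by (intro net_content_le) (auto simp: Z_def)
  ultimately show False using W(2) by auto
qed

lemma dist_scaled_point_corner:
  assumes "0 \<le> L"
  shows "dist (scaled_point L \<omega> :: 'a::euclidean_space) (L *\<^sub>R (2 *\<^sub>R corner (prefix_rev \<omega> n) - One))
    \<le> 2 * L * DIM('a) * (1/2) ^ n"
proof -
  have "scaled_point L \<omega> - (L *\<^sub>R (2 *\<^sub>R corner (prefix_rev \<omega> n) - One)) =
    (2 * L) *\<^sub>R (path_point \<omega> - corner (prefix_rev \<omega> n) :: 'a)"
    by (simp add: scaled_point_def algebra_simps)
  then have "dist (scaled_point L \<omega> :: 'a) (L *\<^sub>R (2 *\<^sub>R corner (prefix_rev \<omega> n) - One)) =
    2 * L * dist (path_point \<omega> :: 'a) (corner (prefix_rev \<omega> n))"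
    using assms by (simp add: dist_norm)
  also have "\<dots> \<le> 2 * L * (DIM('a) * (1/2) ^ n)"
    using assms by (intro mult_left_mono dist_path_point_corner) auto
  finally show ?thesis by (simp add: mult.assoc)
qed

lemma dist_scaled_point_cylinder:
  assumes "0 \<le> L" "\<omega> \<in> cylinder w" "\<omega>' \<in> cylinder w"
  shows "dist (scaled_point L \<omega> :: 'a::euclidean_space) (scaled_point L \<omega>') \<le> 4 * L * DIM('a) * (1/2) ^ length w"
proof -
  have "prefix_rev \<omega> (length w) = w" "prefix_rev \<omega>' (length w) = w"
    using assms by (auto simp: cylinder_def)
  then show ?thesis
    using dist_scaled_point_corner[OF assms(1), of \<omega> "length w", where 'a='a]
      dist_scaled_point_corner[OF assms(1), of \<omega>' "length w", where 'a='a]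
      dist_triangle2[of "scaled_point L \<omega> :: 'a" "scaled_point L \<omega>'" "L *\<^sub>R (2 *\<^sub>R corner w - One)"]
    by auto
qed

lemma scaled_point_surj:
  fixes x :: "'a::euclidean_space"
  assumes "norm x \<le> L" "0 < L"
  obtains \<omega> where "\<omega> \<in> digit_paths TYPE('a)" "scaled_point L \<omega> = x"
proof -
  let ?y = "(1/2) *\<^sub>R ((1 / L) *\<^sub>R x + One)"
  have "0 \<le> ?y \<bullet> b \<and> ?y \<bullet> b \<le> 1" if "b \<in> Basis" for b
  proof -
    have "\<bar>x \<bullet> b\<bar> \<le> L" using Basis_le_norm[OF that, of x] assms by simp
    then have "- 1 \<le> x \<bullet> b / L" "x \<bullet> b / L \<le> 1" using assms(2) by (auto simp: field_simps)
    then show ?thesis using that by (simp add: inner_add_left)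
  qed
  then obtain \<omega> where "\<omega> \<in> digit_paths TYPE('a)" "path_point \<omega> = ?y" using unit_cube_path[of ?y] by blast
  moreover from this(2) have "scaled_point L \<omega> = x" using assms(2) by (simp add: scaled_point_def)
  ultimately show thesis using that by blast
qed

lemma hausdorff_content_le:
  fixes Q :: "'j::countable \<Rightarrow> 'a::euclidean_space set"
  assumes "E \<subseteq> (\<Union>j. Q j)" "\<And>j. bounded (Q j)" "\<And>j. diameter (Q j) \<le> \<delta>" "0 \<le> \<delta>"
  shows "hausdorff_content \<delta> s E \<le> (\<integral>\<^sup>+j. ennreal (diameter_power s (Q j)) \<partial>count_space UNIV)"
proof -
  let ?g = "to_nat :: 'j \<Rightarrow> nat"
  define U where "U i = (if i \<in> range ?g then Q (from_nat i) else {})" for i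
  have "E \<subseteq> (\<Union>i. U i)"
  proof
    fix x assume "x \<in> E"
    then obtain j where "x \<in> Q j" using assms(1) by auto
    then have "x \<in> U (?g j)" by (simp add: U_def)
    then show "x \<in> (\<Union>i. U i)" by blast
  qed
  then have "hausdorff_content \<delta> s E \<le> (\<Sum>i. ennreal (diameter_power s (U i)))"
    unfolding hausdorff_content_def using assms
    by (intro INF_lower) (auto simp: U_def)
  also have "\<dots> = (\<integral>\<^sup>+i. ennreal (diameter_power s (U i)) \<partial>count_space UNIV)"
    by (simp add: nn_integral_count_space_nat)
  also have "\<dots> = (\<integral>\<^sup>+i. ennreal (diameter_power s (Q (from_nat i))) * indicator (range ?g) i \<partial>count_space UNIV)"
    by (intro nn_integral_cong) (auto simp: U_def diameter_power_def split: split_indicator)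
  also have "\<dots> = (\<integral>\<^sup>+i. ennreal (diameter_power s (Q (from_nat i))) \<partial>count_space (range ?g))"
    by (rule nn_integral_count_space_indicator[symmetric]) (simp only: NO_MATCH_def)
  also have "\<dots> = (\<integral>\<^sup>+j. ennreal (diameter_power s (Q (from_nat (?g j)))) \<partial>count_space UNIV)"
    by (rule nn_integral_bij_count_space[symmetric]) (auto simp: bij_betw_def)
  finally show ?thesis by simp
qed

text \<open>The content has no mesh condition, and for positive s none is needed: each single weight
  is below the total, so a cover of small weight consists of small cubes. The cubes of half side 1,
  2, 3, ... exhaust the space.\<close>

lemma hausdorff_measure_0_if_cube_content_0:
  fixes E :: "'a::euclidean_space set"
  assumes s: "0 < s" and 0: "\<And>L::nat. cube_content s (real (Suc L)) E = 0"
  shows "hausdorff_measure s E = 0"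
proof -
  have "hausdorff_content \<delta> s E \<le> 0" if "0 < \<delta>" for \<delta>
  proof (rule ennreal_le_epsilon)
    fix e :: real assume "0 < e"
    define D where "D L = 4 * real (Suc L) * DIM('a)" for L :: nat
    \<comment> \<open>The minimum with \<open>\<delta> powr s\<close> forces every diameter below
      \<open>\<delta>\<close>, and the terms \<open>e * (1/2) ^ Suc L\<close> add up to
      \<open>e\<close>. Dividing by \<open>1 + D L powr s\<close> in \<open>\<eta>\<close> pays for
      the passage from sides to diameters.\<close>
    define g where "g L = min (\<delta> powr s) (e * (1/2) ^ Suc L)" for L
    define \<eta> where "\<eta> L = g L / (1 + D L powr s)" for L
    have g: "0 < g L" for L using \<open>0 < e\<close> that by (simp add: g_def)
    have D1: "0 < 1 + D L powr s" for L by (simp add: add_pos_nonneg)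
    have \<eta>: "0 < \<eta> L" "D L powr s * \<eta> L \<le> g L" for L
      using g[of L] D1[of L] by (auto simp: \<eta>_def field_simps)
    have "\<exists>W. {\<omega>\<in>digit_paths TYPE('a). scaled_point (real (Suc L)) \<omega> \<in> E} \<subseteq> cylinders W \<and>
        emeasure (net_measure s) W < ennreal (\<eta> L)" for L
    proof -
      have "net_content (net_measure s) {\<omega>\<in>digit_paths TYPE('a). scaled_point (real (Suc L)) \<omega> \<in> E} < ennreal (\<eta> L)"
        using 0[of L] \<eta>(1)[of L] by (simp add: cube_content_def)
      then show ?thesis by (rule net_content_lessE) (intro exI conjI)
    qed
    then obtain W where W: "\<And>L. {\<omega>\<in>digit_paths TYPE('a). scaled_point (real (Suc L)) \<omega> \<in> E} \<subseteq> cylinders (W L)"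
      "\<And>L. emeasure (net_measure s) (W L) < ennreal (\<eta> L)" by metis
    define Q where "Q = (\<lambda>(L, w). if w \<in> W L then (scaled_point (real (Suc L)) :: _ \<Rightarrow> 'a) ` cylinder w else {})"
    have QD: "bounded (Q (L, w)) \<and> diameter (Q (L, w)) \<le> D L * (1/2) ^ length w" for L w
    proof
      have *: "norm (x - y) \<le> D L * (1/2) ^ length w" if "x \<in> Q (L, w)" "y \<in> Q (L, w)" for x y
        using that dist_scaled_point_cylinder[of "real (Suc L)" _ w, where 'a='a]
        by (auto simp: Q_def D_def dist_norm split: if_splits)
      then show "bounded (Q (L, w))" unfolding bounded_two_points dist_norm by blast
      show "diameter (Q (L, w)) \<le> D L * (1/2) ^ length w"
        by (intro diameter_le *) (auto simp: D_def)
    qed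
    have small: "(1/2) powr (s * length w) < \<eta> L" if "w \<in> W L" for L w
    proof -
      have "ennreal ((1/2) powr (s * length w)) = emeasure (net_measure s) {w}"
        by (simp add: emeasure_net_measure_finite)
      also have "\<dots> \<le> emeasure (net_measure s) (W L)" using that by (intro emeasure_mono) auto
      also have "\<dots> < ennreal (\<eta> L)" by (rule W)
      finally show ?thesis by (simp add: ennreal_less_iff)
    qed
    have Dpow: "(D L * (1/2) ^ length w) powr s = D L powr s * (1/2) powr (s * length w)" for L and w :: "nat list"
      by (simp add: D_def powr_mult powr_powr mult.commute flip: powr_realpow)
    have dp: "diameter_power s (Q (L, w)) \<le> D L powr s * (1/2) powr (s * length w) * indicator (W L) w" for L w
    proof (cases "w \<in> W L \<and> Q (L, w) \<noteq> {}")
      case True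
      have "diameter (Q (L, w)) powr s \<le> (D L * (1/2) ^ length w) powr s"
        using QD[of L w] s by (intro powr_mono2) (auto simp: diameter_ge_0)
      then show ?thesis using True s by (simp add: diameter_power_def Dpow)
    next
      case False
      then show ?thesis by (auto simp: diameter_power_def Q_def)
    qed
    have "E \<subseteq> (\<Union>j. Q j)"
    proof
      fix x assume "x \<in> E"
      obtain L where "norm x \<le> real L" using real_arch_simple by blast
      then have "norm x \<le> real (Suc L)" by simp
      then obtain \<omega> where \<omega>: "\<omega> \<in> digit_paths TYPE('a)" "scaled_point (real (Suc L)) \<omega> = x"
        by (rule scaled_point_surj) auto
      then have "\<omega> \<in> cylinders (W L)" using W(1)[of L] \<open>x \<in> E\<close> by auto
      then obtain w where "w \<in> W L" "\<omega> \<in> cylinder w" by (auto simp: cylinders_def)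
      then have "x \<in> Q (L, w)" using \<omega> by (auto simp: Q_def)
      then show "x \<in> (\<Union>j. Q j)" by blast
    qed
    moreover have "bounded (Q j)" for j using QD[of "fst j" "snd j"] by simp
    moreover have "diameter (Q j) \<le> \<delta>" for j
    proof (cases j)
      case (Pair L w)
      show ?thesis
      proof (cases "w \<in> W L")
        case True
        have "(D L * (1/2) ^ length w) powr s \<le> D L powr s * \<eta> L"
          unfolding Dpow using small[OF True] by (intro mult_left_mono) auto
        also have "\<dots> \<le> \<delta> powr s" using \<eta>(2)[of L] by (simp add: g_def)
        finally have "D L * (1/2) ^ length w \<le> \<delta>"
          using powr_less_mono2[OF s, of \<delta> "D L * (1/2) ^ length w"] that by fastforce
        then show ?thesis using QD[of L w] Pair by auto
      qed (use that Pair in \<open>simp add: Q_def\<close>)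
    qed
    ultimately have "hausdorff_content \<delta> s E \<le> (\<integral>\<^sup>+j. ennreal (diameter_power s (Q j)) \<partial>count_space UNIV)"
      using that by (intro hausdorff_content_le) auto
    also have "\<dots> = (\<integral>\<^sup>+L. \<integral>\<^sup>+w. ennreal (diameter_power s (Q (L, w))) \<partial>count_space UNIV \<partial>count_space UNIV)"
      by (rule nn_integral_fst_count_space[symmetric])
    also have "\<dots> \<le> (\<integral>\<^sup>+L. ennreal (e * (1/2) ^ Suc L) \<partial>count_space UNIV)"
    proof (rule nn_integral_mono)
      fix L
      have "(\<integral>\<^sup>+w. ennreal (diameter_power s (Q (L, w))) \<partial>count_space UNIV) \<le>
        (\<integral>\<^sup>+w. ennreal (D L powr s) * (ennreal ((1/2) powr (s * length w)) * indicator (W L) w) \<partial>count_space UNIV)"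
        using dp[of L] by (intro nn_integral_mono order_trans[OF ennreal_leI[OF dp]])
          (auto simp: ennreal_mult split: split_indicator)
      also have "\<dots> = ennreal (D L powr s) * emeasure (net_measure s) (W L)"
        by (subst nn_integral_cmult) (auto simp: emeasure_net_measure)
      also have "\<dots> \<le> ennreal (D L powr s) * ennreal (\<eta> L)"
        using W(2)[of L] by (intro mult_left_mono) auto
      also have "\<dots> = ennreal (D L powr s * \<eta> L)" using \<eta>(1)[of L] by (simp add: ennreal_mult)
      also have "\<dots> \<le> ennreal (e * (1/2) ^ Suc L)" using \<eta>(2)[of L] by (intro ennreal_leI) (simp add: g_def)
      finally show "(\<integral>\<^sup>+w. ennreal (diameter_power s (Q (L, w))) \<partial>count_space UNIV) \<le> ennreal (e * (1/2) ^ Suc L)" .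
    qed
    also have "\<dots> = (\<Sum>L. ennreal (e * (1/2) ^ Suc L))" by (simp add: nn_integral_count_space_nat)
    also have "\<dots> = ennreal e"
    proof (rule sums_unique[symmetric], subst sums_ennreal)
      show "(\<lambda>L. e * (1/2) ^ Suc L) sums e"
        using sums_mult[OF power_half_series, of e] by simp
    qed (use \<open>0 < e\<close> in auto)
    finally show "hausdorff_content \<delta> s E \<le> 0 + ennreal e" by simp
  qed
  then show ?thesis unfolding hausdorff_measure_def by (auto intro!: antisym SUP_least)
qed

text \<open>All words of length n form a cover of weight \<open>2 powr (n * (d - s))\<close>, which
  tends to 0. The consequence in use is that Hausdorff dimensions are never infinite from
  above.\<close>

lemma cube_content_0_if_gt_DIM:
  fixes E :: "'a::euclidean_space set" and s :: real
  assumes "DIM('a) < s"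
  shows "cube_content s L E = 0"
proof -
  let ?W = "\<lambda>n. {w :: nat list. set w \<subseteq> {..<2 ^ DIM('a)} \<and> length w = n}"
  have "cube_content s L E \<le> ennreal ((2 powr (DIM('a) - s)) ^ n)" for n
  proof -
    have "{\<omega>\<in>digit_paths TYPE('a). scaled_point L \<omega> \<in> E} \<subseteq> cylinders (?W n)"
    proof
      fix \<omega> assume \<omega>: "\<omega> \<in> {\<omega>\<in>digit_paths TYPE('a). scaled_point L \<omega> \<in> E}"
      have "set (prefix_rev \<omega> n) \<subseteq> {..<2 ^ DIM('a)}"
        using \<omega> by (induction n) (auto simp: digit_paths_def)
      then show "\<omega> \<in> cylinders (?W n)"
        unfolding cylinders_def by (intro UN_I[of "prefix_rev \<omega> n"]) auto
    qed
    then have "cube_content s L E \<le> emeasure (net_measure s) (?W n)"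
      unfolding cube_content_def by (rule net_content_le)
    also have "\<dots> = (\<Sum>w\<in>?W n. ennreal ((1/2) powr (s * length w)))"
      by (rule emeasure_net_measure_finite) (simp add: finite_lists_length_eq)
    also have "\<dots> = (\<Sum>w\<in>?W n. ennreal ((1/2) powr (s * n)))" by (rule sum.cong) auto
    also have "\<dots> = ennreal (real (card (?W n)) * (1/2) powr (s * n))"
      by (simp add: ennreal_mult ennreal_of_nat_eq_real_of_nat)
    also have "real (card (?W n)) * (1/2) powr (s * n) = (2 powr (DIM('a) - s)) ^ n"
    proof -
      have "real (card (?W n)) = 2 ^ (DIM('a) * n)"
        by (subst card_lists_length_eq) (simp_all add: power_mult)
      also have "\<dots> = 2 powr real (DIM('a) * n)" by (rule powr_realpow[symmetric]) simp
      finally have "real (card (?W n)) = 2 powr (real DIM('a) * real n)" by (simp only: of_nat_mult)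
      moreover have "(1/2::real) powr (s * n) = 2 powr (- (s * n))"
        using powr_powr[of 2 "-1" "s * n"] by (simp add: powr_minus_divide)
      moreover have "(2 powr (real DIM('a) - s)) ^ n = 2 powr ((real DIM('a) - s) * n)"
        by (subst powr_realpow[symmetric]) (simp_all add: powr_powr)
      ultimately show ?thesis by (simp only: powr_add[symmetric]) (simp add: algebra_simps)
    qed
    finally show ?thesis .
  qed
  moreover have "(\<lambda>n. ennreal ((2 powr (DIM('a) - s)) ^ n)) \<longlonglongrightarrow> ennreal 0"
  proof (intro tendsto_ennrealI LIMSEQ_power_zero)
    show "norm (2 powr (real DIM('a) - s)) < 1"
      using assms powr_less_mono[of "real DIM('a) - s" 0 2] by simp
  qed
  ultimately have "cube_content s L E \<le> ennreal 0"
    by (intro LIMSEQ_le_const) auto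
  then show ?thesis by simp
qed

lemma hausdorff_dim_le_DIM:
  fixes E :: "'a::euclidean_space set"
  shows "hausdorff_dim E \<le> ereal DIM('a)"
  unfolding hausdorff_dim_def
proof (intro Sup_least, safe)
  fix s :: real assume "0 \<le> s" "0 < hausdorff_measure s E"
  then show "ereal s \<le> ereal DIM('a)"
    using hausdorff_measure_0_if_cube_content_0[of s E] cube_content_0_if_gt_DIM[of s _ E]
    by (cases "s \<le> DIM('a)") auto
qed

lemma dyadic_scale:
  fixes r :: real
  assumes "0 < r" "r \<le> 1"
  obtains n where "(1/2) ^ Suc n < r" "r \<le> (1/2) ^ n"
proof -
  obtain m where m: "(1/2) ^ m < r" using real_arch_pow_inv[OF assms(1), of "1/2"] by auto
  define k where "k = (LEAST m. (1/2) ^ m < r)"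
  have k: "(1/2) ^ k < r" unfolding k_def by (rule LeastI[of "\<lambda>m. (1/2) ^ m < r", OF m])
  then obtain n where n: "k = Suc n" using assms(2) by (cases k) auto
  then have "\<not> (1/2) ^ n < r" using not_less_Least[of n "\<lambda>m. (1/2) ^ m < r"] by (simp add: k_def)
  with k n that show thesis by force
qed

lemma hausdorff_measure_empty: "hausdorff_measure s {} = 0"
proof -
  have "hausdorff_content \<delta> s ({} :: 'a set) \<le> 0" if "0 < \<delta>" for \<delta>
    using hausdorff_content_le[of "{}" "\<lambda>_::unit. {} :: 'a set" \<delta> s] that
    by (simp add: diameter_power_def)
  then show ?thesis unfolding hausdorff_measure_def by (auto intro!: antisym SUP_least)
qed

text \<open>A random point of an interval selects a path through the flow, and the measure is the
  law of the resulting point of space. Each word has mass at most its side to the power s, and a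
  ball meets boundedly many words of its own scale.\<close>

theorem frostman:
  fixes B :: "'a::euclidean_space set"
  assumes B: "B \<in> sets borel" and s: "0 \<le> s" and H: "0 < hausdorff_measure s B"
  obtains \<nu> K C where "prob_space \<nu>" "sets \<nu> = sets borel" "compact K" "K \<subseteq> B"
    "emeasure \<nu> (- K) = 0" "0 \<le> C" "\<And>x r. 0 < r \<Longrightarrow> emeasure \<nu> (cball x r) \<le> ennreal (C * r powr s)"
\<comment> \<open>For \<open>s = 0\<close> a small weight no longer forces small cubes, but a unit
  mass at any point of \<open>B\<close> satisfies the claim.\<close>
proof (cases "s = 0")
  case True
  have "B \<noteq> {}" using H hausdorff_measure_empty[of s, where 'a='a] by auto
  then obtain b where b: "b \<in> B" by blast
  show thesis
  proof
    show "prob_space (return borel b)" by (rule prob_space_return) simp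
    show "emeasure (return borel b) (- {b}) = 0" by (subst emeasure_return) auto
    show "emeasure (return borel b) (cball x r) \<le> ennreal (1 * r powr s)" if "0 < r" for x r
      using that True by (subst emeasure_return) (auto split: split_indicator)
  qed (use b in auto)
next
  case False
  then have s0: "0 < s" using s by simp
  obtain l :: nat where l: "cube_content s (real (Suc l)) B \<noteq> 0"
    using hausdorff_measure_0_if_cube_content_0[OF s0, of B] H by (metis less_irrefl)
  define L where "L = real (Suc l)"
  have L: "0 < L" "cube_content s L B \<noteq> 0" using l by (auto simp: L_def)
  obtain a where a: "0 < a" "a < cube_content s L B"
    using dense[of 0 "cube_content s L B"] L(2) by (auto simp: zero_less_iff_neq_zero)
  obtain K where K: "compact K" "K \<subseteq> B" "\<And>U. open U \<Longrightarrow> K \<subseteq> U \<Longrightarrow> a < cube_content s L U"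
    by (rule capacitability[of "cube_content s L" a B, OF cube_content_mono cube_content_incseq B a(2)], assumption, assumption, assumption) (rule that)
  have aK: "a \<le> cube_content s L K" by (rule cube_content_compact) (rule K)
  define F where "F = {\<omega>\<in>digit_paths TYPE('a). scaled_point L \<omega> \<in> K}"
  define N :: nat where "N = 2 ^ DIM('a)"
  have F_less: "\<omega> i < N" if "\<omega> \<in> F" for \<omega> i using that by (auto simp: F_def digit_paths_def N_def)
  have "0 < net_content (net_measure s) F"
    using a(1) aK by (auto simp: F_def cube_content_def)
  then obtain f :: "nat list \<Rightarrow> real" where f: "\<And>w. 0 \<le> f w" "\<And>w. (\<Sum>j<N. f (j # w)) = f w" "0 < f []"
      "\<And>w. f w \<le> (1/2) powr (s * length w)" "\<And>w. 0 < f w \<Longrightarrow> F \<inter> cylinder w \<noteq> {}"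
    by (rule tree_flow[of F N s, rotated]) (use F_less in blast)+
  obtain X :: "real \<Rightarrow> nat \<Rightarrow> nat"
    where X: "\<And>n. (\<lambda>t. prefix_rev (X t) n) \<in> borel \<rightarrow>\<^sub>M count_space UNIV"
      "\<And>t n. 0 \<le> t \<Longrightarrow> t < f [] \<Longrightarrow> X t n < N \<and> 0 < f (prefix_rev (X t) n)"
      "\<And>w. emeasure lborel {t\<in>{0..<f []}. prefix_rev (X t) (length w) = w} \<le> ennreal (f w)"
    by (rule tree_intervals[OF f(1,2)]) (rule that)
  define I where "I = {0..<f []}"
  have I: "I \<in> sets lborel" "emeasure lborel I = ennreal (f [])" using f(3) by (auto simp: I_def)
  define g :: "real \<Rightarrow> 'a" where "g t = scaled_point L (X t)" for t
  have "(\<lambda>t. corner (prefix_rev (X t) n) :: 'a) \<in> borel_measurable borel" for n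
    by (rule measurable_compose[OF X(1)]) simp
  then have "(\<lambda>t. path_point (X t) :: 'a) \<in> borel_measurable borel"
    by (rule borel_measurable_LIMSEQ_metric[OF _ corner_LIMSEQ])
  then have g [measurable]: "g \<in> borel_measurable borel"
    unfolding g_def scaled_point_def by measurable
  \<comment> \<open>Every word on the selected path has positive mass, so its cylinder contains a
    path of \<open>F\<close>. This gives points of \<open>K\<close> arbitrarily close to
    \<open>g t\<close>, and \<open>K\<close> is closed.\<close>
  have gK: "g t \<in> K" if "t \<in> I" for t
  proof (rule closed_approachable[THEN iffD1, OF compact_imp_closed[OF K(1)]], intro allI impI)
    fix e :: real assume "0 < e"
    have "(\<lambda>n. 4 * L * DIM('a) * (1/2) ^ n) \<longlonglongrightarrow> 4 * L * DIM('a) * 0"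
      by (intro tendsto_intros LIMSEQ_power_zero) auto
    then have "\<forall>\<^sub>F n in sequentially. 4 * L * DIM('a) * (1/2) ^ n < e"
      using \<open>0 < e\<close> by (simp add: order_tendsto_iff)
    then obtain n where n: "4 * L * DIM('a) * (1/2) ^ n < e"
      by (auto simp: eventually_sequentially)
    have "0 < f (prefix_rev (X t) n)" using X(2)[of t n] that by (auto simp: I_def)
    from f(5)[OF this] obtain \<omega> where \<omega>: "\<omega> \<in> F" "\<omega> \<in> cylinder (prefix_rev (X t) n)" by blast
    have "dist (scaled_point L \<omega> :: 'a) (g t) \<le> 4 * L * DIM('a) * (1/2) ^ n"
      using dist_scaled_point_cylinder[of L \<omega> "prefix_rev (X t) n" "X t", where 'a='a] L \<omega>(2)
      by (simp add: g_def)
    then show "\<exists>y\<in>K. dist y (g t) < e" using \<omega>(1) n by (intro bexI[of _ "scaled_point L \<omega>"]) (auto simp: F_def)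
  qed
  define \<nu> where "\<nu> = distr (uniform_measure lborel I) borel g"
  have \<nu>: "emeasure \<nu> E = emeasure lborel (I \<inter> g -` E) / ennreal (f [])" if E [measurable]: "E \<in> sets borel" for E
  proof -
    have "g -` E \<in> sets lborel" using measurable_sets_borel[OF g E] by simp
    then show ?thesis unfolding \<nu>_def using I
      by (subst emeasure_distr) (auto intro: E)
  qed
  interpret U: prob_space "uniform_measure lborel I"
    by (rule prob_space_uniform_measure) (use I f(3) in auto)
  have "prob_space \<nu>" unfolding \<nu>_def by (rule U.prob_space_distr) simp
  then interpret V: prob_space \<nu> .
  \<comment> \<open>After undoing the scaling by \<open>2 * L\<close>, the radius of the ball
    contributes \<open>1 / (2 * L)\<close> and the distance from a point to its corner contributes
    \<open>DIM('a)\<close>, both in units of \<open>(1/2) ^ n\<close>.\<close>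
  define \<rho> where "\<rho> = 1 / (2 * L) + DIM('a)"
  define M where "M = (2 * \<rho> + 1) ^ DIM('a)"
  have M: "0 \<le> M" "0 \<le> \<rho>" using L by (auto simp: M_def \<rho>_def)
  have ball: "emeasure lborel (I \<inter> g -` cball x r) \<le> ennreal (M * 2 powr s * r powr s)" if r: "0 < r" "r \<le> 1" for x r
  proof -
    obtain n where n: "(1/2) ^ Suc n < r" "r \<le> (1/2) ^ n" by (rule dyadic_scale[OF r])
    define y where "y = (1/2) *\<^sub>R ((1 / L) *\<^sub>R x + One)"
    define G where "G = {w. length w = n \<and> set w \<subseteq> {..<2 ^ DIM('a)} \<and> dist (corner w) y \<le> \<rho> * (1/2) ^ n}"
    have G: "finite G" "real (card G) \<le> M"
      using card_corners_near[OF M(2), of n y] by (auto simp: G_def M_def)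
    have sub: "I \<inter> g -` cball x r \<subseteq> (\<Union>w\<in>G. {t\<in>{0..<f []}. prefix_rev (X t) (length w) = w})"
    proof
      fix t assume t: "t \<in> I \<inter> g -` cball x r"
      let ?w = "prefix_rev (X t) n"
      have "X t i < N" for i using X(2)[of t i] t by (auto simp: I_def)
      then have "set ?w \<subseteq> {..<2 ^ DIM('a)}" by (induction n) (auto simp: N_def)
      moreover have "dist (corner ?w) y \<le> \<rho> * (1/2) ^ n"
      proof -
        have "2 * L * dist (corner ?w) y = norm ((2 * L) *\<^sub>R (corner ?w - y))"
          using L by (simp add: dist_norm)
        also have "(2 * L) *\<^sub>R (corner ?w - y) = L *\<^sub>R (2 *\<^sub>R corner ?w - One) - x"
          using L by (simp add: y_def algebra_simps)
        also have "norm \<dots> = dist (L *\<^sub>R (2 *\<^sub>R corner ?w - One)) x" by (simp add: dist_norm)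
        also have "\<dots> \<le> dist (g t) (L *\<^sub>R (2 *\<^sub>R corner ?w - One)) + dist (g t) x" by (rule dist_triangle3)
        also have "\<dots> \<le> 2 * L * DIM('a) * (1/2) ^ n + (1/2) ^ n"
          using dist_scaled_point_corner[of L "X t" n, where 'a='a] L t n(2)
          by (intro add_mono) (auto simp: g_def dist_commute)
        also have "\<dots> = 2 * L * (\<rho> * (1/2) ^ n)" using L by (simp add: \<rho>_def field_simps)
        finally show ?thesis using L by simp
      qed
      ultimately have "?w \<in> G" by (simp add: G_def)
      then show "t \<in> (\<Union>w\<in>G. {t\<in>{0..<f []}. prefix_rev (X t) (length w) = w})"
        using t by (intro UN_I[of ?w]) (auto simp: I_def)
    qed
    have meas: "{t\<in>{0..<f []}. prefix_rev (X t) (length w) = w} \<in> sets lborel" for w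
    proof -
      have "(\<lambda>t. prefix_rev (X t) (length w)) -` {w} \<in> sets borel"
        by (rule measurable_sets_borel[OF X(1)]) simp
      moreover have "{t\<in>{0..<f []}. prefix_rev (X t) (length w) = w} = {0..<f []} \<inter> (\<lambda>t. prefix_rev (X t) (length w)) -` {w}"
        by auto
      ultimately show ?thesis by simp
    qed
    have "emeasure lborel (I \<inter> g -` cball x r) \<le> emeasure lborel (\<Union>w\<in>G. {t\<in>{0..<f []}. prefix_rev (X t) (length w) = w})"
      by (rule emeasure_mono[OF sub]) (use G meas in auto)
    also have "\<dots> \<le> (\<Sum>w\<in>G. emeasure lborel {t\<in>{0..<f []}. prefix_rev (X t) (length w) = w})"
      by (rule emeasure_subadditive_finite) (use G meas in auto)
    also have "\<dots> \<le> (\<Sum>w\<in>G. ennreal ((1/2) powr (s * n)))"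
    proof (rule sum_mono)
      fix w assume "w \<in> G"
      then show "emeasure lborel {t\<in>{0..<f []}. prefix_rev (X t) (length w) = w} \<le> ennreal ((1/2) powr (s * n))"
        using X(3)[of w] f(4)[of w] by (auto simp: G_def intro: order_trans ennreal_leI)
    qed
    also have "\<dots> = ennreal (card G * (1/2) powr (s * n))"
      by (simp add: ennreal_mult ennreal_of_nat_eq_real_of_nat)
    also have "\<dots> \<le> ennreal (M * (2 * r) powr s)"
    proof (intro ennreal_leI mult_mono)
      have "((1/2) ^ n) powr s \<le> (2 * r) powr s" using n(1) s by (intro powr_mono2) auto
      then show "(1/2) powr (s * n) \<le> (2 * r) powr s"
        by (simp add: powr_powr mult.commute flip: powr_realpow)
    qed (use G M in auto)
    also have "M * (2 * r) powr s = M * 2 powr s * r powr s" using r by (simp add: powr_mult)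
    finally show ?thesis .
  qed
  \<comment> \<open>The maximum with 1 settles radii above 1, where the total mass is the
    bound.\<close>
  define C where "C = max 1 (M * 2 powr s / f [])"
  show thesis
  proof
    show "prob_space \<nu>" by (rule V.prob_space_axioms)
    show "sets \<nu> = sets borel" by (simp add: \<nu>_def)
    show "compact K" "K \<subseteq> B" by fact+
    have "I \<inter> g -` (- K) = {}" using gK by auto
    moreover have "- K \<in> sets borel" using K(1) by (intro borel_open open_Compl compact_imp_closed)
    ultimately show "emeasure \<nu> (- K) = 0" by (simp add: \<nu>)
    show "0 \<le> C" by (simp add: C_def)
    show "emeasure \<nu> (cball x r) \<le> ennreal (C * r powr s)" if r: "0 < r" for x r
    proof (cases "r \<le> 1")
      case True
      have "emeasure \<nu> (cball x r) \<le> ennreal (M * 2 powr s * r powr s) / ennreal (f [])"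
        using ball[OF r True, of x] by (simp add: \<nu> divide_right_mono_ennreal)
      also have "\<dots> = ennreal (M * 2 powr s * r powr s / f [])"
        using M f(3) by (intro divide_ennreal) auto
      also have "\<dots> \<le> ennreal (C * r powr s)"
      proof (rule ennreal_leI)
        have "(M * 2 powr s / f []) * r powr s \<le> C * r powr s" by (intro mult_right_mono) (auto simp: C_def)
        then show "M * 2 powr s * r powr s / f [] \<le> C * r powr s" by simp
      qed
      finally show ?thesis .
    next
      case False
      then have "1 \<le> r powr s" using s by (simp add: ge_one_powr_ge_zero)
      then have "1 * 1 \<le> C * r powr s" by (intro mult_mono) (auto simp: C_def)
      then have "1 \<le> ennreal (C * r powr s)" using ennreal_leI by fastforce
      then show ?thesis using V.emeasure_le_1[of "cball x r"] by (rule order_trans[rotated])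
    qed
  qed
qed

subsection \<open>Gaussian energies\<close>

definition fourier_char :: "'a::euclidean_space \<Rightarrow> 'a \<Rightarrow> complex" where
  "fourier_char \<xi> x = exp (- 2 * of_real pi * \<i> * of_real (\<xi> \<bullet> x))"

lemma fourier_char_cis: "fourier_char \<xi> x = cis (- 2 * pi * (\<xi> \<bullet> x))"
  by (simp add: fourier_char_def cis_conv_exp mult_ac)

lemma norm_fourier_char [simp]: "norm (fourier_char \<xi> x) = 1"
  by (simp add: fourier_char_cis)

lemma cnj_fourier_char: "cnj (fourier_char \<xi> x) = fourier_char \<xi> (- x)"
  by (simp add: fourier_char_cis cis_cnj)

lemma fourier_char_add: "fourier_char \<xi> (x + y) = fourier_char \<xi> x * fourier_char \<xi> y"
  by (simp add: fourier_char_cis cis_mult inner_add_right algebra_simps)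

lemma fourier_char_diff: "fourier_char \<xi> (x - y) = fourier_char \<xi> x * cnj (fourier_char \<xi> y)"
  using fourier_char_add[of \<xi> x "- y"] by (simp add: cnj_fourier_char)

lemma borel_measurable_fourier_char [measurable (raw)]:
  assumes [measurable]: "f \<in> borel_measurable M" "g \<in> borel_measurable M"
  shows "(\<lambda>z. fourier_char (f z) (g z)) \<in> borel_measurable M"
  unfolding fourier_char_def by measurable

lemma fourier_transform_char: "fourier_transform \<mu> \<xi> = (LINT x|\<mu>. fourier_char \<xi> x)"
  by (simp add: fourier_transform_def fourier_char_def)

lemma gaussian_fourier_real:
  fixes c r :: real
  assumes r: "0 < r"
  shows "(LINT x|lborel. of_real (exp (- pi * r\<^sup>2 * x\<^sup>2)) * cis (- 2 * pi * x * c)) =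
      complex_of_real (exp (- pi * c\<^sup>2 / r\<^sup>2) / r)"
    and "integrable lborel (\<lambda>x. of_real (exp (- pi * r\<^sup>2 * x\<^sup>2)) * cis (- 2 * pi * x * c))"
proof -
  \<comment> \<open>The substitution by the factor \<open>k\<close> turns the standard normal
    density into the given Gaussian, and \<open>t\<close> is chosen so that the frequency
    \<open>t * k\<close> is \<open>- 2 * pi * c\<close>. The integral is then a value of the known
    characteristic function.\<close>
  define k where "k = sqrt (2 * pi) * r"
  define t where "t = - sqrt (2 * pi) * c / r"
  have k: "0 < k" using r by (simp add: k_def)
  have k2: "k\<^sup>2 = 2 * pi * r\<^sup>2" by (simp add: k_def power_mult_distrib)
  have tk: "t * k = - 2 * pi * c" using r by (simp add: t_def k_def)
  have t2: "t\<^sup>2 / 2 = pi * c\<^sup>2 / r\<^sup>2" by (simp add: t_def power_mult_distrib power_divide)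
  define h where "h x = complex_of_real (std_normal_density x) * iexp (t * x)" for x
  have int_h: "integrable lborel h"
  proof -
    have "integrable lborel (\<lambda>x. std_normal_density x)"
      by (rule integrable_normal_density) simp
    then show ?thesis unfolding h_def
      by (rule Bochner_Integration.integrable_bound) (auto simp: norm_mult)
  qed
  have "complex_of_real (exp (- (t^2) / 2)) = (LINT x|lborel. h x)"
  proof -
    have "(CLINT x|std_normal_distribution. iexp (t * x)) = (LINT x|lborel. std_normal_density x *\<^sub>R iexp (t * x))"
      by (rule integral_density) auto
    then show ?thesis
      using fun_cong[OF char_std_normal_distribution, of t] by (simp add: char_def h_def scaleR_conv_of_real)
  qed
  also have "\<dots> = \<bar>k\<bar> *\<^sub>R (LINT x|lborel. h (0 + k * x))"
    using k by (intro lborel_integral_real_affine) auto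
  also have "(\<lambda>x. h (0 + k * x)) = (\<lambda>x. complex_of_real (1 / sqrt (2 * pi)) *
      (of_real (exp (- pi * r\<^sup>2 * x\<^sup>2)) * cis (- 2 * pi * x * c)))"
  proof
    fix x
    have "t * (k * x) = - 2 * pi * x * c" using tk by (simp add: mult.assoc[symmetric])
    moreover have "(k * x)\<^sup>2 / 2 = pi * r\<^sup>2 * x\<^sup>2" using k2 by (simp add: power_mult_distrib)
    ultimately show "h (0 + k * x) = complex_of_real (1 / sqrt (2 * pi)) *
      (of_real (exp (- pi * r\<^sup>2 * x\<^sup>2)) * cis (- 2 * pi * x * c))"
      by (simp add: h_def normal_density_def cis_conv_exp)
  qed
  finally have eq: "complex_of_real (exp (- (t^2) / 2)) = \<bar>k\<bar> *\<^sub>R (complex_of_real (1 / sqrt (2 * pi)) *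
      (LINT x|lborel. of_real (exp (- pi * r\<^sup>2 * x\<^sup>2)) * cis (- 2 * pi * x * c)))"
    by simp
  have "\<bar>k\<bar> * (1 / sqrt (2 * pi)) = r" using k r by (simp add: k_def)
  then have "complex_of_real (exp (- (t^2) / 2)) = of_real r *
      (LINT x|lborel. of_real (exp (- pi * r\<^sup>2 * x\<^sup>2)) * cis (- 2 * pi * x * c))"
    unfolding eq by (simp only: scaleR_conv_of_real mult.assoc[symmetric] of_real_mult[symmetric])
  then show "(LINT x|lborel. of_real (exp (- pi * r\<^sup>2 * x\<^sup>2)) * cis (- 2 * pi * x * c)) =
      complex_of_real (exp (- pi * c\<^sup>2 / r\<^sup>2) / r)"
    using r t2 by (simp add: field_simps)
  have "integrable lborel (\<lambda>x. h (0 + k * x))"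
    using int_h k by (subst lborel_integrable_real_affine_iff) auto
  then have "integrable lborel (\<lambda>x. of_real (sqrt (2 * pi)) * h (0 + k * x))" by (rule integrable_mult_right)
  also have "(\<lambda>x. of_real (sqrt (2 * pi)) * h (0 + k * x)) =
     (\<lambda>x. of_real (exp (- pi * r\<^sup>2 * x\<^sup>2)) * cis (- 2 * pi * x * c))"
  proof
    fix x
    have "t * (k * x) = - 2 * pi * x * c" using tk by (simp add: mult.assoc[symmetric])
    moreover have "(k * x)\<^sup>2 / 2 = pi * r\<^sup>2 * x\<^sup>2" using k2 by (simp add: power_mult_distrib)
    ultimately show "of_real (sqrt (2 * pi)) * h (0 + k * x) =
      of_real (exp (- pi * r\<^sup>2 * x\<^sup>2)) * cis (- 2 * pi * x * c)"
      by (simp add: h_def normal_density_def cis_conv_exp)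
  qed
  finally show "integrable lborel (\<lambda>x. of_real (exp (- pi * r\<^sup>2 * x\<^sup>2)) * cis (- 2 * pi * x * c))" .
qed

lemma norm_power2_Basis: "(norm (x::'a::euclidean_space))\<^sup>2 = (\<Sum>b\<in>Basis. (x \<bullet> b)\<^sup>2)"
  by (subst power2_norm_eq_inner, subst euclidean_inner) (simp add: power2_eq_square)

lemma gaussian_fourier:
  fixes z :: "'a::euclidean_space" and r :: real
  assumes r: "0 < r"
  shows "(LINT \<xi>|lborel. of_real (exp (- pi * r\<^sup>2 * (norm \<xi>)\<^sup>2)) * fourier_char \<xi> z) =
      complex_of_real (exp (- pi * (norm z)\<^sup>2 / r\<^sup>2) / r ^ DIM('a))" (is "?I = _")
    and "integrable lborel (\<lambda>\<xi>. of_real (exp (- pi * r\<^sup>2 * (norm \<xi>)\<^sup>2)) * fourier_char \<xi> z)" (is ?J)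
proof -
  let ?g = "\<lambda>b x. complex_of_real (exp (- pi * r\<^sup>2 * x\<^sup>2)) * cis (- 2 * pi * x * (z \<bullet> b))"
  let ?P = "\<Pi>\<^sub>M b\<in>(Basis :: 'a set). (lborel :: real measure)"
  let ?s = "\<lambda>f. \<Sum>b\<in>(Basis :: 'a set). f b *\<^sub>R b"
  have eq: "of_real (exp (- pi * r\<^sup>2 * (norm \<xi>)\<^sup>2)) * fourier_char \<xi> z = (\<Prod>b\<in>Basis. ?g b (\<xi> \<bullet> b))" for \<xi> :: 'a
  proof -
    have "exp (- pi * r\<^sup>2 * (norm \<xi>)\<^sup>2) = (\<Prod>b\<in>Basis. exp (- pi * r\<^sup>2 * (\<xi> \<bullet> b)\<^sup>2))"
      by (simp add: norm_power2_Basis sum_distrib_left exp_sum)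
    moreover have "fourier_char \<xi> z = (\<Prod>b\<in>Basis. cis (- 2 * pi * (\<xi> \<bullet> b) * (z \<bullet> b)))"
      unfolding fourier_char_cis by (subst euclidean_inner) (simp add: cis_conv_exp sum_distrib_left exp_sum mult_ac sum_negf[symmetric] del: sum_negf)
    ultimately show ?thesis by (simp add: prod.distrib)
  qed
  interpret product_sigma_finite "\<lambda>_::'a. lborel :: real measure" ..
  have s: "?s f \<bullet> b = f b" if "b \<in> Basis" for f and b :: 'a
    using that by (simp add: inner_sum_left inner_Basis if_distrib cong: if_cong)
  have ms: "?s \<in> ?P \<rightarrow>\<^sub>M borel" by measurable
  have eq2: "(\<Prod>b\<in>Basis. ?g b (?s f \<bullet> b)) = (\<Prod>b\<in>Basis. ?g b (f b))" for f
    by (intro prod.cong refl) (simp add: s)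
  have mg: "(\<lambda>\<xi>::'a. \<Prod>b\<in>Basis. ?g b (\<xi> \<bullet> b)) \<in> borel_measurable borel"
    unfolding cis_conv_exp by measurable
  have "integrable ?P (\<lambda>f. \<Prod>b\<in>Basis. ?g b (f b))"
    by (rule product_integrable_prod) (use gaussian_fourier_real(2)[OF r] in auto)
  then have "integrable ?P (\<lambda>f. \<Prod>b\<in>Basis. ?g b (?s f \<bullet> b))" unfolding eq2 .
  then have "integrable (distr ?P borel ?s) (\<lambda>\<xi>. \<Prod>b\<in>Basis. ?g b (\<xi> \<bullet> b))"
    by (subst integrable_distr_eq[OF ms mg])
  then show ?J unfolding eq lborel_eq[where 'a='a] .
  have "?I = (LINT \<xi>|distr ?P borel ?s. (\<Prod>b\<in>Basis. ?g b (\<xi> \<bullet> b)))"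
    unfolding eq by (subst lborel_eq[where 'a='a]) simp
  also have "\<dots> = (LINT f|?P. (\<Prod>b\<in>Basis. ?g b (?s f \<bullet> b)))" by (rule integral_distr[OF ms mg])
  also have "\<dots> = (LINT f|?P. (\<Prod>b\<in>Basis. ?g b (f b)))" unfolding eq2 ..
  also have "\<dots> = (\<Prod>b\<in>Basis. (LINT x|lborel. ?g b x))"
    by (rule product_integral_prod) (use gaussian_fourier_real(2)[OF r] in auto)
  also have "\<dots> = (\<Prod>b\<in>Basis. complex_of_real (exp (- pi * (z \<bullet> b)\<^sup>2 / r\<^sup>2) / r))"
    by (intro prod.cong refl gaussian_fourier_real(1)[OF r])
  also have "\<dots> = complex_of_real ((\<Prod>b\<in>Basis. exp (- pi * (z \<bullet> b)\<^sup>2 / r\<^sup>2)) / r ^ DIM('a))"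
    by (simp add: prod_dividef)
  also have "(\<Prod>b\<in>Basis. exp (- pi * (z \<bullet> b)\<^sup>2 / r\<^sup>2)) = exp (- pi * (norm z)\<^sup>2 / r\<^sup>2)"
    by (subst exp_sum[symmetric]) (simp_all add: norm_power2_Basis sum_distrib_left sum_divide_distrib sum_negf)
  finally show "?I = complex_of_real (exp (- pi * (norm z)\<^sup>2 / r\<^sup>2) / r ^ DIM('a))" .
qed

lemma integrable_fourier_char:
  fixes M :: "'a::euclidean_space measure"
  assumes "finite_measure M" and [measurable_cong, simp]: "sets M = sets borel"
  shows "integrable M (fourier_char \<xi>)"
proof -
  interpret finite_measure M by fact
  have "fourier_char \<xi> \<in> borel_measurable M" by measurable
  then show ?thesis by (intro integrable_const_bound[of _ 1]) auto
qed

lemma borel_measurable_fourier_transform: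
  fixes M :: "'a::euclidean_space measure"
  assumes "finite_measure M" and [measurable_cong]: "sets M = sets borel"
  shows "fourier_transform M \<in> borel_measurable borel"
proof -
  interpret finite_measure M by fact
  have "(\<lambda>\<xi>::'a. LINT x|M. fourier_char \<xi> x) \<in> borel_measurable borel" by measurable
  then show ?thesis by (simp add: fourier_transform_char[abs_def])
qed

lemma fourier_transform_norm_power2:
  fixes M :: "'a::euclidean_space measure"
  assumes fin: "finite_measure M" and M [measurable_cong, simp]: "sets M = sets borel"
  shows "of_real ((norm (fourier_transform M \<xi>))\<^sup>2) =
    (LINT p|(M \<Otimes>\<^sub>M M). fourier_char \<xi> (fst p - snd p :: 'a))"
proof -
  interpret finite_measure M by fact
  interpret P: pair_sigma_finite M M ..
  interpret PF: finite_measure "M \<Otimes>\<^sub>M M" by (rule finite_measure_pair_measure) unfold_locales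
  have "(\<lambda>p. fourier_char \<xi> (fst p - snd p :: 'a)) \<in> borel_measurable (M \<Otimes>\<^sub>M M)" by measurable
  then have i: "integrable (M \<Otimes>\<^sub>M M) (\<lambda>(x, y). fourier_char \<xi> (x - y :: 'a))"
    unfolding case_prod_beta by (intro PF.integrable_const_bound[of _ 1]) auto
  have "(LINT p|(M \<Otimes>\<^sub>M M). fourier_char \<xi> (fst p - snd p :: 'a)) =
      (LINT x|M. (LINT y|M. fourier_char \<xi> (x - y)))"
    using P.integral_fst'[OF i] by (simp add: case_prod_unfold)
  also have "\<dots> = (LINT x|M. fourier_char \<xi> x * cnj (fourier_transform M \<xi>))"
    unfolding fourier_char_diff fourier_transform_char
    by (simp add: integrable_fourier_char[OF fin M])
  also have "\<dots> = fourier_transform M \<xi> * cnj (fourier_transform M \<xi>)"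
    by (simp add: fourier_transform_char integrable_fourier_char[OF fin M])
  also have "\<dots> = of_real ((norm (fourier_transform M \<xi>))\<^sup>2)"
    by (rule complex_norm_square[symmetric])
  finally show ?thesis ..
qed

text \<open>Fubini for the Gaussian times \<open>fourier_char \<xi> (x - y)\<close>, which is
  integrable because \<open>M\<close> is finite. Roughly, the left side sees frequencies up to 1/r
  and the right side pairs within distance r, so the identity transfers bounds in both
  directions.\<close>

lemma gaussian_energy:
  fixes M :: "'a::euclidean_space measure" and r :: real
  assumes fin: "finite_measure M" and M [measurable_cong, simp]: "sets M = sets borel" and r: "0 < r"
  shows "(\<integral>\<^sup>+\<xi>. ennreal ((norm (fourier_transform M \<xi>))\<^sup>2 * exp (- pi * r\<^sup>2 * (norm \<xi>)\<^sup>2)) \<partial>lborel) =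
    (\<integral>\<^sup>+p. ennreal (exp (- pi * (dist (fst p) (snd p))\<^sup>2 / r\<^sup>2) / r ^ DIM('a)) \<partial>(M \<Otimes>\<^sub>M M))"
proof -
  let ?P = "M \<Otimes>\<^sub>M M"
  interpret finite_measure M by fact
  interpret PF: finite_measure ?P by (rule finite_measure_pair_measure) unfold_locales
  interpret Q: pair_sigma_finite "lborel :: 'a measure" ?P ..
  define w where "w \<xi> = exp (- pi * r\<^sup>2 * (norm \<xi>)\<^sup>2)" for \<xi> :: 'a
  define G where "G p = exp (- pi * (dist (fst p) (snd p))\<^sup>2 / r\<^sup>2) / r ^ DIM('a)" for p :: "'a \<times> 'a"
  have [measurable]: "w \<in> borel_measurable borel" unfolding w_def by measurable
  have iw: "integrable lborel w"
    using integrable_norm[OF gaussian_fourier(2)[OF r, of 0]] by (simp add: norm_mult w_def[abs_def])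
  define \<phi> where "\<phi> = (\<lambda>(\<xi>, p). of_real (w \<xi>) * fourier_char \<xi> (fst p - snd p :: 'a))"
  have m\<phi>: "\<phi> \<in> borel_measurable (lborel \<Otimes>\<^sub>M ?P)" unfolding \<phi>_def case_prod_beta by measurable
  have n\<phi>: "norm (\<phi> (\<xi>, p)) = w \<xi>" for \<xi> p by (simp add: \<phi>_def norm_mult w_def)
  have i\<phi>: "integrable (lborel \<Otimes>\<^sub>M ?P) \<phi>"
  proof (rule Q.Fubini_integrable[OF m\<phi>])
    show "integrable lborel (\<lambda>\<xi>. LINT p|?P. norm (\<phi> (\<xi>, p)))" using iw by (simp add: n\<phi>)
    have "(\<lambda>p. \<phi> (\<xi>, p)) \<in> borel_measurable ?P" for \<xi> by (rule measurable_compose_Pair1[OF _ m\<phi>]) simp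
    then show "AE \<xi> in lborel. integrable ?P (\<lambda>p. \<phi> (\<xi>, p))"
      by (intro AE_I2 PF.integrable_const_bound[of _ "w _"]) (auto simp: n\<phi>)
  qed
  have 1: "(LINT p|?P. \<phi> (\<xi>, p)) = of_real ((norm (fourier_transform M \<xi>))\<^sup>2 * w \<xi>)" for \<xi>
    using fourier_transform_norm_power2[OF fin M, of \<xi>] by (simp add: \<phi>_def mult.commute)
  have 2: "(LINT \<xi>|lborel. \<phi> (\<xi>, p)) = of_real (G p)" for p
    using gaussian_fourier(1)[OF r, of "fst p - snd p"] by (simp add: \<phi>_def w_def G_def dist_norm)
  have "of_real (LINT \<xi>|lborel. (norm (fourier_transform M \<xi>))\<^sup>2 * w \<xi>) =
      (LINT \<xi>|lborel. (LINT p|?P. \<phi> (\<xi>, p)))" by (simp only: 1 integral_complex_of_real)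
  also have "\<dots> = (LINT p|?P. (LINT \<xi>|lborel. \<phi> (\<xi>, p)))"
    using Q.Fubini_integral[of "\<lambda>\<xi> p. \<phi> (\<xi>, p)"] i\<phi> by simp
  also have "\<dots> = of_real (LINT p|?P. G p)" by (simp only: 2 integral_complex_of_real)
  finally have eq: "(LINT \<xi>|lborel. (norm (fourier_transform M \<xi>))\<^sup>2 * w \<xi>) = (LINT p|?P. G p)"
    by (simp only: of_real_eq_iff)
  have "integrable lborel (\<lambda>\<xi>. LINT p|?P. \<phi> (\<xi>, p))"
    using Q.integrable_fst'[OF i\<phi>] .
  then have i1: "integrable lborel (\<lambda>\<xi>. (norm (fourier_transform M \<xi>))\<^sup>2 * w \<xi>)"
    unfolding 1 by (simp only: complex_of_real_integrable_eq)
  have "G \<in> borel_measurable ?P" unfolding G_def by measurable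
  then have i2: "integrable ?P G"
    by (intro PF.integrable_const_bound[of _ "1 / r ^ DIM('a)"]) (use r in \<open>auto simp: G_def divide_right_mono\<close>)
  have "(\<integral>\<^sup>+\<xi>. ennreal ((norm (fourier_transform M \<xi>))\<^sup>2 * w \<xi>) \<partial>lborel) =
      ennreal (LINT \<xi>|lborel. (norm (fourier_transform M \<xi>))\<^sup>2 * w \<xi>)"
    by (rule nn_integral_eq_integral[OF i1]) (simp add: w_def)
  also have "\<dots> = ennreal (LINT p|?P. G p)" by (simp only: eq)
  also have "\<dots> = (\<integral>\<^sup>+p. ennreal (G p) \<partial>?P)"
    by (rule nn_integral_eq_integral[OF i2, symmetric]) (use r in \<open>simp add: G_def\<close>)
  finally show ?thesis by (simp only: w_def G_def)
qed

section \<open>Comparison of power weights with Gaussians\<close>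

lemma powr_gaussian_bound:
  fixes u p :: real
  assumes "0 \<le> u" "0 \<le> p"
  shows "(1 + u) powr p * exp (- pi * u\<^sup>2) \<le> exp (p\<^sup>2)"
proof -
  have "(1 + u) powr p = exp (p * ln (1 + u))" using assms by (simp add: powr_def)
  also have "\<dots> \<le> exp (p * u)" using assms ln_add_one_self_le_self[of u] by (simp add: mult_left_mono)
  finally have "(1 + u) powr p * exp (- pi * u\<^sup>2) \<le> exp (p * u) * exp (- pi * u\<^sup>2)" by (intro mult_right_mono) auto
  also have "\<dots> = exp (p * u - pi * u\<^sup>2)" by (simp add: exp_add[symmetric])
  also have "\<dots> \<le> exp (p\<^sup>2)"
  proof -
    \<comment> \<open>Completing the square bounds \<open>p * u\<close> by
      \<open>p\<^sup>2 + u\<^sup>2 / 4\<close>, and \<open>pi\<close> exceeds 1/4.\<close>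
    have "0 \<le> (p - u / 2)\<^sup>2 + (pi - 1/4) * u\<^sup>2"
      using pi_gt3 by (intro add_nonneg_nonneg mult_nonneg_nonneg) auto
    then show ?thesis by (simp add: power2_eq_square algebra_simps)
  qed
  finally show ?thesis .
qed

definition sobolev_energy :: "'a::euclidean_space measure \<Rightarrow> real \<Rightarrow> ennreal" where
  "sobolev_energy \<mu> s = (\<integral>\<^sup>+ x. ennreal ((cmod (fourier_transform \<mu> x))\<^sup>2 *
             (1 + norm x) powr (s - real DIM('a))) \<partial>lborel)"

text \<open>Where \<open>1 + dist x y / r\<close> is about \<open>2 ^ k\<close>, decay of order
  \<open>s + 1\<close> beats the growth \<open>2 powr (k * s)\<close> of the ball masses by a factor
  \<open>(1/2) ^ k\<close>. The leading 2 in the constant is the sum of these factors.\<close>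

lemma gaussian_potential_le:
  fixes M :: "'a::euclidean_space measure" and s r C :: real
  assumes M [measurable_cong, simp]: "sets M = sets borel"
    and s: "0 \<le> s" and C: "0 \<le> C" and ball: "\<And>r. 0 < r \<Longrightarrow> emeasure M (cball x r) \<le> ennreal (C * r powr s)"
    and r: "0 < r"
  shows "(\<integral>\<^sup>+y. ennreal (exp (- pi * (dist x y)\<^sup>2 / r\<^sup>2)) \<partial>M) \<le> ennreal (2 * exp ((s + 1)\<^sup>2) * 2 powr (s + 1) * C * r powr s)"
proof -
  \<comment> \<open>The exponential comes from \<open>powr_gaussian_bound\<close> with exponent
    \<open>s + 1\<close>, the power of 2 from rounding \<open>1 + u\<close> to a dyadic
    radius.\<close>
  define A where "A = exp ((s + 1)\<^sup>2) * 2 powr (s + 1)"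
  have A: "0 \<le> A" by (simp add: A_def)
  have bound: "ennreal (exp (- pi * (dist x y)\<^sup>2 / r\<^sup>2)) \<le>
      (\<Sum>k. ennreal (A * (1/2) powr (k * (s + 1))) * indicator (cball x (2 ^ k * r)) y)" for y
  proof -
    define u where "u = dist x y / r"
    have u: "0 \<le> u" using r by (simp add: u_def)
    have e: "exp (- pi * (dist x y)\<^sup>2 / r\<^sup>2) = exp (- pi * u\<^sup>2)" by (simp add: u_def power_divide)
    obtain k where k: "(1/2) ^ Suc k < 1 / (1 + u)" "1 / (1 + u) \<le> (1/2) ^ k"
      using dyadic_scale[of "1 / (1 + u)"] u by auto
    have k1: "1 + u < 2 ^ Suc k" "2 ^ k \<le> 1 + u"
      using k u by (auto simp: field_simps power_divide)
    have "exp (- pi * u\<^sup>2) = ((1 + u) powr (s + 1) * exp (- pi * u\<^sup>2)) * (1 + u) powr (- (s + 1))"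
    proof -
      have "(1 + u) powr (s + 1) * (1 + u) powr (- (s + 1)) = 1"
        using u by (subst powr_add[symmetric]) simp
      then show ?thesis by (metis mult.assoc mult.commute mult_1)
    qed
    also have "\<dots> \<le> exp ((s + 1)\<^sup>2) * (2 ^ k) powr (- (s + 1))"
      using k1 s u by (intro mult_mono powr_gaussian_bound powr_mono2') auto
    also have "(2 ^ k :: real) powr (- (s + 1)) = 2 powr (s + 1) * (1/2) powr (Suc k * (s + 1))"
      by (simp add: powr_divide powr_minus_divide powr_powr powr_add[symmetric] algebra_simps flip: powr_realpow powr_diff)
    finally have "exp (- pi * u\<^sup>2) \<le> A * (1/2) powr (Suc k * (s + 1))" by (simp add: A_def mult_ac)
    moreover have "y \<in> cball x (2 ^ Suc k * r)"
      using k1 r by (auto simp: u_def field_simps)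
    ultimately have "ennreal (exp (- pi * (dist x y)\<^sup>2 / r\<^sup>2)) \<le>
       ennreal (A * (1/2) powr (Suc k * (s + 1))) * indicator (cball x (2 ^ Suc k * r)) y"
      unfolding e by (simp add: ennreal_leI del: mem_cball)
    also have "\<dots> \<le> (\<Sum>k. ennreal (A * (1/2) powr (k * (s + 1))) * indicator (cball x (2 ^ k * r)) y)"
      by (rule sum_le_suminf[of _ "{Suc k}", simplified sum.insert sum.empty, simplified]) auto
    finally show ?thesis .
  qed
  have "(\<integral>\<^sup>+y. ennreal (exp (- pi * (dist x y)\<^sup>2 / r\<^sup>2)) \<partial>M) \<le>
    (\<integral>\<^sup>+y. (\<Sum>k. ennreal (A * (1/2) powr (k * (s + 1))) * indicator (cball x (2 ^ k * r)) y) \<partial>M)"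
    by (rule nn_integral_mono) (rule bound)
  also have "\<dots> = (\<Sum>k. \<integral>\<^sup>+y. ennreal (A * (1/2) powr (k * (s + 1))) * indicator (cball x (2 ^ k * r)) y \<partial>M)"
    by (rule nn_integral_suminf) (intro borel_measurable_times_ennreal borel_measurable_const borel_measurable_indicator, simp)
  also have "\<dots> = (\<Sum>k. ennreal (A * (1/2) powr (k * (s + 1))) * emeasure M (cball x (2 ^ k * r)))"
    by (intro suminf_cong) (simp add: nn_integral_cmult_indicator)
  also have "\<dots> \<le> (\<Sum>k. ennreal (A * C * r powr s * (1/2) ^ k))"
  proof (intro suminf_le summableI)
    fix k :: nat
    have "ennreal (A * (1/2) powr (k * (s + 1))) * emeasure M (cball x (2 ^ k * r)) \<le>
       ennreal (A * (1/2) powr (k * (s + 1))) * ennreal (C * (2 ^ k * r) powr s)"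
      using r by (intro mult_left_mono ball) auto
    also have "\<dots> = ennreal ((A * (1/2) powr (k * (s + 1))) * (C * (2 ^ k * r) powr s))"
      using A C by (simp add: ennreal_mult)
    also have "(A * (1/2) powr (k * (s + 1))) * (C * (2 ^ k * r) powr s) = A * C * r powr s * (1/2) ^ k"
    proof -
      have "(2 ^ k * r) powr s = 2 powr (k * s) * r powr s"
        using r by (simp add: powr_mult powr_powr flip: powr_realpow)
      moreover have "(1/2 :: real) powr (k * (s + 1)) = (1/2) ^ k * (1/2) powr (k * s)"
        by (simp add: powr_add[symmetric] algebra_simps flip: powr_realpow)
      moreover have "(1/2 :: real) powr (k * s) * 2 powr (k * s) = 1"
        by (simp add: powr_mult[symmetric])
      ultimately show ?thesis by (simp add: mult_ac)
    qed
    finally show "ennreal (A * (1/2) powr (k * (s + 1))) * emeasure M (cball x (2 ^ k * r)) \<le>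
      ennreal (A * C * r powr s * (1/2) ^ k)" .
  qed
  also have "\<dots> = ennreal (A * C * r powr s * 2)"
  proof (rule suminf_ennreal_eq)
    show "(\<lambda>k. A * C * r powr s * (1/2) ^ k) sums (A * C * r powr s * 2)"
      using sums_mult[OF geometric_sums[of "1/2::real"], of "A * C * r powr s"] by simp
  qed (use A C in auto)
  also have "A * C * r powr s * 2 = 2 * exp ((s + 1)\<^sup>2) * 2 powr (s + 1) * C * r powr s"
    by (simp add: A_def)
  finally show ?thesis .
qed

text \<open>Where \<open>1 + norm \<xi>\<close> is about \<open>2 ^ k\<close>, the weight is bounded
  by a constant times \<open>2 powr (k * (t - d))\<close> times the Gaussian of parameter
  \<open>(1/2) ^ k\<close>. The ball condition bounds the k-th Gaussian energy by a multiple of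
  \<open>2 powr (k * (d - s))\<close>, so the resulting series has ratio
  \<open>2 powr (t - s)\<close>, below 1.\<close>

lemma sobolev_energy_finite:
  fixes M :: "'a::euclidean_space measure" and s t C :: real
  assumes prob: "prob_space M" and M [measurable_cong, simp]: "sets M = sets borel"
    and s: "0 \<le> s" and C: "0 \<le> C" and ball: "\<And>x r. 0 < r \<Longrightarrow> emeasure M (cball x r) \<le> ennreal (C * r powr s)"
    and t: "t < s"
  shows "sobolev_energy M t < \<infinity>"
proof -
  interpret prob_space M by fact
  let ?d = "real DIM('a)"
  define K where "K = 2 * exp ((s + 1)\<^sup>2) * 2 powr (s + 1) * C"
  have K: "0 \<le> K" using C by (simp add: K_def)
  define F where "F k \<xi> = (norm (fourier_transform M \<xi>))\<^sup>2 * exp (- pi * ((1/2) ^ k)\<^sup>2 * (norm \<xi>)\<^sup>2)"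
    for k and \<xi> :: 'a
  have F0: "0 \<le> F k \<xi>" for k \<xi> by (simp add: F_def)
  have ft [measurable]: "fourier_transform M \<in> borel_measurable borel"
    by (rule borel_measurable_fourier_transform[OF finite_measure_axioms M])
  have mF: "F k \<in> borel_measurable borel" for k unfolding F_def by measurable
  have energy: "(\<integral>\<^sup>+\<xi>. ennreal (F k \<xi>) \<partial>lborel) \<le> ennreal (K * 2 powr (k * (?d - s)))" for k
  proof -
    define r where "r = (1/2::real) ^ k"
    have r: "0 < r" by (simp add: r_def)
    let ?E = "\<lambda>x y. exp (- pi * (dist x y)\<^sup>2 / r\<^sup>2)"
    have mE: "(\<lambda>p. ennreal (?E (fst p) (snd p) / r ^ DIM('a))) \<in> borel_measurable (M \<Otimes>\<^sub>M M)"
      by measurable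
    have "(\<integral>\<^sup>+\<xi>. ennreal (F k \<xi>) \<partial>lborel) = (\<integral>\<^sup>+p. ennreal (?E (fst p) (snd p) / r ^ DIM('a)) \<partial>(M \<Otimes>\<^sub>M M))"
      unfolding F_def r_def[symmetric] by (rule gaussian_energy[OF finite_measure_axioms M r])
    also have "\<dots> = (\<integral>\<^sup>+x. \<integral>\<^sup>+y. ennreal (?E x y / r ^ DIM('a)) \<partial>M \<partial>M)"
      using nn_integral_fst[OF mE] by simp
    also have "\<dots> = (\<integral>\<^sup>+x. ennreal (1 / r ^ DIM('a)) * (\<integral>\<^sup>+y. ennreal (?E x y) \<partial>M) \<partial>M)"
    proof (rule nn_integral_cong)
      fix x
      have "(\<lambda>y. ennreal (?E x y)) \<in> borel_measurable M" by measurable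
      then show "(\<integral>\<^sup>+y. ennreal (?E x y / r ^ DIM('a)) \<partial>M) = ennreal (1 / r ^ DIM('a)) * (\<integral>\<^sup>+y. ennreal (?E x y) \<partial>M)"
        using r by (subst nn_integral_cmult[symmetric]) (auto simp flip: ennreal_mult)
    qed
    also have "\<dots> \<le> (\<integral>\<^sup>+x. ennreal (1 / r ^ DIM('a)) * ennreal (K * r powr s) \<partial>M)"
      unfolding K_def
      by (intro nn_integral_mono mult_left_mono gaussian_potential_le[OF M s C ball r]) auto
    also have "\<dots> = ennreal (1 / r ^ DIM('a)) * ennreal (K * r powr s)"
      by (simp add: emeasure_space_1)
    also have "\<dots> = ennreal (1 / r ^ DIM('a) * (K * r powr s))"
      by (rule ennreal_mult[symmetric]) (use r K in auto)
    also have "1 / r ^ DIM('a) * (K * r powr s) = K * 2 powr (k * (?d - s))"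
    proof -
      have r2: "r = 2 powr (- real k)"
        unfolding r_def powr_minus_divide by (simp add: powr_realpow power_one_over)
      have "r powr s = 2 powr (- (k * s))" unfolding r2 powr_powr by simp
      moreover have "1 / r ^ DIM('a) = r powr (- ?d)"
        using r by (simp add: powr_minus_divide powr_realpow)
      moreover have "r powr (- ?d) = 2 powr (k * ?d)" unfolding r2 powr_powr by simp
      moreover have "2 powr (k * ?d) * 2 powr (- (k * s)) = 2 powr (k * (?d - s))"
        unfolding powr_add[symmetric] by (simp add: algebra_simps)
      ultimately show ?thesis by (metis mult.assoc mult.commute)
    qed
    finally show ?thesis .
  qed
  define q where "q = t - ?d"
  \<comment> \<open>For the k chosen below, \<open>(1/2) ^ k * norm \<xi>\<close> is at most 2, so
    the Gaussian is at least \<open>exp (- 4 * pi)\<close>. The absolute value of \<open>q\<close>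
    covers both signs when \<open>1 + norm \<xi>\<close> is replaced by
    \<open>2 ^ k\<close>.\<close>
  define A where "A = exp (4 * pi) * 2 powr \<bar>q\<bar>"
  have A: "0 \<le> A" by (simp add: A_def)
  have pointwise: "ennreal ((norm (fourier_transform M \<xi>))\<^sup>2 * (1 + norm \<xi>) powr q) \<le>
     (\<Sum>k. ennreal (A * 2 powr (k * q)) * ennreal (F k \<xi>))" for \<xi>
  proof -
    obtain k where k: "(1/2) ^ Suc k < 1 / (1 + norm \<xi>)" "1 / (1 + norm \<xi>) \<le> (1/2) ^ k"
      using dyadic_scale[of "1 / (1 + norm \<xi>)"] by (auto simp: field_simps add_pos_nonneg)
    have k1: "1 + norm \<xi> < 2 * 2 ^ k" "2 ^ k \<le> 1 + norm \<xi>"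
      using k by (auto simp: field_simps power_divide add_pos_nonneg)
    define c where "c = (1 + norm \<xi>) / 2 ^ k"
    have c: "1 \<le> c" "c \<le> 2" using k1 by (auto simp: c_def field_simps)
    have "c powr q \<le> c powr \<bar>q\<bar>" using c by (intro powr_mono) auto
    also have "\<dots> \<le> 2 powr \<bar>q\<bar>" using c by (intro powr_mono2) auto
    finally have cq: "c powr q \<le> 2 powr \<bar>q\<bar>" .
    have "(1 + norm \<xi>) powr q = (2 ^ k * c) powr q" by (simp add: c_def)
    also have "\<dots> = 2 powr (k * q) * c powr q"
      using c by (simp add: powr_mult powr_powr flip: powr_realpow)
    also have "\<dots> \<le> 2 powr (k * q) * 2 powr \<bar>q\<bar>" using cq by (intro mult_left_mono) auto
    finally have 1: "(1 + norm \<xi>) powr q \<le> 2 powr (k * q) * 2 powr \<bar>q\<bar>" .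
    have "(1/2) ^ k * norm \<xi> \<le> 2" using k1 by (simp add: power_divide field_simps)
    then have "((1/2) ^ k * norm \<xi>)\<^sup>2 \<le> 2\<^sup>2" by (intro power_mono) auto
    then have "1 \<le> exp (4 * pi) * exp (- pi * ((1/2) ^ k)\<^sup>2 * (norm \<xi>)\<^sup>2)"
      by (simp add: exp_add[symmetric] power_mult_distrib mult.commute[of pi] mult.assoc)
    then have "(1 + norm \<xi>) powr q * 1 \<le> (2 powr (k * q) * 2 powr \<bar>q\<bar>) * (exp (4 * pi) * exp (- pi * ((1/2) ^ k)\<^sup>2 * (norm \<xi>)\<^sup>2))"
      by (intro mult_mono 1) auto
    then have "(norm (fourier_transform M \<xi>))\<^sup>2 * (1 + norm \<xi>) powr q \<le>
      (norm (fourier_transform M \<xi>))\<^sup>2 * ((2 powr (k * q) * 2 powr \<bar>q\<bar>) * (exp (4 * pi) * exp (- pi * ((1/2) ^ k)\<^sup>2 * (norm \<xi>)\<^sup>2)))"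
      by (intro mult_left_mono) auto
    also have "\<dots> = A * 2 powr (k * q) * F k \<xi>" by (simp add: A_def F_def mult_ac)
    finally have "ennreal ((norm (fourier_transform M \<xi>))\<^sup>2 * (1 + norm \<xi>) powr q) \<le>
      ennreal (A * 2 powr (k * q)) * ennreal (F k \<xi>)"
      using A F0[of k \<xi>] by (simp add: ennreal_leI flip: ennreal_mult)
    also have "\<dots> \<le> (\<Sum>k. ennreal (A * 2 powr (k * q)) * ennreal (F k \<xi>))"
      using sum_le_suminf[of "\<lambda>k. ennreal (A * 2 powr (k * q)) * ennreal (F k \<xi>)" "{k}"] by simp
    finally show ?thesis .
  qed
  have "sobolev_energy M t \<le> (\<integral>\<^sup>+\<xi>. (\<Sum>k. ennreal (A * 2 powr (k * q)) * ennreal (F k \<xi>)) \<partial>lborel)"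
    unfolding sobolev_energy_def q_def[symmetric] by (rule nn_integral_mono) (rule pointwise)
  also have "\<dots> = (\<Sum>k. \<integral>\<^sup>+\<xi>. ennreal (A * 2 powr (k * q)) * ennreal (F k \<xi>) \<partial>lborel)"
    by (rule nn_integral_suminf) (use mF in measurable)
  also have "\<dots> = (\<Sum>k. ennreal (A * 2 powr (k * q)) * (\<integral>\<^sup>+\<xi>. ennreal (F k \<xi>) \<partial>lborel))"
    by (intro suminf_cong nn_integral_cmult) (use mF in measurable)
  also have "\<dots> \<le> (\<Sum>k. ennreal (A * K * (2 powr (t - s)) ^ k))"
  proof (intro suminf_le summableI)
    fix k :: nat
    have "ennreal (A * 2 powr (k * q)) * (\<integral>\<^sup>+\<xi>. ennreal (F k \<xi>) \<partial>lborel) \<le>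
       ennreal (A * 2 powr (k * q)) * ennreal (K * 2 powr (k * (?d - s)))"
      by (intro mult_left_mono energy) auto
    also have "\<dots> = ennreal (A * 2 powr (k * q) * (K * 2 powr (k * (?d - s))))"
      using A K by (simp add: ennreal_mult)
    also have "A * 2 powr (k * q) * (K * 2 powr (k * (?d - s))) = A * K * (2 powr (t - s)) ^ k"
    proof -
      have "2 powr (k * q) * 2 powr (k * (?d - s)) = 2 powr ((t - s) * k)"
        by (simp add: powr_add[symmetric] q_def algebra_simps)
      also have "\<dots> = (2 powr (t - s)) ^ k" by (simp add: powr_powr[symmetric] powr_realpow)
      finally show ?thesis by (simp add: mult_ac)
    qed
    finally show "ennreal (A * 2 powr (k * q)) * (\<integral>\<^sup>+\<xi>. ennreal (F k \<xi>) \<partial>lborel) \<le> ennreal (A * K * (2 powr (t - s)) ^ k)" .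
  qed
  also have "\<dots> = ennreal (\<Sum>k. A * K * (2 powr (t - s)) ^ k)"
  proof (rule suminf_ennreal2)
    have "norm (2 powr (t - s)) < 1" using t powr_less_mono[of "t - s" 0 2] by simp
    then show "summable (\<lambda>k. A * K * (2 powr (t - s)) ^ k)"
      by (intro summable_mult summable_geometric)
  qed (use A K in auto)
  also have "\<dots> < \<infinity>" by simp
  finally show ?thesis .
qed

text \<open>For pairs within distance r the Gaussian of width r is at least
  \<open>exp (- pi)\<close>. On the frequency side the Gaussian is dominated by the energy weight at
  the cost of \<open>r powr - p\<close> with \<open>p = d - v\<close>, and the normalisation
  \<open>r ^ d\<close> leaves \<open>r powr v\<close>. The assumption on v makes p
  nonnegative.\<close>

lemma close_pairs_le:
  fixes M :: "'a::euclidean_space measure" and v :: real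
  assumes fin: "finite_measure M" and M [measurable_cong, simp]: "sets M = sets borel"
    and v: "v \<le> DIM('a)" and S: "sobolev_energy M v < \<infinity>"
  obtains C where "0 \<le> C" "\<And>r. 0 < r \<Longrightarrow> r \<le> 1 \<Longrightarrow>
    emeasure (M \<Otimes>\<^sub>M M) {p. dist (fst p) (snd p) \<le> r} \<le> ennreal (C * r powr v)"
proof
  interpret finite_measure M by fact
  define p where "p = DIM('a) - v"
  have p: "0 \<le> p" using v by (simp add: p_def)
  let ?S = "enn2real (sobolev_energy M v)"
  define C where "C = exp pi * exp (p\<^sup>2) * ?S"
  show "0 \<le> C" by (simp add: C_def)
  fix r :: real assume r: "0 < r" "r \<le> 1"
  let ?G = "\<lambda>p. exp (- pi * (dist (fst p) (snd p))\<^sup>2 / r\<^sup>2) / r ^ DIM('a)"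
  let ?F = "\<lambda>\<xi>. (norm (fourier_transform M \<xi>))\<^sup>2"
  have ft [measurable]: "fourier_transform M \<in> borel_measurable borel"
    by (rule borel_measurable_fourier_transform[OF finite_measure_axioms M])
  have sp: "space (M \<Otimes>\<^sub>M M) = UNIV"
    using sets_eq_imp_space_eq[OF M] by (simp add: space_pair_measure)
  have "Measurable.pred (M \<Otimes>\<^sub>M M) (\<lambda>p. dist (fst p) (snd p) \<le> r)" by measurable
  then have D: "{p. dist (fst p) (snd p) \<le> r} \<in> sets (M \<Otimes>\<^sub>M M)" by (simp add: pred_def sp)
  have mG: "(\<lambda>p. ennreal (?G p)) \<in> borel_measurable (M \<Otimes>\<^sub>M M)" by measurable
  have "(\<integral>\<^sup>+p. ennreal (?G p) \<partial>(M \<Otimes>\<^sub>M M)) =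
      (\<integral>\<^sup>+\<xi>. ennreal (?F \<xi> * exp (- pi * r\<^sup>2 * (norm \<xi>)\<^sup>2)) \<partial>lborel)"
    by (rule gaussian_energy[OF fin M r(1), symmetric])
  also have "\<dots> \<le> (\<integral>\<^sup>+\<xi>. ennreal (exp (p\<^sup>2) * r powr - p) * ennreal (?F \<xi> * (1 + norm \<xi>) powr (v - real DIM('a))) \<partial>lborel)"
  proof (rule nn_integral_mono)
    fix \<xi> :: 'a
    have "(1 + norm \<xi>) powr p * r powr p = ((1 + norm \<xi>) * r) powr p" using r by (simp add: powr_mult)
    \<comment> \<open>Here \<open>r \<le> 1\<close> enters.\<close>
    also have "\<dots> \<le> (1 + r * norm \<xi>) powr p"
      using r p by (intro powr_mono2) (auto simp: algebra_simps)
    finally have "(1 + norm \<xi>) powr p * r powr p * exp (- pi * r\<^sup>2 * (norm \<xi>)\<^sup>2) \<le>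
      (1 + r * norm \<xi>) powr p * exp (- pi * (r * norm \<xi>)\<^sup>2)"
      by (simp add: power_mult_distrib mult.assoc)
    also have "\<dots> \<le> exp (p\<^sup>2)" using r p by (intro powr_gaussian_bound) auto
    finally have ineq: "(1 + norm \<xi>) powr p * r powr p * exp (- pi * r\<^sup>2 * (norm \<xi>)\<^sup>2) * (r powr - p * (1 + norm \<xi>) powr - p)
       \<le> exp (p\<^sup>2) * (r powr - p * (1 + norm \<xi>) powr - p)" by (intro mult_right_mono) auto
    have "1 + norm \<xi> \<noteq> 0" using norm_ge_zero[of \<xi>] by linarith
    then have "(1 + norm \<xi>) powr p * (1 + norm \<xi>) powr - p = 1" "r powr p * r powr - p = 1"
      using r by (simp_all add: powr_add[symmetric])
    then have eq: "(1 + norm \<xi>) powr p * r powr p * exp (- pi * r\<^sup>2 * (norm \<xi>)\<^sup>2) * (r powr - p * (1 + norm \<xi>) powr - p)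
      = exp (- pi * r\<^sup>2 * (norm \<xi>)\<^sup>2)" by algebra
    have "?F \<xi> * exp (- pi * r\<^sup>2 * (norm \<xi>)\<^sup>2) \<le> ?F \<xi> * (exp (p\<^sup>2) * (r powr - p * (1 + norm \<xi>) powr - p))"
      using ineq unfolding eq by (intro mult_left_mono) auto
    also have "\<dots> = exp (p\<^sup>2) * r powr - p * (?F \<xi> * (1 + norm \<xi>) powr (v - real DIM('a)))"
      by (simp add: p_def mult_ac)
    finally show "ennreal (?F \<xi> * exp (- pi * r\<^sup>2 * (norm \<xi>)\<^sup>2)) \<le>
      ennreal (exp (p\<^sup>2) * r powr - p) * ennreal (?F \<xi> * (1 + norm \<xi>) powr (v - real DIM('a)))"
      by (simp add: ennreal_leI flip: ennreal_mult)
  qed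
  also have "\<dots> = ennreal (exp (p\<^sup>2) * r powr - p) * sobolev_energy M v"
    unfolding sobolev_energy_def by (rule nn_integral_cmult) measurable
  also have "sobolev_energy M v = ennreal ?S" using S by simp
  finally have J: "(\<integral>\<^sup>+p. ennreal (?G p) \<partial>(M \<Otimes>\<^sub>M M)) \<le> ennreal (exp (p\<^sup>2) * r powr - p) * ennreal ?S" .
  have "emeasure (M \<Otimes>\<^sub>M M) {p. dist (fst p) (snd p) \<le> r} =
      (\<integral>\<^sup>+p. indicator {p. dist (fst p) (snd p) \<le> r} p \<partial>(M \<Otimes>\<^sub>M M))" using D by simp
  also have "\<dots> \<le> (\<integral>\<^sup>+p. ennreal (exp pi * r ^ DIM('a)) * ennreal (?G p) \<partial>(M \<Otimes>\<^sub>M M))"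
  proof (rule nn_integral_mono)
    fix p :: "'a \<times> 'a"
    show "indicator {p. dist (fst p) (snd p) \<le> r} p \<le> ennreal (exp pi * r ^ DIM('a)) * ennreal (?G p)"
    proof (cases "dist (fst p) (snd p) \<le> r")
      case True
      then have "(dist (fst p) (snd p))\<^sup>2 / r\<^sup>2 \<le> 1" using r by (auto simp: divide_le_eq_1 intro: power_mono)
      then have "1 \<le> exp (pi + - pi * (dist (fst p) (snd p))\<^sup>2 / r\<^sup>2)"
        by (simp add: mult_left_le flip: times_divide_eq_right)
      also have "\<dots> = exp pi * r ^ DIM('a) * ?G p" using r by (simp add: exp_diff exp_minus divide_inverse)
      finally have "ennreal 1 \<le> ennreal (exp pi * r ^ DIM('a) * ?G p)" by (rule ennreal_leI)
      also have "ennreal (exp pi * r ^ DIM('a) * ?G p) = ennreal (exp pi * r ^ DIM('a)) * ennreal (?G p)"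
        by (rule ennreal_mult) (use r in auto)
      finally show ?thesis using True by (simp only: ennreal_1 indicator_eq_1_iff[THEN iffD2] mem_Collect_eq)
    qed simp
  qed
  also have "\<dots> = ennreal (exp pi * r ^ DIM('a)) * (\<integral>\<^sup>+p. ennreal (?G p) \<partial>(M \<Otimes>\<^sub>M M))"
    by (rule nn_integral_cmult[OF mG])
  also have "\<dots> \<le> ennreal (exp pi * r ^ DIM('a)) * (ennreal (exp (p\<^sup>2) * r powr - p) * ennreal ?S)"
    by (intro mult_left_mono J) auto
  also have "ennreal (exp pi * r ^ DIM('a)) * (ennreal (exp (p\<^sup>2) * r powr - p) * ennreal ?S) =
     ennreal (exp pi * r ^ DIM('a) * (exp (p\<^sup>2) * r powr - p * ?S))"
    using r by (simp add: ennreal_mult)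
  also have "exp pi * r ^ DIM('a) * (exp (p\<^sup>2) * r powr - p * ?S) = C * r powr v"
  proof -
    have "r ^ DIM('a) * r powr - p = r powr v"
      using r by (simp add: p_def powr_add[symmetric] flip: powr_realpow)
    then show ?thesis by (simp add: C_def mult_ac flip: \<open>r ^ DIM('a) * r powr - p = r powr v\<close>)
  qed
  finally show "emeasure (M \<Otimes>\<^sub>M M) {p. dist (fst p) (snd p) \<le> r} \<le> ennreal (C * r powr v)" .
qed

subsection \<open>Measures on the sum set\<close>

lemma fourier_transform_sum:
  fixes M N :: "'a::euclidean_space measure"
  assumes M: "finite_measure M" and sM [measurable_cong, simp]: "sets M = sets borel"
    and N: "finite_measure N" and sN [measurable_cong, simp]: "sets N = sets borel"
  shows "fourier_transform (distr (M \<Otimes>\<^sub>M N) borel (\<lambda>p. fst p + snd p)) \<xi> =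
    fourier_transform M \<xi> * fourier_transform N \<xi>"
proof -
  interpret M: finite_measure M by fact
  interpret N: finite_measure N by fact
  interpret P: pair_sigma_finite M N ..
  interpret PF: finite_measure "M \<Otimes>\<^sub>M N" by (rule finite_measure_pair_measure) fact+
  have "(\<lambda>p. fourier_char \<xi> (fst p + snd p :: 'a)) \<in> borel_measurable (M \<Otimes>\<^sub>M N)" by measurable
  then have i: "integrable (M \<Otimes>\<^sub>M N) (\<lambda>(x, y). fourier_char \<xi> (x + y :: 'a))"
    unfolding case_prod_beta by (intro PF.integrable_const_bound[of _ 1]) auto
  have "fourier_transform (distr (M \<Otimes>\<^sub>M N) borel (\<lambda>p. fst p + snd p)) \<xi> =
      (LINT p|(M \<Otimes>\<^sub>M N). fourier_char \<xi> (fst p + snd p))"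
    unfolding fourier_transform_char by (subst integral_distr) measurable
  also have "\<dots> = (LINT x|M. (LINT y|N. fourier_char \<xi> (x + y)))"
    using P.integral_fst'[OF i] by (simp add: case_prod_unfold)
  also have "\<dots> = fourier_transform M \<xi> * fourier_transform N \<xi>"
    by (simp add: fourier_char_add fourier_transform_char
        integrable_fourier_char[OF M sM] integrable_fourier_char[OF N sN])
  finally show ?thesis .
qed

text \<open>The complement of the support is a union of possibly uncountably many null open sets; by
  Lindelof countably many suffice, so it is null. Local finiteness on the compact support then makes
  the total mass finite, and the measure can be normalised.\<close>

lemma radon_measures_on_prob:
  fixes A :: "'a::euclidean_space set"
  assumes \<mu>: "\<mu> \<in> radon_measures_on A"
  obtains M S c where "prob_space M" "sets M = sets borel" "compact S" "S \<subseteq> A" "emeasure M (- S) = 0"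
    "0 \<le> c" "\<And>\<xi>. norm (fourier_transform M \<xi>) = c * norm (fourier_transform \<mu> \<xi>)"
proof -
  define S where "S = measure_support \<mu>"
  have [measurable_cong, simp]: "sets \<mu> = sets borel" and S: "compact S" "S \<subseteq> A"
    and fin: "emeasure \<mu> S < \<infinity>" and pos: "emeasure \<mu> UNIV \<noteq> 0"
    using \<mu> by (auto simp: radon_measures_on_def radon_measure_def S_def)
  have [simp]: "space \<mu> = UNIV" using sets_eq_imp_space_eq[of \<mu> borel] by simp
  have S_sets [simp]: "S \<in> sets borel" using S(1) by (rule borel_compact)
  have cS_sets [simp]: "- S \<in> sets borel" using S_sets by (rule borel_comp)
  let ?F = "{V. open V \<and> emeasure \<mu> V = 0}"
  obtain F' where F': "F' \<subseteq> ?F" "countable F'" "\<Union>F' = \<Union>?F"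
    by (rule Lindelof[of ?F]) auto
  have "\<Union>F' \<in> null_sets \<mu>"
    using null_sets_UN'[of F' "\<lambda>V. V" \<mu>] F' by (auto simp: null_sets_def subset_eq)
  moreover have "- S = \<Union>F'" using F'(3) by (simp add: S_def measure_support_def)
  ultimately have null: "emeasure \<mu> (- S) = 0" by auto
  have "emeasure \<mu> UNIV \<le> emeasure \<mu> S + emeasure \<mu> (- S)"
    using emeasure_subadditive[of S \<mu> "- S"] by (simp add: Compl_partition)
  then have finU: "emeasure \<mu> UNIV < \<infinity>" using fin null by (auto simp: le_less_trans)
  define m where "m = enn2real (emeasure \<mu> UNIV)"
  have m: "emeasure \<mu> UNIV = ennreal m" "0 < m"
    using finU pos by (auto simp: m_def enn2real_positive_iff zero_less_iff_neq_zero)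
  define M where "M = density \<mu> (\<lambda>_. ennreal (1 / m))"
  have eM: "emeasure M E = ennreal (1 / m) * emeasure \<mu> E" if "E \<in> sets borel" for E
    using that unfolding M_def by (subst emeasure_density) (auto simp: nn_integral_cmult_indicator)
  show thesis
  proof
    show "prob_space M"
    proof
      have "emeasure M UNIV = ennreal (1 / m) * ennreal m" by (simp add: eM m)
      also have "\<dots> = ennreal (1 / m * m)" using m(2) by (intro ennreal_mult[symmetric]) auto
      finally show "emeasure M (space M) = 1" using m(2) by (simp add: M_def)
    qed
    show "sets M = sets borel" by (simp add: M_def)
    show "compact S" "S \<subseteq> A" by fact+
    show "emeasure M (- S) = 0" using null S(1) by (simp add: eM)
    show "0 \<le> 1 / m" using m by simp
    show "norm (fourier_transform M \<xi>) = 1 / m * norm (fourier_transform \<mu> \<xi>)" for \<xi>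
    proof -
      have "fourier_transform M \<xi> = (LINT x|\<mu>. (1 / m) *\<^sub>R fourier_char \<xi> x)"
        unfolding M_def fourier_transform_char using m(2) by (intro integral_density) auto
      also have "\<dots> = (1 / m) *\<^sub>R fourier_transform \<mu> \<xi>"
        unfolding fourier_transform_char by (rule integral_scaleR_right)
      finally show ?thesis using m(2) by simp
    qed
  qed
qed

section \<open>From close pairs to the size of the support\<close>

text \<open>The ball mass \<open>\<phi>\<close> has integral \<open>\<omega> * r ^ d\<close>, the
  integral of its square is at most \<open>C * (2 * r) ^ d * (\<omega> * r ^ d)\<close>, and it
  vanishes off the r-neighbourhood of \<open>S\<close>. In the Cauchy-Schwarz inequality the powers
  of r cancel, so such neighbourhoods have volume bounded below uniformly in r, which a compact null
  set does not allow.\<close>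

lemma compact_measure_lebesgue_pos:
  fixes M :: "'a::euclidean_space measure"
  assumes "prob_space M" and M [measurable_cong, simp]: "sets M = sets borel"
    and S: "compact S" "emeasure M (- S) = 0"
    and C: "0 \<le> C" "\<And>r. 0 < r \<Longrightarrow> r \<le> 1 \<Longrightarrow>
    emeasure (M \<Otimes>\<^sub>M M) {p. dist (fst p) (snd p) \<le> r} \<le> ennreal (C * r ^ DIM('a))"
  shows "0 < emeasure lborel S"
proof (rule ccontr)
  interpret prob_space M by fact
  let ?P = "M \<Otimes>\<^sub>M M"
  interpret PF: finite_measure ?P by (rule finite_measure_pair_measure) unfold_locales
  interpret Q: pair_sigma_finite "lborel :: 'a measure" ?P ..
  interpret R: pair_sigma_finite "lborel :: 'a measure" M ..
  let ?d = "DIM('a)"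
  have spM [simp]: "space M = UNIV" using sets_eq_imp_space_eq[OF M] by simp
  have spP [simp]: "space ?P = UNIV" by (simp add: space_pair_measure)
  assume "\<not> 0 < emeasure lborel S"
  then have S0: "emeasure lborel S = 0" by simp
  have Sb: "S \<in> sets borel" using S(1) by (rule borel_compact)
  define \<omega> where "\<omega> = unit_ball_vol (real ?d)"
  have \<omega>: "0 < \<omega>" by (simp add: \<omega>_def)
  have vol: "emeasure lborel (cball (x::'a) r) = ennreal (\<omega> * r ^ ?d)" if "0 \<le> r" for x r
    using that emeasure_cball[of r x] by (simp add: \<omega>_def)
  \<comment> \<open>Chosen so that \<open>C * 2 ^ d * e\<close> is at most half of
    \<open>\<omega>\<close>; the added 1 keeps the denominator positive when
    \<open>C = 0\<close>.\<close>
  define e where "e = \<omega> / (2 * (C * 2 ^ ?d + 1))"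
  have e: "0 < e" using \<omega> C(1) by (simp add: e_def add_nonneg_pos)
  obtain U where U: "open U" "S \<subseteq> U" "emeasure lborel (U - S) \<le> ennreal e"
    using outer_regular_lborel_le[OF Sb e] by blast
  have "emeasure lborel U \<le> emeasure lborel S + emeasure lborel (U - S)"
    using U Sb emeasure_subadditive[of S lborel "U - S"] by (simp add: Un_absorb1)
  then have Ue: "emeasure lborel U \<le> ennreal e" using U(3) S0 by simp
  obtain r0 where r0: "0 < r0" "(\<Union>x\<in>S. cball x r0) \<subseteq> U"
    using compact_subset_open_imp_cball_epsilon_subset[OF S(1) U(1,2)] by blast
  \<comment> \<open>Two points of a ball of radius r are within \<open>2 * r\<close>, so the
    hypothesis on pairs is applied at \<open>2 * r\<close>, which must not exceed 1.\<close>
  define r where "r = min r0 (1/2)"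
  have r: "0 < r" "2 * r \<le> 1" "r \<le> r0" using r0 by (auto simp: r_def)
  define \<phi> where "\<phi> x = emeasure M (cball x r)" for x
  have pm: "Measurable.pred (lborel \<Otimes>\<^sub>M M) (\<lambda>z. dist (fst z) (snd z) \<le> r)" by measurable
  have sp1: "space (lborel \<Otimes>\<^sub>M M) = (UNIV :: ('a \<times> 'a) set)" by (simp add: space_pair_measure)
  have mset: "{z. dist (fst z) (snd z) \<le> r} \<in> sets (lborel \<Otimes>\<^sub>M M)"
    using pm by (simp add: pred_def sp1)
  have \<phi>_m [measurable]: "\<phi> \<in> borel_measurable borel"
  proof -
    have eq: "Pair x -` {z. dist (fst z) (snd z) \<le> r} = cball x r" for x :: 'a by auto
    have "(\<lambda>x. emeasure M (Pair x -` {z. dist (fst z) (snd z) \<le> r})) \<in> borel_measurable lborel"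
      by (rule measurable_emeasure_Pair[OF mset])
    then show ?thesis unfolding eq \<phi>_def[abs_def] by simp
  qed
  have i1: "(\<integral>\<^sup>+x. \<phi> x \<partial>lborel) = ennreal (\<omega> * r ^ ?d)"
  proof -
    have "(\<integral>\<^sup>+x. \<phi> x \<partial>lborel) = (\<integral>\<^sup>+x. \<integral>\<^sup>+y. indicator {z. dist (fst z) (snd z) \<le> r} (x, y) \<partial>M \<partial>lborel)"
    proof (rule nn_integral_cong)
      fix x :: 'a
      have "(\<integral>\<^sup>+y. indicator {z. dist (fst z) (snd z) \<le> r} (x, y) \<partial>M) = (\<integral>\<^sup>+y. indicator (cball x r) y \<partial>M)"
        by (rule nn_integral_cong) (auto split: split_indicator)
      then show "\<phi> x = (\<integral>\<^sup>+y. indicator {z. dist (fst z) (snd z) \<le> r} (x, y) \<partial>M)" by (simp add: \<phi>_def)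
    qed
    also have "\<dots> = (\<integral>\<^sup>+y. \<integral>\<^sup>+x. indicator {z. dist (fst z) (snd z) \<le> r} (x, y) \<partial>lborel \<partial>M)"
      by (rule R.Fubini'[symmetric]) (use mset in \<open>simp add: case_prod_unfold\<close>)
    also have "\<dots> = (\<integral>\<^sup>+y. ennreal (\<omega> * r ^ ?d) \<partial>M)"
    proof (rule nn_integral_cong)
      fix y :: 'a
      have "(\<integral>\<^sup>+x. indicator {z. dist (fst z) (snd z) \<le> r} (x, y) \<partial>lborel) = (\<integral>\<^sup>+x. indicator (cball y r) x \<partial>lborel)"
        by (rule nn_integral_cong) (auto split: split_indicator simp: dist_commute)
      then show "(\<integral>\<^sup>+x. indicator {z. dist (fst z) (snd z) \<le> r} (x, y) \<partial>lborel) = ennreal (\<omega> * r ^ ?d)"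
        using r by (simp add: vol)
    qed
    finally show ?thesis using emeasure_space_1 by simp
  qed
  have i2: "(\<integral>\<^sup>+x. (\<phi> x)\<^sup>2 \<partial>lborel) \<le> ennreal (C * (2 * r) ^ ?d * (\<omega> * r ^ ?d))"
  proof -
    let ?I = "\<lambda>x p. indicator {z. dist (fst z) (fst (snd z)) \<le> r \<and> dist (fst z) (snd (snd z)) \<le> r} (x, p) :: ennreal"
    let ?D = "{p::'a \<times> 'a. dist (fst p) (snd p) \<le> 2 * r}"
    have "Measurable.pred (lborel \<Otimes>\<^sub>M ?P) (\<lambda>z. dist (fst z) (fst (snd z)) \<le> r \<and> dist (fst z) (snd (snd z)) \<le> r)"
      by measurable
    then have T: "{z :: 'a \<times> 'a \<times> 'a. dist (fst z) (fst (snd z)) \<le> r \<and> dist (fst z) (snd (snd z)) \<le> r} \<in> sets (lborel \<Otimes>\<^sub>M ?P)"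
      by (simp add: pred_def space_pair_measure)
    have "Measurable.pred ?P (\<lambda>p. dist (fst p) (snd p) \<le> 2 * r)" by measurable
    then have D: "?D \<in> sets ?P" by (simp add: pred_def)
    have "(\<integral>\<^sup>+x. (\<phi> x)\<^sup>2 \<partial>lborel) = (\<integral>\<^sup>+x. \<integral>\<^sup>+p. ?I x p \<partial>?P \<partial>lborel)"
    proof (rule nn_integral_cong)
      fix x :: 'a
      have "(\<integral>\<^sup>+p. ?I x p \<partial>?P) = (\<integral>\<^sup>+p. indicator (cball x r \<times> cball x r) p \<partial>?P)"
        by (rule nn_integral_cong) (auto split: split_indicator)
      also have "\<dots> = emeasure ?P (cball x r \<times> cball x r)" by (rule nn_integral_indicator) simp
      also have "\<dots> = \<phi> x * \<phi> x" unfolding \<phi>_def by (rule emeasure_pair_measure_Times) simp_all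
      finally show "(\<phi> x)\<^sup>2 = (\<integral>\<^sup>+p. ?I x p \<partial>?P)" by (simp add: power2_eq_square)
    qed
    also have "\<dots> = (\<integral>\<^sup>+p. \<integral>\<^sup>+x. ?I x p \<partial>lborel \<partial>?P)"
      by (rule Q.Fubini'[symmetric]) (use T in \<open>simp add: case_prod_unfold\<close>)
    also have "\<dots> \<le> (\<integral>\<^sup>+p. ennreal (\<omega> * r ^ ?d) * indicator ?D p \<partial>?P)"
    proof (rule nn_integral_mono)
      fix p :: "'a \<times> 'a"
      show "(\<integral>\<^sup>+x. ?I x p \<partial>lborel) \<le> ennreal (\<omega> * r ^ ?d) * indicator ?D p"
      proof (cases "p \<in> ?D")
        case True
        have "(\<integral>\<^sup>+x. ?I x p \<partial>lborel) \<le> (\<integral>\<^sup>+x. indicator (cball (fst p) r) x \<partial>lborel)"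
          by (rule nn_integral_mono) (auto split: split_indicator simp: dist_commute)
        then show ?thesis using True r by (simp add: vol)
      next
        case False
        have "?I x p = 0" for x
          using False dist_triangle3[of "fst p" "snd p" x] by (auto split: split_indicator)
        then show ?thesis by simp
      qed
    qed
    also have "\<dots> = ennreal (\<omega> * r ^ ?d) * emeasure ?P ?D" by (rule nn_integral_cmult_indicator[OF D])
    also have "\<dots> \<le> ennreal (\<omega> * r ^ ?d) * ennreal (C * (2 * r) ^ ?d)"
      using r by (intro mult_left_mono C(2)) auto
    also have "\<dots> = ennreal (C * (2 * r) ^ ?d * (\<omega> * r ^ ?d))"
      using C(1) \<omega> r by (simp add: mult.commute flip: ennreal_mult)
    finally show ?thesis .
  qed
  have \<phi>U: "\<phi> x = \<phi> x * indicator U x" for x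
  proof (cases "x \<in> U")
    case False
    have "cball x r \<subseteq> - S"
    proof
      fix y assume y: "y \<in> cball x r"
      show "y \<in> - S"
      proof
        assume "y \<in> S"
        moreover have "x \<in> cball y r0" using y r by (auto simp: dist_commute)
        ultimately show False using r0(2) False by blast
      qed
    qed
    then have "\<phi> x \<le> emeasure M (- S)" unfolding \<phi>_def using Sb by (intro emeasure_mono) auto
    then show ?thesis using S(2) by simp
  qed simp
  have "(\<integral>\<^sup>+x. \<phi> x * indicator U x \<partial>lborel)\<^sup>2 \<le> (\<integral>\<^sup>+x. (\<phi> x)\<^sup>2 \<partial>lborel) * (\<integral>\<^sup>+x. (indicator U x)\<^sup>2 \<partial>lborel)"
    using U(1) by (intro Cauchy_Schwarz_nn_integral) auto
  also have "(\<integral>\<^sup>+x. (indicator U x)\<^sup>2 \<partial>lborel) = (\<integral>\<^sup>+x. indicator U x \<partial>lborel)"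
    by (rule nn_integral_cong) (auto split: split_indicator)
  also have "\<dots> = emeasure lborel U" using U(1) by simp
  also have "(\<integral>\<^sup>+x. \<phi> x * indicator U x \<partial>lborel) = (\<integral>\<^sup>+x. \<phi> x \<partial>lborel)"
    by (rule nn_integral_cong) (rule \<phi>U[symmetric])
  also note i1
  also have "(\<integral>\<^sup>+x. (\<phi> x)\<^sup>2 \<partial>lborel) * emeasure lborel U \<le> ennreal (C * (2 * r) ^ ?d * (\<omega> * r ^ ?d)) * ennreal e"
    by (intro mult_mono i2 Ue) auto
  finally have "ennreal ((\<omega> * r ^ ?d)\<^sup>2) \<le> ennreal (C * (2 * r) ^ ?d * (\<omega> * r ^ ?d) * e)"
    using C(1) \<omega> r e by (simp add: ennreal_power flip: ennreal_mult)
  then have "(\<omega> * r ^ ?d)\<^sup>2 \<le> C * (2 * r) ^ ?d * (\<omega> * r ^ ?d) * e"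
    using C(1) \<omega> r e by (simp add: ennreal_le_iff)
  then have "(\<omega> * (r ^ ?d)\<^sup>2) * \<omega> \<le> (\<omega> * (r ^ ?d)\<^sup>2) * (C * 2 ^ ?d * e)"
    by (simp add: power2_eq_square power_mult_distrib mult_ac)
  then have "\<omega> \<le> C * 2 ^ ?d * e" using \<omega> r by (simp add: mult_le_cancel_left)
  also have "\<dots> \<le> (C * 2 ^ ?d + 1) * e" using e by (intro mult_right_mono) auto
  also have "\<dots> = \<omega> / 2"
  proof -
    have "X * (\<omega> / (2 * X)) = \<omega> / 2" if "0 < X" for X using that by simp
    moreover have "0 < C * 2 ^ ?d + 1" using C(1) by (intro add_nonneg_pos) auto
    ultimately show ?thesis unfolding e_def by blast
  qed
  finally show False using \<omega> by simp
qed

lemma hausdorff_measure_mono: "E \<subseteq> F \<Longrightarrow> hausdorff_measure s E \<le> hausdorff_measure s F"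
  unfolding hausdorff_measure_def hausdorff_content_def
  by (intro SUP_mono' INF_superset_mono) auto

text \<open>The mass distribution principle with a ball bound only at centres in \<open>G\<close>
  and small dyadic radii. A cover set that meets \<open>G\<close> lies in a ball about one of its
  points in \<open>G\<close>, with its diameter as radius; the factor \<open>2 powr u\<close> rounds
  radii up to dyadic ones.\<close>

lemma hausdorff_measure_pos_if_ball_le:
  fixes M :: "'a::euclidean_space measure" and u \<delta> :: real
  assumes sM [simp]: "sets M = sets borel" and G: "G \<in> sets borel" "0 < emeasure M (S \<inter> G)" and S: "S \<in> sets borel"
    and u: "0 < u" and \<delta>: "\<delta> = (1/2) ^ k0"
    and ball: "\<And>x k. x \<in> G \<Longrightarrow> k0 \<le> k \<Longrightarrow> emeasure M (cball x ((1/2) ^ k)) \<le> ennreal (((1/2) ^ k) powr u)"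
  shows "0 < hausdorff_measure u S"
proof -
  have \<delta>0: "0 < \<delta>" "\<delta> \<le> 1" by (auto simp: \<delta> power_le_one)
  have ballt: "emeasure M (cball x t) \<le> ennreal (2 powr u * t powr u)" if x: "x \<in> G" and t: "0 \<le> t" "t \<le> \<delta>" for x t
  \<comment> \<open>Cover sets may be single points, which have diameter power 0. They carry no
    mass, by the ball bound along radii tending to 0.\<close>
  proof (cases "t = 0")
    case True
    have "emeasure M (cball x t) \<le> 0"
    proof (rule LIMSEQ_le_const)
      have "(\<lambda>k. ennreal (((1/2) powr u) ^ k)) \<longlonglongrightarrow> ennreal 0"
        using powr_less_mono2[of u "1/2" 1] u by (intro tendsto_ennrealI LIMSEQ_power_zero) simp
      then show "(\<lambda>k. ennreal (((1/2) powr u) ^ k)) \<longlonglongrightarrow> 0" by simp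
      have "emeasure M (cball x t) \<le> ennreal (((1/2) powr u) ^ k)" if "k0 \<le> k" for k
      proof -
        have "emeasure M (cball x t) \<le> emeasure M (cball x ((1/2) ^ k))"
          using True by (intro emeasure_mono subset_cball) auto
        also have "\<dots> \<le> ennreal (((1/2) ^ k) powr u)" by (rule ball[OF x that])
        also have "((1/2) ^ k) powr u = (((1/2)::real) powr u) ^ k"
          by (simp add: powr_powr mult.commute flip: powr_realpow)
        finally show ?thesis .
      qed
      then show "\<exists>N. \<forall>n\<ge>N. emeasure M (cball x t) \<le> ennreal (((1/2) powr u) ^ n)" by blast
    qed
    then show ?thesis by simp
  next
    case False
    then have t0: "0 < t" "t \<le> 1" using t \<delta>0 by auto
    obtain k where k: "(1/2) ^ Suc k < t" "t \<le> (1/2) ^ k" by (rule dyadic_scale[OF t0])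
    have "k0 \<le> k"
    proof (rule ccontr)
      assume "\<not> k0 \<le> k"
      then have "(1/2::real) ^ k0 \<le> (1/2) ^ Suc k" by (intro power_decreasing) auto
      then show False using k(1) t(2) by (simp add: \<delta>)
    qed
    have "emeasure M (cball x t) \<le> emeasure M (cball x ((1/2) ^ k))"
      using k(2) by (intro emeasure_mono subset_cball) auto
    also have "\<dots> \<le> ennreal (((1/2) ^ k) powr u)" by (rule ball[OF x \<open>k0 \<le> k\<close>])
    also have "\<dots> \<le> ennreal ((2 * t) powr u)"
      using k(1) u by (intro ennreal_leI powr_mono2) auto
    also have "(2 * t) powr u = 2 powr u * t powr u" using t0 by (simp add: powr_mult)
    finally show ?thesis .
  qed
  have bound: "emeasure M (S \<inter> G) \<le> ennreal (2 powr u) * hausdorff_content \<delta> u S"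
  proof -
    have "emeasure M (S \<inter> G) \<le> ennreal (2 powr u) * (\<Sum>i. ennreal (diameter_power u (U i)))"
      if U: "S \<subseteq> (\<Union>i. U i)" "\<And>i. bounded (U i) \<and> diameter (U i) \<le> \<delta>" for U :: "nat \<Rightarrow> 'a set"
    proof -
      define V where "V i = (if U i \<inter> G = {} then {} else cball (SOME x. x \<in> U i \<inter> G) (diameter (U i)))" for i
      have x: "(SOME x. x \<in> U i \<inter> G) \<in> U i \<inter> G" if "U i \<inter> G \<noteq> {}" for i
        using that by (metis some_in_eq)
      have "S \<inter> G \<subseteq> (\<Union>i. V i)"
      proof
        fix y assume y: "y \<in> S \<inter> G"
        then obtain i where i: "y \<in> U i" using U(1) by auto
        then have ne: "U i \<inter> G \<noteq> {}" using y by auto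
        have "dist (SOME x. x \<in> U i \<inter> G) y \<le> diameter (U i)"
          using x[OF ne] i U(2)[of i] by (intro diameter_bounded_bound) auto
        then have "y \<in> V i" using ne by (simp add: V_def)
        then show "y \<in> (\<Union>i. V i)" by blast
      qed
      then have "emeasure M (S \<inter> G) \<le> emeasure M (\<Union>i. V i)"
        by (intro emeasure_mono) (auto simp: V_def)
      also have "\<dots> \<le> (\<Sum>i. emeasure M (V i))"
        by (intro emeasure_subadditive_countably) (auto simp: V_def)
      also have "\<dots> \<le> (\<Sum>i. ennreal (2 powr u) * ennreal (diameter_power u (U i)))"
      proof (intro suminf_le summableI)
        fix i
        show "emeasure M (V i) \<le> ennreal (2 powr u) * ennreal (diameter_power u (U i))"
        proof (cases "U i \<inter> G = {}")
          case False
          then have "emeasure M (V i) \<le> ennreal (2 powr u * diameter (U i) powr u)"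
            unfolding V_def using x[OF False] U(2)[of i] diameter_ge_0 by (auto intro!: ballt)
          then show ?thesis using False u by (auto simp: diameter_power_def ennreal_mult)
        qed (simp add: V_def)
      qed
      also have "\<dots> = ennreal (2 powr u) * (\<Sum>i. ennreal (diameter_power u (U i)))"
        by (rule ennreal_suminf_cmult)
      finally show ?thesis .
    qed
    then have "emeasure M (S \<inter> G) / ennreal (2 powr u) \<le> hausdorff_content \<delta> u S"
      unfolding hausdorff_content_def
      by (intro INF_greatest) (auto simp: divide_le_posI_ennreal mult.commute)
    then have "ennreal (2 powr u) * (emeasure M (S \<inter> G) / ennreal (2 powr u)) \<le>
        ennreal (2 powr u) * hausdorff_content \<delta> u S"
      by (rule mult_left_mono) simp
    moreover have "ennreal (2 powr u) * (emeasure M (S \<inter> G) / ennreal (2 powr u)) = emeasure M (S \<inter> G)"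
      by (simp add: ennreal_times_divide mult.commute[of "ennreal _"] mult_divide_eq_ennreal)
    ultimately show ?thesis by simp
  qed
  have "hausdorff_content \<delta> u S \<noteq> 0" using bound G(2) by auto
  moreover have "hausdorff_content \<delta> u S \<le> hausdorff_measure u S"
    unfolding hausdorff_measure_def using \<delta>0 by (intro SUP_upper) auto
  ultimately show ?thesis by (auto simp: zero_less_iff_neq_zero)
qed

text \<open>The integral of the ball masses is the mass of close pairs. By Markov's inequality the
  set \<open>Bad k\<close>, where the bound of order u fails, has mass at most
  \<open>C * r k powr (v - u)\<close>. This is summable, so a late tail of bad sets leaves positive
  mass in \<open>S\<close>.\<close>

lemma hausdorff_measure_pos_if_close_pairs:
  fixes M :: "'a::euclidean_space measure" and u v C :: real
  assumes "prob_space M" and M [measurable_cong, simp]: "sets M = sets borel"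
    and S: "S \<in> sets borel" "emeasure M (- S) = 0" and u: "0 < u" "u < v"
    and C: "0 \<le> C" "\<And>r. 0 < r \<Longrightarrow> r \<le> 1 \<Longrightarrow>
    emeasure (M \<Otimes>\<^sub>M M) {p. dist (fst p) (snd p) \<le> r} \<le> ennreal (C * r powr v)"
  shows "0 < hausdorff_measure u S"
proof -
  interpret prob_space M by fact
  let ?P = "M \<Otimes>\<^sub>M M"
  have spM [simp]: "space M = UNIV" using sets_eq_imp_space_eq[OF M] by simp
  have spP [simp]: "space ?P = UNIV" by (simp add: space_pair_measure)
  define r where "r k = (1/2::real) ^ k" for k
  have r: "0 < r k" "r k \<le> 1" for k by (auto simp: r_def power_le_one)
  define \<phi> where "\<phi> k x = emeasure M (cball x (r k))" for k x
  have Dk: "{p. dist (fst p) (snd p) \<le> r k} \<in> sets ?P" for k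
  proof -
    have "Measurable.pred ?P (\<lambda>p. dist (fst p) (snd p) \<le> r k)" by measurable
    then show ?thesis by (simp add: pred_def)
  qed
  have eq: "Pair x -` {z. dist (fst z) (snd z) \<le> r k} = cball x (r k)" for k and x :: 'a by auto
  have \<phi>_m: "\<phi> k \<in> borel_measurable M" for k
    using measurable_emeasure_Pair[OF Dk[of k]] unfolding eq \<phi>_def[abs_def] .
  have \<phi>_int: "(\<integral>\<^sup>+x. \<phi> k x \<partial>M) \<le> ennreal (C * r k powr v)" for k
  proof -
    have "(\<integral>\<^sup>+x. \<phi> k x \<partial>M) = emeasure ?P {p. dist (fst p) (snd p) \<le> r k}"
      using emeasure_pair_measure_alt[OF Dk[of k]] unfolding eq \<phi>_def by simp
    also have "\<dots> \<le> ennreal (C * r k powr v)" by (rule C(2)[OF r])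
    finally show ?thesis .
  qed
  define Bad where "Bad k = {x. ennreal (r k powr u) < \<phi> k x}" for k
  have Bad_m: "Bad k \<in> sets M" for k
  proof -
    have "{x\<in>space M. ennreal (r k powr u) < \<phi> k x} \<in> sets M"
      by (rule borel_measurable_less[OF borel_measurable_const \<phi>_m])
    then show ?thesis by (simp only: Bad_def spM UNIV_I simp_thms)
  qed
  have Bad_le: "emeasure M (Bad k) \<le> ennreal (C * (2 powr (u - v)) ^ k)" for k
  proof -
    have ru: "0 < r k powr u" using r[of k] by simp
    have "ennreal (r k powr u) * emeasure M (Bad k) = (\<integral>\<^sup>+x. ennreal (r k powr u) * indicator (Bad k) x \<partial>M)"
      by (rule nn_integral_cmult_indicator[symmetric]) (rule Bad_m)
    also have "\<dots> \<le> (\<integral>\<^sup>+x. \<phi> k x \<partial>M)"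
      by (rule nn_integral_mono) (auto simp: Bad_def split: split_indicator)
    also have "\<dots> \<le> ennreal (C * r k powr v)" by (rule \<phi>_int)
    finally have "ennreal (r k powr - u) * (ennreal (r k powr u) * emeasure M (Bad k)) \<le> ennreal (r k powr - u) * ennreal (C * r k powr v)"
      by (rule mult_left_mono) simp
    moreover have "ennreal (r k powr - u) * (ennreal (r k powr u) * emeasure M (Bad k)) = emeasure M (Bad k)"
    proof -
      have "ennreal (r k powr - u) * ennreal (r k powr u) = ennreal (r k powr - u * r k powr u)"
        by (rule ennreal_mult[symmetric]) auto
      also have "r k powr - u * r k powr u = 1"
        using r(1)[of k] by (simp add: powr_add[symmetric])
      finally show ?thesis by (simp add: mult.assoc[symmetric])
    qed
    moreover have "ennreal (r k powr - u) * ennreal (C * r k powr v) = ennreal (C * (2 powr (u - v)) ^ k)"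
    proof -
      have "ennreal (r k powr - u) * ennreal (C * r k powr v) = ennreal (r k powr - u * (C * r k powr v))"
        by (rule ennreal_mult[symmetric]) (use C(1) in auto)
      also have "r k powr - u * (C * r k powr v) = C * r k powr (v - u)"
        by (simp add: powr_diff powr_minus field_simps)
      also have "r k powr (v - u) = (2 powr (u - v)) ^ k"
      proof -
        have r2: "r k = 2 powr (- real k)"
          unfolding r_def powr_minus_divide by (simp add: powr_realpow power_one_over)
        have "(2 powr (u - v)) ^ k = 2 powr ((u - v) * k)" by (subst powr_realpow[symmetric]) (auto simp: powr_powr)
        then show ?thesis unfolding r2 powr_powr by (simp add: algebra_simps)
      qed
      finally show ?thesis .
    qed
    ultimately show ?thesis by simp
  qed
  define q where "q = 2 powr (u - v)"
  have q: "0 < q" "q < 1" using u powr_less_mono[of "u - v" 0 2] by (auto simp: q_def)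
  have "(\<lambda>k. C / (1 - q) * q ^ k) \<longlonglongrightarrow> C / (1 - q) * 0"
    using q by (intro tendsto_intros LIMSEQ_power_zero) auto
  then have "\<forall>\<^sub>F k in sequentially. C / (1 - q) * q ^ k < 1"
    by (simp add: order_tendsto_iff)
  \<comment> \<open>The quantity is the sum of the geometric tail from \<open>k0\<close> on, so the
    bad sets from there on cannot fill the unit mass.\<close>
  then obtain k0 where k0: "C / (1 - q) * q ^ k0 < 1" by (auto simp: eventually_sequentially)
  define BB where "BB = (\<Union>i. Bad (i + k0))"
  have BB_m: "BB \<in> sets M" using Bad_m by (auto simp: BB_def)
  have "emeasure M BB \<le> (\<Sum>i. emeasure M (Bad (i + k0)))"
    unfolding BB_def using Bad_m by (intro emeasure_subadditive_countably) auto
  also have "\<dots> \<le> (\<Sum>i. ennreal (C * q ^ k0 * q ^ i))"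
  proof (intro suminf_le summableI)
    fix i
    have "C * q ^ (i + k0) = C * q ^ k0 * q ^ i" by (simp add: power_add)
    then show "emeasure M (Bad (i + k0)) \<le> ennreal (C * q ^ k0 * q ^ i)"
      using Bad_le[of "i + k0"] unfolding q_def by (simp only:)
  qed
  also have "\<dots> = ennreal (C * q ^ k0 * (1 / (1 - q)))"
  proof (rule suminf_ennreal_eq)
    show "(\<lambda>i. C * q ^ k0 * q ^ i) sums (C * q ^ k0 * (1 / (1 - q)))"
      using q by (intro sums_mult geometric_sums) simp
  qed (use q C(1) in auto)
  also have "\<dots> < 1" using k0 by (simp add: mult_ac)
  finally have BB: "emeasure M BB < 1" .
  have "0 < emeasure M (S \<inter> - BB)"
  proof (rule ccontr)
    assume "\<not> ?thesis"
    then have z: "emeasure M (S \<inter> - BB) = 0" by simp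
    have "1 = emeasure M UNIV" using emeasure_space_1 by simp
    also have "\<dots> \<le> emeasure M ((S \<inter> - BB \<union> - S) \<union> BB)" using S(1) BB_m by (intro emeasure_mono) auto
    also have "\<dots> \<le> emeasure M (S \<inter> - BB \<union> - S) + emeasure M BB"
      using S(1) BB_m by (intro emeasure_subadditive) auto
    also have "\<dots> \<le> (emeasure M (S \<inter> - BB) + emeasure M (- S)) + emeasure M BB"
      using S(1) BB_m by (intro add_right_mono emeasure_subadditive) auto
    also have "\<dots> = emeasure M BB" using z S(2) by simp
    finally show False using BB by simp
  qed
  then show ?thesis
  proof (rule hausdorff_measure_pos_if_ball_le[OF M _ _ S(1) u(1) refl, rotated])
    show "- BB \<in> sets borel" using BB_m by auto
    fix x k assume x: "x \<in> - BB" and k: "k0 \<le> k"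
    have "x \<notin> Bad ((k - k0) + k0)" using x unfolding BB_def by blast
    then show "emeasure M (cball x ((1/2) ^ k)) \<le> ennreal (((1/2) ^ k) powr u)"
      using k by (simp add: Bad_def \<phi>_def r_def not_less)
  qed
qed

section \<open>Construction on the sum set and conclusion\<close>

text \<open>One construction serves all three assertions. The transform of a convolution is a
  product, so squared decay of order \<open>\<alpha>\<close> on the side of \<open>A\<close> reduces
  energy of order v to energy of order \<open>v - \<alpha>\<close> of the Frostman measure. Here v
  may be negative or exceed the dimension of the space.\<close>

lemma sumset_measure:
  fixes A B :: "'a::euclidean_space set" and v :: real
  assumes B: "B \<in> sets borel" and v: "ereal v < fourier_dim A + hausdorff_dim B"
  obtains M S where "prob_space M" "sets M = sets borel" "compact S" "S \<subseteq> A + B" "emeasure M (- S) = 0"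
    "sobolev_energy M v < \<infinity>"
proof -
  let ?d = "real DIM('a)"
  have F: "fourier_dim A \<le> ereal ?d"
    unfolding fourier_dim_def by (intro Sup_least) auto
  have H: "hausdorff_dim B \<le> ereal ?d" by (rule hausdorff_dim_le_DIM)
  \<comment> \<open>Both dimensions are bounded above, and the value minus infinity of an empty set
    is excluded because \<open>ereal v\<close> lies below the sum.\<close>
  obtain f h where fh: "fourier_dim A = ereal f" "hausdorff_dim B = ereal h"
    using F H v by (cases "fourier_dim A"; cases "hausdorff_dim B") auto
  \<comment> \<open>Each dimension may lose \<open>e\<close>, so that
    \<open>\<alpha> + \<beta>\<close> still exceeds v.\<close>
  define e where "e = (f + h - v) / 2"
  have e: "0 < e" using v by (simp add: fh e_def)
  have "ereal (f - e) < fourier_dim A" using e by (simp add: fh)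
  then obtain \<alpha> \<mu> C where \<alpha>: "f - e < \<alpha>" and \<mu>: "\<mu> \<in> radon_measures_on A" and C: "0 < C"
    "\<And>x. cmod (fourier_transform \<mu> x) \<le> C * (1 + norm x) powr (- \<alpha> / 2)"
    unfolding fourier_dim_def less_Sup_iff by auto
  have "ereal (h - e) < hausdorff_dim B" using e by (simp add: fh)
  then obtain \<beta> where \<beta>: "h - e < \<beta>" "0 \<le> \<beta>" "0 < hausdorff_measure \<beta> B"
    unfolding hausdorff_dim_def less_Sup_iff by auto
  have v\<beta>: "v - \<alpha> < \<beta>" using \<alpha> \<beta>(1) by (simp add: e_def field_simps)
  obtain N K D where N: "prob_space N" "sets N = sets borel" "compact K" "K \<subseteq> B"
    "emeasure N (- K) = 0" "0 \<le> D" "\<And>x r. 0 < r \<Longrightarrow> emeasure N (cball x r) \<le> ennreal (D * r powr \<beta>)"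
    by (rule frostman[OF B \<beta>(2,3)]) (rule that)
  have SN: "sobolev_energy N (v - \<alpha>) < \<infinity>"
    by (rule sobolev_energy_finite[OF N(1,2) \<beta>(2) N(6) N(7) v\<beta>])
  obtain M0 S0 c where M0: "prob_space M0" "sets M0 = sets borel" "compact S0" "S0 \<subseteq> A" "emeasure M0 (- S0) = 0"
    "0 \<le> c" "\<And>\<xi>. norm (fourier_transform M0 \<xi>) = c * norm (fourier_transform \<mu> \<xi>)"
    by (rule radon_measures_on_prob[OF \<mu>]) (rule that)
  note [measurable_cong, simp] = M0(2) N(2)
  interpret M0: prob_space M0 by fact
  interpret N: prob_space N by fact
  interpret P: pair_prob_space M0 N ..
  have sp [simp]: "space M0 = UNIV" "space N = UNIV"
    using sets_eq_imp_space_eq[OF M0(2)] sets_eq_imp_space_eq[OF N(2)] by auto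
  let ?R = "distr (M0 \<Otimes>\<^sub>M N) borel (\<lambda>p. fst p + snd p)"
  let ?S = "(\<lambda>p. fst p + snd p) ` (S0 \<times> K)"
  have add_m: "(\<lambda>p. fst p + snd p) \<in> borel_measurable (M0 \<Otimes>\<^sub>M N)" by measurable
  show thesis
  proof
    show "prob_space ?R" by (rule P.prob_space_distr[OF add_m])
    show "sets ?R = sets borel" by simp
    show cS: "compact ?S"
      by (intro compact_continuous_image continuous_intros compact_Times M0(3) N(3))
    show "?S \<subseteq> A + B" using M0(4) N(4) by (auto intro!: set_plus_intro)
    have b: "- S0 \<in> sets borel" "- K \<in> sets borel" "- ?S \<in> sets borel"
      using M0(3) N(3) cS by (auto intro!: borel_open open_Compl compact_imp_closed)
    have "emeasure ?R (- ?S) = emeasure (M0 \<Otimes>\<^sub>M N) ((\<lambda>p. fst p + snd p) -` (- ?S) \<inter> space (M0 \<Otimes>\<^sub>M N))"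
      by (rule emeasure_distr[OF add_m b(3)])
    also have "\<dots> \<le> emeasure (M0 \<Otimes>\<^sub>M N) (((- S0) \<times> UNIV) \<union> (UNIV \<times> (- K)))"
    proof (rule emeasure_mono)
      have "fst p + snd p \<in> ?S" if "fst p \<in> S0" "snd p \<in> K" for p
        using that by (intro image_eqI[of _ _ p]) (auto simp: mem_Times_iff)
      then show "(\<lambda>p. fst p + snd p) -` (- ?S) \<inter> space (M0 \<Otimes>\<^sub>M N) \<subseteq> ((- S0) \<times> UNIV) \<union> (UNIV \<times> (- K))"
        by (auto simp: mem_Times_iff simp del: image_iff)
    qed (use b in \<open>auto intro!: sets.Un pair_measureI\<close>)
    also have "\<dots> \<le> emeasure (M0 \<Otimes>\<^sub>M N) ((- S0) \<times> UNIV) + emeasure (M0 \<Otimes>\<^sub>M N) (UNIV \<times> (- K))"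
      using b by (intro emeasure_subadditive pair_measureI) auto
    also have "\<dots> = emeasure M0 (- S0) * emeasure N UNIV + emeasure M0 UNIV * emeasure N (- K)"
      using b by (intro arg_cong2[of _ _ _ _ "(+)"] N.emeasure_pair_measure_Times) auto
    also have "\<dots> = 0" using M0(5) N(5) by simp
    finally show "emeasure ?R (- ?S) = 0" by simp
    have "sobolev_energy ?R v \<le> (\<integral>\<^sup>+x. ennreal ((c * C)\<^sup>2) *
        ennreal ((cmod (fourier_transform N x))\<^sup>2 * (1 + norm x) powr (v - \<alpha> - ?d)) \<partial>lborel)"
      unfolding sobolev_energy_def
    proof (rule nn_integral_mono)
      fix x :: 'a
      have "cmod (fourier_transform M0 x) \<le> c * (C * (1 + norm x) powr (- \<alpha> / 2))"
        unfolding M0(7) by (intro mult_left_mono C(2) M0(6))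
      then have "(cmod (fourier_transform M0 x))\<^sup>2 \<le> (c * (C * (1 + norm x) powr (- \<alpha> / 2)))\<^sup>2"
        by (rule power_mono) simp
      also have "\<dots> = (c * C)\<^sup>2 * ((1 + norm x) powr (- \<alpha> / 2))\<^sup>2" by (simp add: power_mult_distrib)
      also have "((1 + norm x) powr (- \<alpha> / 2))\<^sup>2 = (1 + norm x) powr - \<alpha>"
        by (simp add: power2_eq_square powr_add[symmetric])
      finally have m: "(cmod (fourier_transform M0 x))\<^sup>2 \<le> (c * C)\<^sup>2 * (1 + norm x) powr - \<alpha>" .
      have "(cmod (fourier_transform ?R x))\<^sup>2 * (1 + norm x) powr (v - ?d) =
        (cmod (fourier_transform M0 x))\<^sup>2 * ((cmod (fourier_transform N x))\<^sup>2 * (1 + norm x) powr (v - ?d))"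
        using fourier_transform_sum[OF M0.finite_measure_axioms M0(2) N.finite_measure_axioms N(2), of x]
        by (simp add: norm_mult power_mult_distrib)
      also have "\<dots> \<le> ((c * C)\<^sup>2 * (1 + norm x) powr - \<alpha>) * ((cmod (fourier_transform N x))\<^sup>2 * (1 + norm x) powr (v - ?d))"
        by (rule mult_right_mono[OF m]) simp
      also have "\<dots> = (c * C)\<^sup>2 * ((cmod (fourier_transform N x))\<^sup>2 * ((1 + norm x) powr - \<alpha> * (1 + norm x) powr (v - ?d)))"
        by (simp only: mult_ac)
      also have "(1 + norm x) powr - \<alpha> * (1 + norm x) powr (v - ?d) = (1 + norm x) powr (v - \<alpha> - ?d)"
        by (simp add: powr_add[symmetric] algebra_simps)
      finally have "ennreal ((cmod (fourier_transform ?R x))\<^sup>2 * (1 + norm x) powr (v - ?d)) \<le>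
        ennreal ((c * C)\<^sup>2 * ((cmod (fourier_transform N x))\<^sup>2 * (1 + norm x) powr (v - \<alpha> - ?d)))"
        by (rule ennreal_leI)
      also have "\<dots> = ennreal ((c * C)\<^sup>2) * ennreal ((cmod (fourier_transform N x))\<^sup>2 * (1 + norm x) powr (v - \<alpha> - ?d))"
        by (rule ennreal_mult) auto
      finally show "ennreal ((cmod (fourier_transform ?R x))\<^sup>2 * (1 + norm x) powr (v - ?d)) \<le>
         ennreal ((c * C)\<^sup>2) * ennreal ((cmod (fourier_transform N x))\<^sup>2 * (1 + norm x) powr (v - \<alpha> - ?d))" .
    qed
    also have "\<dots> = ennreal ((c * C)\<^sup>2) * sobolev_energy N (v - \<alpha>)"
      unfolding sobolev_energy_def
    proof (rule nn_integral_cmult)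
      have [measurable]: "fourier_transform N \<in> borel_measurable borel"
        by (rule borel_measurable_fourier_transform[OF N.finite_measure_axioms N(2)])
      show "(\<lambda>x. ennreal ((cmod (fourier_transform N x))\<^sup>2 * (1 + norm x) powr (v - \<alpha> - ?d))) \<in> borel_measurable lborel"
        by measurable
    qed
    also have "\<dots> < \<infinity>" using SN by (simp add: ennreal_mult_less_top)
    finally show "sobolev_energy ?R v < \<infinity>" .
  qed
qed

theorem theoremB:
  fixes A B :: "'a::euclidean_space set"
  assumes "A \<in> sets borel" and "B \<in> sets borel"
  shows "sobolev_dim (A + B) \<ge> fourier_dim A + hausdorff_dim B \<and>
    (fourier_dim A + hausdorff_dim B > ereal (real DIM('a)) \<longrightarrow>
      emeasure lebesgue (A + B) > 0) \<and>
    (\<forall>u::real. 0 < u \<and> u < real DIM('a) \<and> fourier_dim A + hausdorff_dim B > ereal u \<longrightarrow>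
      hausdorff_dim (A + B) \<ge> ereal u)"
proof (intro conjI impI allI)
  let ?d = "real DIM('a)"
  show "fourier_dim A + hausdorff_dim B \<le> sobolev_dim (A + B)"
  proof (rule ccontr)
    assume "\<not> ?thesis"
    then have "sobolev_dim (A + B) < fourier_dim A + hausdorff_dim B" by simp
    from ereal_dense2[OF this] obtain v
      where v: "sobolev_dim (A + B) < ereal v" "ereal v < fourier_dim A + hausdorff_dim B" by blast
    obtain M S where M: "prob_space M" "sets M = sets borel" "compact S" "S \<subseteq> A + B"
      "emeasure M (- S) = 0" "sobolev_energy M v < \<infinity>"
      by (rule sumset_measure[OF assms(2) v(2)])
    have "AE x in M. x \<in> A + B"
      by (rule AE_I'[of "- S"]) (use M borel_compact[OF M(3)] in \<open>auto simp: null_sets_def\<close>)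
    then have "carries_sobolev_measure (A + B) v"
      using M unfolding carries_sobolev_measure_def sobolev_energy_def by blast
    then have "ereal v \<le> sobolev_dim (A + B)"
      unfolding sobolev_dim_def by (intro Sup_upper) auto
    with v(1) show False by simp
  qed
next
  assume "ereal (real DIM('a)) < fourier_dim A + hausdorff_dim B"
  then obtain M S where M: "prob_space M" "sets M = sets borel" "compact S" "S \<subseteq> A + B"
    "emeasure M (- S) = 0" "sobolev_energy M DIM('a) < \<infinity>"
    by (rule sumset_measure[OF assms(2)])
  obtain C where C: "0 \<le> C" "\<And>r. 0 < r \<Longrightarrow> r \<le> 1 \<Longrightarrow>
    emeasure (M \<Otimes>\<^sub>M M) {p. dist (fst p) (snd p) \<le> r} \<le> ennreal (C * r powr DIM('a))"
    by (rule close_pairs_le[OF prob_space.finite_measure[OF M(1)] M(2) order_refl M(6)]) (rule that)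
  have "0 < emeasure lborel S"
    by (rule compact_measure_lebesgue_pos[OF M(1,2,3,5) C(1)]) (use C(2) in \<open>simp add: powr_realpow\<close>)
  also have "emeasure lborel S = emeasure lebesgue S" using borel_compact[OF M(3)] by simp
  also have "\<dots> \<le> emeasure lebesgue (A + B)"
    by (intro emeasure_mono M(4) lebesgue_measurable_sumset assms)
  finally show "0 < emeasure lebesgue (A + B)" .
next
  fix u :: real
  assume u: "0 < u \<and> u < real DIM('a) \<and> ereal u < fourier_dim A + hausdorff_dim B"
  \<comment> \<open>The energy order must exceed u strictly for the bad sets to be summable, and
    must not exceed the dimension of the space for \<open>close_pairs_le\<close>.\<close>
  then have "ereal u < min (ereal (real DIM('a))) (fourier_dim A + hausdorff_dim B)" by simp
  from ereal_dense2[OF this] obtain v where v: "u < v" "v \<le> DIM('a)" "ereal v < fourier_dim A + hausdorff_dim B"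
    by auto
  obtain M S where M: "prob_space M" "sets M = sets borel" "compact S" "S \<subseteq> A + B"
    "emeasure M (- S) = 0" "sobolev_energy M v < \<infinity>"
    by (rule sumset_measure[OF assms(2) v(3)])
  obtain C where C: "0 \<le> C" "\<And>r. 0 < r \<Longrightarrow> r \<le> 1 \<Longrightarrow>
    emeasure (M \<Otimes>\<^sub>M M) {p. dist (fst p) (snd p) \<le> r} \<le> ennreal (C * r powr v)"
    by (rule close_pairs_le[OF prob_space.finite_measure[OF M(1)] M(2) v(2) M(6)]) (rule that)
  have "0 < hausdorff_measure u S"
    by (rule hausdorff_measure_pos_if_close_pairs[OF M(1,2) borel_compact[OF M(3)] M(5) _ v(1) C]) (use u in auto)
  also have "\<dots> \<le> hausdorff_measure u (A + B)" by (rule hausdorff_measure_mono[OF M(4)])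
  finally have "0 < hausdorff_measure u (A + B)" .
  then show "ereal u \<le> hausdorff_dim (A + B)"
    unfolding hausdorff_dim_def using u by (intro Sup_upper) auto
qed

end
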